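(* There exists a real number $\mu>0$ such that the following holds. Let $p=p(n)$ satisfy $p\gg \frac{\log n}{n}$. Then asymptotically almost surely the random graph $G=G(n,p)$ has the following property: for every $\mu np$-bounded incompatibility system $\mathcal{F}$ over $G$, there exists a Hamilton cycle in $G$ that is compatible with $\mathcal{F}$.
   Context: $G(n,p)$ is the binomial random graph on $n$ vertices in which each pair of vertices is an edge independently with probability $p$. "Asymptotically almost surely" (a.a.s.) means with probability tending to $1$ as $n\to\infty$; $p\gg f(n)$ means $p/f(n)\to\infty$. Logarithms are natural. For a graph $G=(V,E)$, an incompatibility system $\mathcal{F}$ over $G$ is a family $\{F_v\}_{v\in V}$ where each $F_v$ is a set of unordered pairs $\{e,e'\}$ of distinct edges $e,e'\in E$ with $e\cap e'=\{v\}$. Two edges $e,e'$ are incompatible if $\{e,e'\}\in F_v$ for some $v$, and compatible otherwise. A subgraph $H\subseteq G$ is compatible with $\mathcal{F}$ if every pair of its edges is compatible. For a real $\Delta>0$, $\mathcal{F}$ is $\Delta$-bounded if for every vertex $v$ and every edge $e$ incident to $v$, there are at most $\Delta$ edges $e'$ incident to $v$ with $\{e,e'\}\in F_v$. *)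

theory Defs
  imports "HOL-Probability.Probability" "HOL-Probability.Product_PMF"
begin

text \<open>
  A graph is given by a vertex set \<open>V\<close> and a set \<open>E\<close> of edges, an edge being a two-element
  subset of \<open>V\<close>. Digraph libraries are not used, since incompatibility systems are about
  unordered pairs of undirected edges.
\<close>

definition all_edges :: "'a set \<Rightarrow> 'a set set" where
  "all_edges V = {e. e \<subseteq> V \<and> card e = 2}"

text \<open>The random graph \<open>G(n,p)\<close> on the vertex set \<open>{..<n}\<close>, as a distribution on edge sets.
  Outside \<open>[0,1]\<close>, \<^const>\<open>bernoulli_pmf\<close> clamps its parameter.\<close>

definition gnp :: "nat \<Rightarrow> real \<Rightarrow> nat set set pmf" where
  "gnp n p = map_pmf (\<lambda>f. {e \<in> all_edges {..<n}. f e})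
               (Pi_pmf (all_edges {..<n}) False (\<lambda>_. bernoulli_pmf p))"

definition asymptotically_almost_surely ::
    "(nat \<Rightarrow> 'a pmf) \<Rightarrow> (nat \<Rightarrow> 'a \<Rightarrow> bool) \<Rightarrow> bool" where
  "asymptotically_almost_surely M P \<longleftrightarrow>
     (\<lambda>n. measure_pmf.prob (M n) {x. P n x}) \<longlonglongrightarrow> 1"

text \<open>The family \<open>(F\<^sub>v)\<close> indexed by \<open>V\<close> is a total function on the vertex type; its values
  outside \<open>V\<close> are irrelevant and never consulted.\<close>

definition incompatibility_system ::
    "'a set \<Rightarrow> 'a set set \<Rightarrow> ('a \<Rightarrow> 'a set set set) \<Rightarrow> bool" where
  "incompatibility_system V E F \<longleftrightarrow>
     (\<forall>v\<in>V. \<forall>P\<in>F v. \<exists>e\<in>E. \<exists>e'\<in>E. P = {e, e'} \<and> e \<noteq> e' \<and> e \<inter> e' = {v})"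

definition incompatible ::
    "'a set \<Rightarrow> ('a \<Rightarrow> 'a set set set) \<Rightarrow> 'a set \<Rightarrow> 'a set \<Rightarrow> bool" where
  "incompatible V F e e' \<longleftrightarrow> (\<exists>v\<in>V. {e, e'} \<in> F v)"

text \<open>\<open>H\<close> is the edge set of the subgraph.\<close>

definition compatible_subgraph ::
    "'a set \<Rightarrow> ('a \<Rightarrow> 'a set set set) \<Rightarrow> 'a set set \<Rightarrow> bool" where
  "compatible_subgraph V F H \<longleftrightarrow>
     (\<forall>e\<in>H. \<forall>e'\<in>H. e \<noteq> e' \<longrightarrow> \<not> incompatible V F e e')"

text \<open>The cardinality is meaningful for locally finite graphs only; here \<open>V\<close> is always finite.\<close>

definition bounded_system ::
    "'a set \<Rightarrow> 'a set set \<Rightarrow> ('a \<Rightarrow> 'a set set set) \<Rightarrow> real \<Rightarrow> bool" where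
  "bounded_system V E F \<Delta> \<longleftrightarrow>
     (\<forall>v\<in>V. \<forall>e\<in>E. v \<in> e \<longrightarrow>
        real (card {e' \<in> E. v \<in> e' \<and> {e, e'} \<in> F v}) \<le> \<Delta>)"

definition cycle_edges :: "'a list \<Rightarrow> 'a set set" where
  "cycle_edges vs = {{vs ! i, vs ! (Suc i mod length vs)} | i. i < length vs}"

text \<open>A Hamilton cycle is a spanning subgraph, so it is determined by its edge set \<open>C\<close>.\<close>

definition hamilton_cycle :: "'a set \<Rightarrow> 'a set set \<Rightarrow> 'a set set \<Rightarrow> bool" where
  "hamilton_cycle V E C \<longleftrightarrow>
     C \<subseteq> E \<and>
     (\<exists>vs. distinct vs \<and> set vs = V \<and> length vs \<ge> 3 \<and> C = cycle_edges vs)"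

end

theory Submission
  imports Defs
begin

text \<open>
  Write \<open>a = n * p\<close>. A subgraph \<open>\<Gamma>\<close> with \<open>O(n)\<close> edges, all pairwise compatible, rules out only
  \<open>O(\<mu> * n * a)\<close> edges of \<open>G\<close>. If \<open>\<Gamma>\<close> expands small sets and joins all pairs of disjoint sets of
  linear size, then by Posa's rotations it is Hamiltonian or has quadratically many boosters, pairs
  whose addition makes it Hamiltonian or lengthens its longest path. Since \<open>\<Gamma>\<close> is sparse and
  \<open>a\<close> tends to infinity, a union bound over \<open>\<Gamma>\<close> shows that \<open>G\<close> contains a constant proportion of
  \<open>n * a\<close> boosters of each such \<open>\<Gamma>\<close>; for small \<open>\<mu>\<close> one of them is compatible with \<open>\<Gamma>\<close>. At most
  \<open>n + 1\<close> boosters are needed, so the sparsity is preserved.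

  The initial \<open>\<Gamma>\<close> is obtained in two steps. First, every vertex picks a bounded number of
  neighbours, each uniformly among the edges that are compatible with the previous picks; a
  potential function (method of conditional expectations) keeps the number of unusable edges small
  at every vertex and makes all sets of at most \<open>k = \<Theta>(n)\<close> vertices expand. Second, \<open>O(n)\<close> further
  compatible edges, chosen by averaging, join all disjoint pairs of \<open>k\<close>-sets.
\<close>

section \<open>Rotations and boosters\<close>

text \<open>The system \<open>F\<close> is chosen after the graph is revealed, and there are far too
  many systems for a union bound over them. Hence every property required of the random graph
  (degrees, spread, edges between large sets, boosters of sparse subgraphs) is free of
  \<open>F\<close>, which enters only in a deterministic argument afterwards. The obstacle in
  building the expander is a set \<open>U\<close> whose neighbours crowd into some \<open>Y\<close>
  with \<open>card Y = 4 * card U\<close>, where picks could stay. The spread property of the graph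
  says that most vertices of \<open>U\<close> have at most a fraction of order
  \<open>sqrt (card U / n)\<close> of their neighbours in \<open>Y\<close>. The square root is a
  compromise: pairs violating it are rare enough for a union bound, while 44 picks by each of half
  of the vertices of \<open>U\<close> still yield a factor of order
  \<open>(card U / n) ^ (11 * card U)\<close>. This beats the number of pairs \<open>(U, Y)\<close>,
  of order \<open>(n / card U) ^ (5 * card U)\<close>. The constants are convenient choices for such
  comparisons, not optimal ones.\<close>

definition path_in :: "'a set \<Rightarrow> 'a set set \<Rightarrow> 'a list \<Rightarrow> bool" where
  "path_in V E xs \<longleftrightarrow> distinct xs \<and> set xs \<subseteq> V \<and> successively (\<lambda>x y. {x, y} \<in> E) xs"

definition nbrs :: "'a set set \<Rightarrow> 'a \<Rightarrow> 'a set" where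
  "nbrs E v = {w. {v, w} \<in> E}"

definition outer_nbrs :: "'a set set \<Rightarrow> 'a set \<Rightarrow> 'a set" where
  "outer_nbrs E U = (\<Union>u\<in>U. nbrs E u) - U"

text \<open>On a path, the vertices of a set \<open>R\<close> have at most \<open>2 * card R\<close>
  path neighbours. Posa's argument needs an expansion factor above that; 3 is the least integer that
  works.\<close>

definition expanding :: "'a set \<Rightarrow> nat \<Rightarrow> 'a set set \<Rightarrow> bool" where
  "expanding V k E \<longleftrightarrow> (\<forall>U. U \<subseteq> V \<and> U \<noteq> {} \<and> card U \<le> k \<longrightarrow> 3 * card U \<le> card (outer_nbrs E U))"

definition cross_edges :: "'a set \<Rightarrow> 'a set \<Rightarrow> 'a set set" where
  "cross_edges U W = {{u, w} | u w. u \<in> U \<and> w \<in> W}"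

definition disjoint_pairs :: "'a set \<Rightarrow> nat \<Rightarrow> ('a set \<times> 'a set) set" where
  "disjoint_pairs V k = {(U, W). U \<subseteq> V \<and> W \<subseteq> V \<and> U \<inter> W = {} \<and> card U = k \<and> card W = k}"

definition joined :: "'a set \<Rightarrow> nat \<Rightarrow> 'a set set \<Rightarrow> bool" where
  "joined V k E \<longleftrightarrow> (\<forall>(U, W)\<in>disjoint_pairs V k. E \<inter> cross_edges U W \<noteq> {})"

definition hamiltonian :: "'a set \<Rightarrow> 'a set set \<Rightarrow> bool" where
  "hamiltonian V E \<longleftrightarrow> (\<exists>C. hamilton_cycle V E C)"

definition longest_path :: "'a set \<Rightarrow> 'a set set \<Rightarrow> 'a list \<Rightarrow> bool" where
  "longest_path V E xs \<longleftrightarrow> path_in V E xs \<and> (\<forall>ys. path_in V E ys \<longrightarrow> length ys \<le> length xs)"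

text \<open>Leaving out the edges of \<open>E\<close> makes the presence of boosters in the random
  graph independent of the event that it contains \<open>E\<close>. Comparing with all paths of
  \<open>E\<close> avoids a separate notion of maximal path length.\<close>

definition boosters :: "'a set \<Rightarrow> 'a set set \<Rightarrow> 'a set set" where
  "boosters V E = {e \<in> all_edges V - E. hamiltonian V (insert e E) \<or>
     (\<exists>xs. path_in V (insert e E) xs \<and> (\<forall>ys. path_in V E ys \<longrightarrow> length ys < length xs))}"

lemma all_edges_iff: "{x, y} \<in> all_edges V \<longleftrightarrow> x \<in> V \<and> y \<in> V \<and> x \<noteq> y"
  by (auto simp: all_edges_def card_insert_if)

lemma finite_all_edges: "finite V \<Longrightarrow> finite (all_edges V)"
  by (rule finite_subset[of _ "Pow V"]) (auto simp: all_edges_def)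

lemma nbrs_sym: "w \<in> nbrs E v \<longleftrightarrow> v \<in> nbrs E w"
  by (simp add: nbrs_def insert_commute)

lemma nbrs_subset: "E \<subseteq> all_edges V \<Longrightarrow> nbrs E v \<subseteq> V - {v}"
proof
  fix w assume "E \<subseteq> all_edges V" "w \<in> nbrs E v"
  hence "{v, w} \<in> all_edges V" by (auto simp: nbrs_def)
  thus "w \<in> V - {v}" by (auto simp: all_edges_iff)
qed

lemma nbrs_mono: "E \<subseteq> E' \<Longrightarrow> nbrs E v \<subseteq> nbrs E' v"
  by (auto simp: nbrs_def)

lemma finite_outer_nbrs: "E \<subseteq> all_edges V \<Longrightarrow> finite V \<Longrightarrow> finite (outer_nbrs E U)"
  using nbrs_subset[of E V] by (intro finite_subset[of "outer_nbrs E U" V]) (auto simp: outer_nbrs_def)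

lemma expanding_mono:
  assumes "expanding V k E" "E \<subseteq> E'" "E' \<subseteq> all_edges V" "finite V"
  shows "expanding V k E'"
  unfolding expanding_def
proof (intro allI impI)
  fix U assume U: "U \<subseteq> V \<and> U \<noteq> {} \<and> card U \<le> k"
  have "outer_nbrs E U \<subseteq> outer_nbrs E' U"
    using nbrs_mono[OF assms(2)] by (auto simp: outer_nbrs_def)
  hence "card (outer_nbrs E U) \<le> card (outer_nbrs E' U)"
    by (intro card_mono finite_outer_nbrs[OF assms(3,4)])
  thus "3 * card U \<le> card (outer_nbrs E' U)"
    using assms(1) U unfolding expanding_def by (meson le_trans)
qed

lemma disjoint_pairs_subset: "disjoint_pairs V k \<subseteq> Pow V \<times> Pow V"
  by (auto simp: disjoint_pairs_def)

lemma finite_disjoint_pairs: "finite V \<Longrightarrow> finite (disjoint_pairs V k)"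
  by (rule finite_subset[OF disjoint_pairs_subset]) simp

lemma card_disjoint_pairs:
  assumes "finite V" shows "card (disjoint_pairs V k) \<le> 4 ^ card V"
proof -
  have "card (disjoint_pairs V k) \<le> card (Pow V \<times> Pow V)"
    using assms by (intro card_mono disjoint_pairs_subset) auto
  thus ?thesis using assms by (simp add: card_cartesian_product card_Pow power_mult_distrib[symmetric])
qed

lemma joined_mono: "joined V k E \<Longrightarrow> E \<subseteq> E' \<Longrightarrow> joined V k E'"
  unfolding joined_def by blast

lemma length_path_le: "finite V \<Longrightarrow> path_in V E xs \<Longrightarrow> length xs \<le> card V"
  by (metis card_mono distinct_card path_in_def)

lemma longest_path_exists:
  assumes "finite V" shows "\<exists>xs. longest_path V E xs"
proof -
  have "path_in V E []" by (simp add: path_in_def)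
  then obtain xs where "path_in V E xs" "\<forall>ys. path_in V E ys \<longrightarrow> length ys \<le> length xs"
    using ex_has_greatest_nat[of "path_in V E" "[]" length "Suc (card V)"] length_path_le[OF assms]
    by (metis le_imp_less_Suc)
  thus ?thesis by (auto simp: longest_path_def)
qed

lemma path_in_mono: "path_in V E xs \<Longrightarrow> E \<subseteq> E' \<Longrightarrow> path_in V E' xs"
  unfolding path_in_def by (auto elim: successively_mono)

lemma path_in_rev: "path_in V E (rev xs) \<longleftrightarrow> path_in V E xs"
  by (simp add: path_in_def insert_commute)

lemma longest_path_rev: "longest_path V E xs \<Longrightarrow> longest_path V E (rev xs)"
  by (simp add: longest_path_def path_in_rev)

section \<open>Edges of paths and their behaviour under rotation\<close>

fun path_edges :: "'a list \<Rightarrow> 'a set set" where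
  "path_edges (x # y # zs) = insert {x, y} (path_edges (y # zs))"
| "path_edges _ = {}"

lemma path_edges_append: "path_edges (us @ w # vs) = path_edges (us @ [w]) \<union> path_edges (w # vs)"
  by (induction us rule: induct_list012) (auto)

lemma path_edges_rev: "path_edges (rev xs) = path_edges xs"
proof (induction xs rule: path_edges.induct)
  case (1 x y zs)
  have "path_edges (rev zs @ y # [x]) = path_edges (rev zs @ [y]) \<union> path_edges [y, x]"
    by (rule path_edges_append)
  thus ?case using 1 by (simp add: insert_commute)
qed auto

lemma path_edges_Cons: "vs \<noteq> [] \<Longrightarrow> path_edges (w # vs) = insert {w, hd vs} (path_edges vs)"
  by (cases vs) auto

lemma path_edges_nth: "path_edges xs = {{xs ! i, xs ! Suc i} | i. Suc i < length xs}"
proof (induction xs rule: path_edges.induct)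
  case (1 x y zs)
  have "{{(x # y # zs) ! i, (x # y # zs) ! Suc i} |i. Suc i < length (x # y # zs)}
     = insert {x, y} {{(y # zs) ! i, (y # zs) ! Suc i} | i. Suc i < length (y # zs)}" (is "?A = ?B")
  proof
    show "?A \<subseteq> ?B"
    proof
      fix e assume "e \<in> ?A"
      then obtain i where "e = {(x # y # zs) ! i, (x # y # zs) ! Suc i}" "Suc i < length (x # y # zs)"
        by blast
      thus "e \<in> ?B" by (cases i) auto
    qed
    show "?B \<subseteq> ?A"
    proof
      fix e assume "e \<in> ?B"
      then consider "e = {x, y}" | i where "e = {(y # zs) ! i, (y # zs) ! Suc i}" "Suc i < length (y # zs)"
        by blast
      thus "e \<in> ?A"
      proof cases
        case 1 thus ?thesis by (intro CollectI exI[of _ 0]) auto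
      next
        case (2 i) thus ?thesis by (intro CollectI exI[of _ "Suc i"]) auto
      qed
    qed
  qed
  thus ?case using 1 by simp
qed auto

text \<open>A vertex of a path has at most a successor and a predecessor, so two images of
  \<open>R\<close> cover all its path neighbours.\<close>

lemma card_path_nbrs_le:
  assumes "finite R" "distinct xs"
  shows "card {x. \<exists>y\<in>R. {x, y} \<in> path_edges xs} \<le> 2 * card R"
proof -
  \<comment> \<open>At the ends of \<open>xs\<close> and off \<open>xs\<close> the values of
    \<open>s\<close> or \<open>t\<close> are meaningless; this is harmless, since only the sizes of
    the two images are bounded.\<close>
  define s where "s y = xs ! Suc (THE i. i < length xs \<and> xs ! i = y)" for y
  define t where "t y = xs ! ((THE i. i < length xs \<and> xs ! i = y) - 1)" for y
  have the: "(THE i. i < length xs \<and> xs ! i = xs ! j) = j" if "j < length xs" for j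
    using that assms(2) by (intro the_equality) (auto simp: nth_eq_iff_index_eq)
  have "{x. \<exists>y\<in>R. {x, y} \<in> path_edges xs} \<subseteq> s ` R \<union> t ` R"
  proof
    fix x assume "x \<in> {x. \<exists>y\<in>R. {x, y} \<in> path_edges xs}"
    then obtain y i where y: "y \<in> R" "{x, y} = {xs ! i, xs ! Suc i}" "Suc i < length xs"
      by (auto simp: path_edges_nth)
    then consider "x = xs ! i" "y = xs ! Suc i" | "y = xs ! i" "x = xs ! Suc i"
      by (auto simp: doubleton_eq_iff)
    thus "x \<in> s ` R \<union> t ` R"
    proof cases
      case 1
      hence "x = t y" using y(3) by (simp add: t_def the)
      thus ?thesis using y(1) by blast
    next
      case 2
      hence "x = s y" using y(3) by (simp add: s_def the)
      thus ?thesis using y(1) by blast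
    qed
  qed
  hence "card {x. \<exists>y\<in>R. {x, y} \<in> path_edges xs} \<le> card (s ` R \<union> t ` R)"
    by (intro card_mono) (use assms in auto)
  also have "\<dots> \<le> card (s ` R) + card (t ` R)" by (rule card_Un_le)
  also have "\<dots> \<le> card R + card R" by (intro add_mono card_image_le assms)
  finally show ?thesis by simp
qed

text \<open>A rotation trades the path edge \<open>{w, hd vs}\<close> for
  \<open>{last vs, w}\<close>, and \<open>hd vs\<close> becomes the last vertex. The first vertex
  never moves, even when \<open>us\<close> is empty.\<close>

inductive_set rotations :: "'a set set \<Rightarrow> 'a list \<Rightarrow> 'a list set" for E xs where
  base: "xs \<in> rotations E xs"
| rotate: "us @ w # vs \<in> rotations E xs \<Longrightarrow> vs \<noteq> [] \<Longrightarrow> {last vs, w} \<in> E \<Longrightarrow> us @ w # rev vs \<in> rotations E xs"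

lemma rotations_longest:
  assumes "ys \<in> rotations E xs" "longest_path V E xs"
  shows "longest_path V E ys \<and> hd ys = hd xs \<and> length ys = length xs"
  using assms(1)
proof induction
  case base thus ?case using assms(2) by simp
next
  case (rotate us w vs)
  have "path_in V E (us @ w # vs)" using rotate.IH by (simp add: longest_path_def)
  hence "path_in V E (us @ w # rev vs)" using rotate.hyps
    by (auto simp: path_in_def successively_append_iff successively_Cons hd_rev insert_commute)
  thus ?case using rotate.IH
    by (cases us) (auto simp: longest_path_def)
qed

text \<open>A path edge \<open>{x, y}\<close> of \<open>xs\<close> can only be broken by making \<open>x\<close> or \<open>y\<close> an end vertex, so away
  from the ends and their neighbours on \<open>xs\<close> all rotations of \<open>xs\<close> have the same edges.\<close>

lemma rotations_path_edges:
  assumes "ys \<in> rotations E xs"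
  defines "R \<equiv> last ` rotations E xs"
  assumes "x \<notin> R" "x \<notin> {x. \<exists>y\<in>R. {x, y} \<in> path_edges xs}"
  shows "{x, y} \<in> path_edges ys \<longleftrightarrow> {x, y} \<in> path_edges xs"
  using assms(1)
proof (induction arbitrary: y)
  case base thus ?case by simp
next
  case (rotate us w vs)
  have "us @ w # rev vs \<in> rotations E xs" using rotate.hyps by (rule rotations.rotate)
  hence "last (us @ w # rev vs) \<in> R" unfolding R_def by blast
  hence hd: "hd vs \<in> R" using \<open>vs \<noteq> []\<close> by (simp add: last_rev)
  have la: "last vs \<in> R" using rotate.hyps(1) \<open>vs \<noteq> []\<close> unfolding R_def
    by (metis image_eqI last_ConsR last_appendR list.distinct(1))
  have e1: "path_edges (us @ w # vs) = path_edges (us @ [w]) \<union> insert {w, hd vs} (path_edges vs)"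
    using path_edges_append[of us w vs] \<open>vs \<noteq> []\<close> by (simp add: path_edges_Cons)
  have e2: "path_edges (us @ w # rev vs) = path_edges (us @ [w]) \<union> insert {w, last vs} (path_edges vs)"
    using path_edges_append[of us w "rev vs"] \<open>vs \<noteq> []\<close>
    by (simp add: path_edges_Cons path_edges_rev hd_rev)
  have "x \<noteq> w"
  proof
    assume "x = w"
    hence "{x, hd vs} \<in> path_edges xs"
      using rotate.IH e1 by blast
    thus False using assms(4) hd by blast
  qed
  moreover have "x \<noteq> hd vs" "x \<noteq> last vs" using hd la assms(3) by auto
  ultimately have "{x, y} \<noteq> {w, hd vs}" "{x, y} \<noteq> {w, last vs}" by (auto simp: doubleton_eq_iff)
  thus ?case using rotate.IH e1 e2 by auto
qed


text \<open>A neighbour \<open>x\<close> of the end of a rotation \<open>ys\<close> lies on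
  \<open>ys\<close>, by maximality, and rotating at \<open>x\<close> makes the successor of
  \<open>x\<close> on \<open>ys\<close> an end. If \<open>x\<close> had no path neighbour in
  \<open>R\<close>, its edges on \<open>ys\<close> would be those on \<open>xs\<close>, so this
  successor would be such a neighbour after all.\<close>

lemma outer_nbrs_rotations:
  assumes xs: "longest_path V E xs" "xs \<noteq> []" and E: "E \<subseteq> all_edges V"
  defines "R \<equiv> last ` rotations E xs"
  shows "outer_nbrs E R \<subseteq> {x. \<exists>y\<in>R. {x, y} \<in> path_edges xs}"
proof
  fix x assume x: "x \<in> outer_nbrs E R"
  show "x \<in> {x. \<exists>y\<in>R. {x, y} \<in> path_edges xs}"
  proof (rule ccontr)
    assume nx: "x \<notin> {x. \<exists>y\<in>R. {x, y} \<in> path_edges xs}"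
    from x obtain ys where ys: "ys \<in> rotations E xs" "{last ys, x} \<in> E" and xR: "x \<notin> R"
      by (auto simp: outer_nbrs_def nbrs_def R_def)
    have lys: "longest_path V E ys" and "ys \<noteq> []"
      using rotations_longest[OF ys(1) xs(1)] xs(2) by auto
    have "x \<in> set ys"
    proof (rule ccontr)
      assume "x \<notin> set ys"
      moreover have "x \<in> V" using subsetD[OF E ys(2)] by (simp add: all_edges_iff)
      ultimately have "path_in V E (ys @ [x])"
        using lys \<open>ys \<noteq> []\<close> ys(2) by (auto simp: longest_path_def path_in_def successively_append_iff)
      hence "length (ys @ [x]) \<le> length ys" using lys unfolding longest_path_def by blast
      thus False by simp
    qed
    then obtain us vs where uv: "ys = us @ x # vs" by (meson split_list)
    have "last ys \<in> R" using ys(1) by (auto simp: R_def)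
    hence "vs \<noteq> []" using xR uv by auto
    have "us @ x # rev vs \<in> rotations E xs"
      using ys uv \<open>vs \<noteq> []\<close> by (intro rotations.rotate) auto
    hence "last (us @ x # rev vs) \<in> R" unfolding R_def by blast
    hence hd: "hd vs \<in> R" using \<open>vs \<noteq> []\<close> by (simp add: last_rev)
    have "{x, hd vs} \<in> path_edges ys"
      using path_edges_append[of us x vs] \<open>vs \<noteq> []\<close> by (simp add: path_edges_Cons uv)
    hence "{x, hd vs} \<in> path_edges xs"
      using rotations_path_edges[OF ys(1), of x "hd vs"] xR nx unfolding R_def by blast
    thus False using nx hd by blast
  qed
qed

text \<open>A small end set \<open>R\<close> would have at least \<open>3 * card R\<close> outer
  neighbours by expansion, but all of them are path neighbours of \<open>R\<close> on
  \<open>xs\<close>, of which there are at most \<open>2 * card R\<close>.\<close>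

lemma card_rotation_ends:
  assumes xs: "longest_path V E xs" "xs \<noteq> []" and E: "E \<subseteq> all_edges V"
    and "finite V" "expanding V k E"
  shows "k < card (last ` rotations E xs)"
proof (rule ccontr)
  define R where "R = last ` rotations E xs"
  assume "\<not> k < card (last ` rotations E xs)"
  hence k: "card R \<le> k" by (simp add: R_def)
  have RV: "R \<subseteq> V"
  proof
    fix x assume "x \<in> R"
    then obtain ys where ys: "ys \<in> rotations E xs" "x = last ys" by (auto simp: R_def)
    have "longest_path V E ys" "ys \<noteq> []"
      using rotations_longest[OF ys(1) xs(1)] xs(2) by auto
    thus "x \<in> V" using ys(2) last_in_set by (fastforce simp: longest_path_def path_in_def)
  qed
  have "R \<noteq> {}" using rotations.base by (auto simp: R_def)
  have fR: "finite R" using RV assms(4) by (rule finite_subset)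
  have "3 * card R \<le> card (outer_nbrs E R)"
    using assms(5) RV k \<open>R \<noteq> {}\<close> unfolding expanding_def by blast
  also have "\<dots> \<le> card {x. \<exists>y\<in>R. {x, y} \<in> path_edges xs}"
  proof (rule card_mono)
    have "{x. \<exists>y\<in>R. {x, y} \<in> path_edges xs} \<subseteq> set xs"
      by (auto simp: path_edges_nth doubleton_eq_iff)
    thus "finite {x. \<exists>y\<in>R. {x, y} \<in> path_edges xs}" by (rule finite_subset) auto
  qed (use outer_nbrs_rotations[OF xs E] in \<open>simp add: R_def\<close>)
  also have "\<dots> \<le> 2 * card R"
    by (rule card_path_nbrs_le) (use fR xs in \<open>auto simp: longest_path_def path_in_def\<close>)
  finally show False using \<open>R \<noteq> {}\<close> fR by (simp add: card_gt_0_iff)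
qed

section \<open>Connectivity and the effect of joining the ends of a longest path\<close>

lemma expanding_joined_exit:
  assumes "expanding V k E" "joined V k E" "E \<subseteq> all_edges V" "finite V"
    and C: "C \<subseteq> V" "C \<noteq> {}" "C \<noteq> V"
  shows "\<exists>x\<in>C. \<exists>y\<in>V - C. {x, y} \<in> E"
proof -
  have fC: "finite C" "finite (V - C)" using C assms(4) finite_subset by auto
  have small: "\<exists>x\<in>U. \<exists>y\<in>V - U. {x, y} \<in> E" if "U \<subseteq> V" "U \<noteq> {}" "card U \<le> k" for U
  proof -
    have "finite U" using that assms(4) finite_subset by blast
    hence "card U > 0" using that by (simp add: card_gt_0_iff)
    moreover have "3 * card U \<le> card (outer_nbrs E U)"
      using assms(1) that unfolding expanding_def by blast
    ultimately have "outer_nbrs E U \<noteq> {}" by fastforce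
    thus ?thesis using nbrs_subset[OF assms(3)] by (fastforce simp: outer_nbrs_def nbrs_def)
  qed
  \<comment> \<open>A small side of the cut has a leaving edge by expansion; two large sides contain
    a pair of disjoint \<open>k\<close>-sets, which is joined.\<close>
  consider "card C \<le> k" | "card (V - C) \<le> k" | "k \<le> card C" "k \<le> card (V - C)" by linarith
  thus ?thesis
  proof cases
    case 1 thus ?thesis using small C by blast
  next
    case 2
    have "V - (V - C) = C" using C by blast
    moreover have "\<exists>x\<in>V - C. \<exists>y\<in>V - (V - C). {x, y} \<in> E" using small[of "V - C"] 2 C by blast
    ultimately show ?thesis by (metis insert_commute)
  next
    case 3
    obtain U W where "U \<subseteq> C" "card U = k" "W \<subseteq> V - C" "card W = k"
      using obtain_subset_with_card_n 3 by metis
    hence "(U, W) \<in> disjoint_pairs V k" using C by (auto simp: disjoint_pairs_def)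
    hence "E \<inter> cross_edges U W \<noteq> {}" using assms(2) by (auto simp: joined_def)
    thus ?thesis using \<open>U \<subseteq> C\<close> \<open>W \<subseteq> V - C\<close> by (auto simp: cross_edges_def)
  qed
qed

text \<open>A closed path that misses a vertex is left by some edge, since \<open>E\<close> is
  connected, and the cycle can be opened there. The larger edge set \<open>E'\<close> allows two
  uses: with \<open>E' = E\<close> to show that the ends are not adjacent, and with the closing pair
  added to show that it is a booster.\<close>

lemma closed_path_extends:
  assumes "expanding V k E" "joined V k E" "E \<subseteq> all_edges V" "finite V" "E \<subseteq> E'"
    and zs: "path_in V E zs" "length zs \<ge> 3" "{last zs, hd zs} \<in> E'"
  shows "hamiltonian V E' \<or> (\<exists>xs. path_in V E' xs \<and> length xs = Suc (length zs))"
proof (cases "set zs = V")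
  case True
  have "{zs ! i, zs ! (Suc i mod length zs)} \<in> E'" if "i < length zs" for i
  proof (cases "Suc i = length zs")
    case True
    thus ?thesis using zs by (metis diff_Suc_1 hd_conv_nth last_conv_nth length_0_conv mod_self nat.distinct(1))
  next
    case False
    hence "Suc i < length zs" using that by simp
    moreover from this have "{zs ! i, zs ! Suc i} \<in> E"
      using zs by (simp add: path_in_def successively_conv_nth)
    ultimately show ?thesis using assms(5) by auto
  qed
  hence "cycle_edges zs \<subseteq> E'" by (auto simp: cycle_edges_def)
  hence "hamiltonian V E'"
    unfolding hamiltonian_def hamilton_cycle_def using True zs by (auto simp: path_in_def)
  thus ?thesis ..
next
  case False
  have "set zs \<subseteq> V" "set zs \<noteq> {}" using zs by (auto simp: path_in_def)
  then obtain x y where xy: "x \<in> set zs" "y \<in> V - set zs" "{x, y} \<in> E"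
    using expanding_joined_exit[OF assms(1-4)] False by meson
  then obtain us vs where uv: "zs = us @ x # vs" by (meson split_list)
  have p: "path_in V E' zs" using zs(1) assms(5) by (rule path_in_mono)
  have "{y, x} \<in> E'" using xy assms(5) by (auto simp: insert_commute)
  moreover have "us \<noteq> [] \<Longrightarrow> {last (x # vs), hd us} \<in> E'" using zs(3) uv by simp
  \<comment> \<open>The cycle is cut open just before \<open>x\<close>: from \<open>y\<close> to
    \<open>x\<close>, on to the end of \<open>zs\<close>, over the closing edge to its start, and
    through \<open>us\<close>.\<close>
  ultimately have "path_in V E' (y # (x # vs) @ us)"
    using p xy uv by (cases "vs = []") (auto simp: path_in_def successively_append_iff successively_Cons)
  moreover have "length (y # (x # vs) @ us) = Suc (length zs)" using uv by simp
  ultimately show ?thesis by blast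
qed

text \<open>By maximality all neighbours of the last vertex lie on the path, and expansion of a
  single vertex provides three of them. A closed path needs this length to count as a cycle.\<close>

lemma longest_path_length_ge_3:
  assumes "expanding V k E" "E \<subseteq> all_edges V" "finite V" "k \<ge> 1" "V \<noteq> {}" "longest_path V E xs"
  shows "length xs \<ge> 3"
proof -
  obtain v where v: "v \<in> V" using assms by auto
  have "path_in V E [v]" using v by (simp add: path_in_def)
  hence "length xs \<ge> 1" using assms(6) by (auto simp: longest_path_def)
  hence ne: "xs \<noteq> []" by auto
  have pxs: "path_in V E xs" using assms by (simp add: longest_path_def)
  hence lV: "last xs \<in> V" using ne by (auto simp: path_in_def)
  have "3 \<le> card (outer_nbrs E {last xs})"
    using assms(1)[unfolded expanding_def, rule_format, of "{last xs}"] assms(4) lV by simp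
  also have "\<dots> \<le> card (set xs)"
  proof (rule card_mono)
    show "outer_nbrs E {last xs} \<subseteq> set xs"
    proof
      fix x assume "x \<in> outer_nbrs E {last xs}"
      hence x: "{last xs, x} \<in> E" by (auto simp: outer_nbrs_def nbrs_def)
      show "x \<in> set xs"
      proof (rule ccontr)
        assume "x \<notin> set xs"
        moreover have "x \<in> V" using subsetD[OF assms(2) x] by (simp add: all_edges_iff)
        ultimately have "path_in V E (xs @ [x])"
          using pxs ne x by (auto simp: path_in_def successively_append_iff)
        hence "length (xs @ [x]) \<le> length xs" using assms(6) unfolding longest_path_def by blast
        thus False by simp
      qed
    qed
  qed simp
  also have "\<dots> \<le> length xs" by (rule card_length)
  finally show ?thesis .
qed

text \<open>Were the ends adjacent, closing the path would give a Hamilton cycle or a longer path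
  within \<open>E\<close>. So they form a non-edge, and adding it produces exactly one of these two
  outcomes.\<close>

lemma booster_of_ends:
  assumes "expanding V k E" "joined V k E" "E \<subseteq> all_edges V" "finite V"
    and "\<not> hamiltonian V E" "longest_path V E zs" "length zs \<ge> 3"
  shows "{hd zs, last zs} \<in> boosters V E"
proof -
  define e where "e = {last zs, hd zs}"
  have p: "path_in V E zs" and mx: "\<And>ys. path_in V E ys \<Longrightarrow> length ys \<le> length zs"
    using assms(6) by (auto simp: longest_path_def)
  have "e \<notin> E"
  proof
    assume "e \<in> E"
    hence "\<exists>xs. path_in V E xs \<and> length xs = Suc (length zs)"
      using closed_path_extends[OF assms(1-4) order_refl p assms(7)] assms(5) by (simp add: e_def)
    thus False using mx by fastforce
  qed
  have "e \<in> all_edges V"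
  proof -
    obtain a b ws where zs: "zs = a # b # ws"
      using assms(7) by (cases zs rule: path_edges.cases) auto
    have "last (b # ws) \<in> set (b # ws)" by (rule last_in_set) simp
    moreover have "set (b # ws) \<subseteq> V" "a \<notin> set (b # ws)" "a \<in> V"
      using p by (auto simp: path_in_def zs)
    moreover have "hd zs = a" "last zs = last (b # ws)" by (auto simp: zs)
    ultimately show ?thesis unfolding e_def all_edges_iff by (metis subsetD)
  qed
  moreover have "hamiltonian V (insert e E) \<or> (\<exists>xs. path_in V (insert e E) xs \<and> length xs = Suc (length zs))"
    by (rule closed_path_extends[OF assms(1-4) _ p assms(7)]) (auto simp: e_def)
  moreover have "\<forall>ys. path_in V E ys \<longrightarrow> length ys < Suc (length zs)"
    using mx by (simp add: less_Suc_eq_le)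
  ultimately have "e \<in> boosters V E" using \<open>e \<notin> E\<close> unfolding boosters_def by (smt (verit) DiffI mem_Collect_eq)
  thus ?thesis by (simp add: e_def insert_commute)
qed

text \<open>An unordered pair arises from at most two ordered ones. Besides boosters this also
  counts edges between two vertex sets that may overlap.\<close>

lemma card_Sigma_le_unordered:
  assumes "finite A" "\<And>a. a \<in> A \<Longrightarrow> finite (B a)"
    and "finite S" "\<And>a b. a \<in> A \<Longrightarrow> b \<in> B a \<Longrightarrow> {a, b} \<in> S"
  shows "(\<Sum>a\<in>A. card (B a)) \<le> 2 * card S"
proof -
  let ?f = "\<lambda>(a, b). {a, b}"
  have "(\<Sum>a\<in>A. card (B a)) = card (Sigma A B)" using assms(1,2) by simp
  also have "Sigma A B = (\<Union>e\<in>?f ` Sigma A B. {x \<in> Sigma A B. ?f x = e})" by blast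
  also have "card \<dots> \<le> (\<Sum>e\<in>?f ` Sigma A B. card {x \<in> Sigma A B. ?f x = e})"
    by (rule card_UN_le) (use assms(1,2) in auto)
  also have "\<dots> \<le> (\<Sum>e\<in>?f ` Sigma A B. 2)"
  proof (rule sum_mono)
    fix e assume "e \<in> ?f ` Sigma A B"
    then obtain a b where e: "e = {a, b}" by auto
    have "card {x \<in> Sigma A B. ?f x = e} \<le> card {(a, b), (b, a)}"
    proof (rule card_mono)
      show "{x \<in> Sigma A B. ?f x = e} \<subseteq> {(a, b), (b, a)}"
        unfolding e by (clarsimp simp: doubleton_eq_iff)
    qed simp
    also have "\<dots> \<le> 2" by (cases "a = b") simp_all
    finally show "card {x \<in> Sigma A B. ?f x = e} \<le> 2" .
  qed
  also have "\<dots> = 2 * card (?f ` Sigma A B)" by simp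
  also have "\<dots> \<le> 2 * card S"
  proof -
    have "?f ` Sigma A B \<subseteq> S" using assms(4) by auto
    thus ?thesis using card_mono[OF assms(3)] by simp
  qed
  finally show ?thesis .
qed

text \<open>Two rounds of rotations: with the first vertex fixed there are more than
  \<open>k\<close> possible ends, and each of them, made the first vertex by reversal, has more than
  \<open>k\<close> partners. Every such pair closes a longest path, hence is a booster.\<close>

theorem posa_boosters:
  assumes "expanding V k E" "joined V k E" "E \<subseteq> all_edges V" "finite V" "k \<ge> 1" "V \<noteq> {}"
    and "\<not> hamiltonian V E"
  shows "k * k \<le> 2 * card (boosters V E)"
proof -
  obtain xs where xs: "longest_path V E xs" using longest_path_exists[OF assms(4)] by blast
  define A where "A = last ` rotations E xs"
  have "\<forall>a\<in>A. \<exists>ys. longest_path V E ys \<and> hd ys = a"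
  proof
    fix a assume "a \<in> A"
    then obtain ys where "ys \<in> rotations E xs" "a = last ys" by (auto simp: A_def)
    thus "\<exists>ys. longest_path V E ys \<and> hd ys = a"
      using rotations_longest[OF _ xs] longest_path_rev by (metis hd_rev)
  qed
  then obtain f where f: "\<And>a. a \<in> A \<Longrightarrow> longest_path V E (f a) \<and> hd (f a) = a" by metis
  define B where "B a = last ` rotations E (f a)" for a
  have ge3: "length ys \<ge> 3" if "longest_path V E ys" for ys
    using longest_path_length_ge_3[OF assms(1,3-6) that] .
  have ends: "k < card (last ` rotations E ys)" if "longest_path V E ys" for ys
    using card_rotation_ends[OF that _ assms(3,4,1)] ge3[OF that] by fastforce
  have cA: "k \<le> card A" using ends[OF xs] by (simp add: A_def)
  have cB: "k \<le> card (B a)" if "a \<in> A" for a using ends f[OF that] by (simp add: B_def less_imp_le)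
  have fin: "finite A" "\<And>a. a \<in> A \<Longrightarrow> finite (B a)"
    using cA cB assms(5) by (metis card.infinite not_one_le_zero le_trans)+
  have "k * k \<le> card A * k" using cA by (rule mult_le_mono1)
  also have "\<dots> \<le> (\<Sum>a\<in>A. card (B a))"
    using sum_bounded_below[of A k "\<lambda>a. card (B a)"] cB by simp
  also have "\<dots> \<le> 2 * card (boosters V E)"
  proof (rule card_Sigma_le_unordered[OF fin])
    show "finite (boosters V E)"
      using finite_all_edges[OF assms(4)] by (auto simp: boosters_def)
    fix a b assume a: "a \<in> A" and "b \<in> B a"
    then obtain zs where zs: "zs \<in> rotations E (f a)" "b = last zs" by (auto simp: B_def)
    have "longest_path V E zs" "hd zs = a" using rotations_longest[OF zs(1)] f[OF a] by auto
    thus "{a, b} \<in> boosters V E" using booster_of_ends[OF assms(1-4,7)] ge3 zs(2) by metis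
  qed
  finally show ?thesis .
qed

section \<open>Compatible completion of a sparse subgraph\<close>

locale bounded_incompatibility =
  fixes V :: "'a set" and E :: "'a set set" and F :: "'a \<Rightarrow> 'a set set set" and \<Delta> :: real
  assumes finite_V: "finite V" and E_sub: "E \<subseteq> all_edges V"
    and system: "incompatibility_system V E F" and bounded: "bounded_system V E F \<Delta>"
begin

lemma finite_E: "finite E"
  using E_sub finite_all_edges[OF finite_V] by (rule finite_subset)

lemma incompatible_sym: "incompatible V F e e' \<longleftrightarrow> incompatible V F e' e"
  by (simp add: incompatible_def insert_commute)

lemma system_pair:
  assumes "v \<in> V" "{e, e'} \<in> F v"
  shows "e \<in> E" "e' \<in> E" "e \<noteq> e'" "v \<in> e" "v \<in> e'"
proof -
  obtain f f' where "f \<in> E" "f' \<in> E" "{e, e'} = {f, f'}" "f \<noteq> f'" "f \<inter> f' = {v}"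
    using system assms unfolding incompatibility_system_def by meson
  thus "e \<in> E" "e' \<in> E" "e \<noteq> e'" "v \<in> e" "v \<in> e'" unfolding doubleton_eq_iff by blast+
qed

lemma card_incompatible_at:
  assumes "v \<in> V" "v \<in> e" "e \<in> E"
  shows "card {e' \<in> E. {e, e'} \<in> F v} \<le> \<Delta>"
proof -
  have "{e' \<in> E. {e, e'} \<in> F v} = {e' \<in> E. v \<in> e' \<and> {e, e'} \<in> F v}"
    using system_pair(5)[OF assms(1)] by blast
  thus ?thesis using bounded assms unfolding bounded_system_def by simp
qed

lemma \<Delta>_nonneg: "e \<in> E \<Longrightarrow> 0 \<le> \<Delta>"
proof -
  assume e: "e \<in> E"
  hence "e \<subseteq> V" "card e = 2" using E_sub by (auto simp: all_edges_def)
  from \<open>card e = 2\<close> have "e \<noteq> {}" by auto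
  then obtain v where "v \<in> e" "v \<in> V" using \<open>e \<subseteq> V\<close> by blast
  thus ?thesis using card_incompatible_at[of v e] e by linarith
qed

lemma card_incompatible:
  assumes "e \<in> E"
  shows "card {e' \<in> E. incompatible V F e e'} \<le> 2 * \<Delta>"
proof -
  have e: "e \<subseteq> V" "card e = 2" using assms E_sub by (auto simp: all_edges_def)
  then have fin: "finite e" using card.infinite by fastforce
  have "{e' \<in> E. incompatible V F e e'} \<subseteq> (\<Union>v\<in>e. {e' \<in> E. {e, e'} \<in> F v})"
    using system_pair(4) by (auto simp: incompatible_def)
  hence "card {e' \<in> E. incompatible V F e e'} \<le> card (\<Union>v\<in>e. {e' \<in> E. {e, e'} \<in> F v})"
    by (intro card_mono) (auto simp: fin finite_E)
  also have "\<dots> \<le> (\<Sum>v\<in>e. card {e' \<in> E. {e, e'} \<in> F v})"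
    by (rule card_UN_le[OF fin])
  finally have "real (card {e' \<in> E. incompatible V F e e'}) \<le> (\<Sum>v\<in>e. real (card {e' \<in> E. {e, e'} \<in> F v}))"
    unfolding of_nat_sum[symmetric] of_nat_le_iff .
  also have "\<dots> \<le> (\<Sum>v\<in>e. \<Delta>)"
    using e assms by (intro sum_mono card_incompatible_at) auto
  finally show ?thesis using e by simp
qed

lemma card_incompatible_with:
  assumes "\<Gamma> \<subseteq> E"
  shows "card {e' \<in> E. \<exists>e\<in>\<Gamma>. incompatible V F e e'} \<le> 2 * \<Delta> * card \<Gamma>"
proof -
  have fin: "finite \<Gamma>" using assms finite_E by (rule finite_subset)
  have "{e' \<in> E. \<exists>e\<in>\<Gamma>. incompatible V F e e'} = (\<Union>e\<in>\<Gamma>. {e' \<in> E. incompatible V F e e'})"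
    by blast
  hence "card {e' \<in> E. \<exists>e\<in>\<Gamma>. incompatible V F e e'} \<le> (\<Sum>e\<in>\<Gamma>. card {e' \<in> E. incompatible V F e e'})"
    using card_UN_le[OF fin] by simp
  hence "real (card {e' \<in> E. \<exists>e\<in>\<Gamma>. incompatible V F e e'}) \<le> (\<Sum>e\<in>\<Gamma>. real (card {e' \<in> E. incompatible V F e e'}))"
    unfolding of_nat_sum[symmetric] of_nat_le_iff .
  also have "\<dots> \<le> (\<Sum>e\<in>\<Gamma>. 2 * \<Delta>)"
    using assms by (intro sum_mono card_incompatible) auto
  finally show ?thesis by (simp add: mult.commute)
qed

lemma compatible_insert:
  assumes "compatible_subgraph V F \<Gamma>" "\<And>g. g \<in> \<Gamma> \<Longrightarrow> \<not> incompatible V F g e"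
  shows "compatible_subgraph V F (insert e \<Gamma>)"
  unfolding compatible_subgraph_def
proof (intro ballI impI)
  fix f g assume "f \<in> insert e \<Gamma>" "g \<in> insert e \<Gamma>" "f \<noteq> g"
  then consider "f \<in> \<Gamma>" "g \<in> \<Gamma>" | "f = e" "g \<in> \<Gamma>" | "g = e" "f \<in> \<Gamma>" by blast
  thus "\<not> incompatible V F f g"
  proof cases
    case 1 thus ?thesis using assms(1) \<open>f \<noteq> g\<close> unfolding compatible_subgraph_def by blast
  next
    case 2 thus ?thesis using assms(2)[of g] incompatible_sym[of e g] by simp
  next
    case 3 thus ?thesis using assms(2) by simp
  qed
qed

text \<open>By \<open>boost\<close>, the boosters inside \<open>E\<close> outnumber the edges that
  conflict with the current subgraph, so one of them can be added. Expansion and joinedness survive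
  the addition.\<close>

lemma booster_completion:
  assumes \<Gamma>0: "\<Gamma>0 \<subseteq> E" "compatible_subgraph V F \<Gamma>0" "expanding V k \<Gamma>0" "joined V k \<Gamma>0"
    and boost: "\<And>\<Gamma>. \<Gamma> \<subseteq> E \<Longrightarrow> card \<Gamma> \<le> card \<Gamma>0 + card V + 1 \<Longrightarrow> expanding V k \<Gamma> \<Longrightarrow> joined V k \<Gamma> \<Longrightarrow>
      \<not> hamiltonian V \<Gamma> \<Longrightarrow> 2 * \<Delta> * card \<Gamma> < card (E \<inter> boosters V \<Gamma>)"
  shows "\<exists>C. hamilton_cycle V E C \<and> compatible_subgraph V F C"
proof -
  \<comment> \<open>The induction runs over a guaranteed path length \<open>i\<close>; a booster
    raises it by one unless the subgraph becomes Hamiltonian.\<close>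
  have step: "\<exists>\<Gamma>. \<Gamma>0 \<subseteq> \<Gamma> \<and> \<Gamma> \<subseteq> E \<and> compatible_subgraph V F \<Gamma> \<and> card \<Gamma> \<le> card \<Gamma>0 + i \<and>
      (hamiltonian V \<Gamma> \<or> (\<exists>xs. path_in V \<Gamma> xs \<and> i \<le> length xs))" if "i \<le> card V + 1" for i
    using that
  proof (induction i)
    case 0
    have "path_in V \<Gamma>0 []" by (simp add: path_in_def)
    thus ?case using \<Gamma>0 by auto
  next
    case (Suc i)
    then obtain \<Gamma> where \<Gamma>: "\<Gamma>0 \<subseteq> \<Gamma>" "\<Gamma> \<subseteq> E" "compatible_subgraph V F \<Gamma>" "card \<Gamma> \<le> card \<Gamma>0 + i"
      "hamiltonian V \<Gamma> \<or> (\<exists>xs. path_in V \<Gamma> xs \<and> i \<le> length xs)" by auto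
    show ?case
    proof (cases "hamiltonian V \<Gamma>")
      case True
      thus ?thesis using \<Gamma> le_SucI by auto
    next
      case False
      have \<Gamma>V: "\<Gamma> \<subseteq> all_edges V" using \<Gamma>(2) E_sub by blast
      have "expanding V k \<Gamma>" by (rule expanding_mono[OF \<Gamma>0(3) \<Gamma>(1) \<Gamma>V finite_V])
      moreover have "joined V k \<Gamma>" by (rule joined_mono[OF \<Gamma>0(4) \<Gamma>(1)])
      ultimately have "2 * \<Delta> * card \<Gamma> < card (E \<inter> boosters V \<Gamma>)"
        using \<Gamma>(2,4) Suc.prems False by (intro boost) auto
      hence "card {e' \<in> E. \<exists>e\<in>\<Gamma>. incompatible V F e e'} < card (E \<inter> boosters V \<Gamma>)"
        using card_incompatible_with[OF \<Gamma>(2)] by linarith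
      hence "\<not> E \<inter> boosters V \<Gamma> \<subseteq> {e' \<in> E. \<exists>e\<in>\<Gamma>. incompatible V F e e'}"
        using card_mono[of "{e' \<in> E. \<exists>e\<in>\<Gamma>. incompatible V F e e'}" "E \<inter> boosters V \<Gamma>"] finite_E by auto
      then obtain e where e: "e \<in> E" "e \<in> boosters V \<Gamma>" "\<And>g. g \<in> \<Gamma> \<Longrightarrow> \<not> incompatible V F g e"
        by blast
      from \<Gamma>(5) False obtain xs where xs: "path_in V \<Gamma> xs" "i \<le> length xs" by blast
      have "hamiltonian V (insert e \<Gamma>) \<or> (\<exists>xs. path_in V (insert e \<Gamma>) xs \<and> Suc i \<le> length xs)"
        (is "?ham \<or> ?long")
      proof -
        consider "?ham" | ys where "path_in V (insert e \<Gamma>) ys" "\<forall>zs. path_in V \<Gamma> zs \<longrightarrow> length zs < length ys"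
          using e(2) unfolding boosters_def by blast
        thus ?thesis
        proof cases
          case (2 ys)
          hence "Suc i \<le> length ys" using xs by (meson Suc_leI order_le_less_trans)
          thus ?thesis using 2 by blast
        qed simp
      qed
      moreover have "card (insert e \<Gamma>) \<le> card \<Gamma>0 + Suc i"
        using \<Gamma>(4) card_insert_le_m1[of "Suc (card \<Gamma>)" \<Gamma> e] by simp
      moreover have "compatible_subgraph V F (insert e \<Gamma>)" by (rule compatible_insert[OF \<Gamma>(3) e(3)])
      ultimately show ?thesis using \<Gamma>(1,2) e(1) by (intro exI[of _ "insert e \<Gamma>"]) auto
    qed
  qed
  \<comment> \<open>After \<open>card V + 1\<close> rounds the path alternative asks for more
    vertices than there are, so only the Hamiltonian one is left.\<close>
  obtain \<Gamma> where \<Gamma>: "\<Gamma> \<subseteq> E" "compatible_subgraph V F \<Gamma>"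
    "hamiltonian V \<Gamma> \<or> (\<exists>xs. path_in V \<Gamma> xs \<and> card V + 1 \<le> length xs)"
    using step[of "card V + 1"] by auto
  then obtain C where "hamilton_cycle V \<Gamma> C"
    using length_path_le[OF finite_V] by (fastforce simp: hamiltonian_def)
  moreover from this have "C \<subseteq> \<Gamma>" by (simp add: hamilton_cycle_def)
  moreover have "compatible_subgraph V F C"
    using \<Gamma>(2) \<open>C \<subseteq> \<Gamma>\<close> unfolding compatible_subgraph_def by (simp add: subset_iff)
  moreover have "C \<subseteq> E" using \<open>C \<subseteq> \<Gamma>\<close> \<Gamma>(1) by simp
  ultimately show ?thesis unfolding hamilton_cycle_def by metis
qed

text \<open>Among the edges compatible with the current subgraph, an average one joins a fraction
  \<open>q / (2 * Q)\<close> of the pairs that are not joined yet.\<close>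

lemma joined_completion:
  fixes q Q :: real
  assumes \<Gamma>0: "\<Gamma>0 \<subseteq> E" "compatible_subgraph V F \<Gamma>0"
    and q: "0 < q" "\<And>U W. (U, W) \<in> disjoint_pairs V k \<Longrightarrow> q \<le> card (E \<inter> cross_edges U W)"
    and Q: "card E \<le> Q" and \<Delta>: "2 * \<Delta> * (card \<Gamma>0 + T) \<le> q / 2"
    and T: "(1 - q / (2 * Q)) ^ T * 4 ^ card V < 1"
  shows "\<exists>\<Gamma>. \<Gamma>0 \<subseteq> \<Gamma> \<and> \<Gamma> \<subseteq> E \<and> compatible_subgraph V F \<Gamma> \<and> card \<Gamma> \<le> card \<Gamma>0 + T \<and> joined V k \<Gamma>"
proof -
  define bad where "bad \<Gamma> = {(U, W) \<in> disjoint_pairs V k. \<Gamma> \<inter> cross_edges U W = {}}" for \<Gamma>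
  have fin_pairs: "finite (disjoint_pairs V k)" by (rule finite_disjoint_pairs[OF finite_V])
  have fin_bad: "finite (bad \<Gamma>)" for \<Gamma>
    by (rule finite_subset[OF _ fin_pairs]) (auto simp: bad_def)
  \<comment> \<open>The case \<open>bad \<Gamma> = {}\<close> is kept apart because
    \<open>1 - q / (2 * Q)\<close> is shown to be nonnegative only while some pair is still
    unjoined.\<close>
  have step: "\<exists>\<Gamma>. \<Gamma>0 \<subseteq> \<Gamma> \<and> \<Gamma> \<subseteq> E \<and> compatible_subgraph V F \<Gamma> \<and> card \<Gamma> \<le> card \<Gamma>0 + i \<and>
      (bad \<Gamma> = {} \<or> card (bad \<Gamma>) \<le> (1 - q / (2 * Q)) ^ i * 4 ^ card V)" if "i \<le> T" for i
    using that
  proof (induction i)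
    case 0
    have "card (bad \<Gamma>0) \<le> card (disjoint_pairs V k)"
      by (rule card_mono[OF fin_pairs]) (auto simp: bad_def)
    hence "card (bad \<Gamma>0) \<le> 4 ^ card V" using card_disjoint_pairs[OF finite_V, of k] by linarith
    hence "real (card (bad \<Gamma>0)) \<le> real (4 ^ card V)" by (rule of_nat_mono)
    thus ?case using \<Gamma>0 by (intro exI[of _ \<Gamma>0]) auto
  next
    case (Suc i)
    then obtain \<Gamma> where \<Gamma>: "\<Gamma>0 \<subseteq> \<Gamma>" "\<Gamma> \<subseteq> E" "compatible_subgraph V F \<Gamma>" "card \<Gamma> \<le> card \<Gamma>0 + i"
      "bad \<Gamma> = {} \<or> card (bad \<Gamma>) \<le> (1 - q / (2 * Q)) ^ i * 4 ^ card V" by auto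
    show ?case
    proof (cases "bad \<Gamma> = {}")
      case True
      thus ?thesis using \<Gamma> le_SucI by auto
    next
      case False
      define I where "I = {e' \<in> E. \<exists>e\<in>\<Gamma>. incompatible V F e e'}"
      \<comment> \<open>\<open>A\<close> consists of the edges that may still be added. By the
        assumption on \<open>\<Delta>\<close>, conflicts use up at most half of the \<open>q\<close>
        edges guaranteed between \<open>U\<close> and \<open>W\<close>.\<close>
      define A where "A = E - I"
      have fA: "finite A" using finite_E by (simp add: A_def)
      have good: "q / 2 \<le> card (A \<inter> cross_edges U W)" if "(U, W) \<in> disjoint_pairs V k" for U W
      proof -
        have "q \<le> card (E \<inter> cross_edges U W)" by (rule q(2)[OF that])
        moreover have "card (E \<inter> cross_edges U W) \<le> card (A \<inter> cross_edges U W) + card I"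
        proof -
          have "E \<inter> cross_edges U W \<subseteq> (A \<inter> cross_edges U W) \<union> I" by (auto simp: A_def)
          hence "card (E \<inter> cross_edges U W) \<le> card ((A \<inter> cross_edges U W) \<union> I)"
            by (intro card_mono) (auto simp: I_def A_def finite_E)
          thus ?thesis using card_Un_le order_trans by blast
        qed
        moreover have "card I \<le> q / 2"
        proof -
          have "card I \<le> 2 * \<Delta> * card \<Gamma>" unfolding I_def by (rule card_incompatible_with[OF \<Gamma>(2)])
          also have "\<dots> \<le> 2 * \<Delta> * (card \<Gamma>0 + T)"
          proof (cases "\<Gamma> = {}")
            case True
            have "E \<noteq> {}" using q(2)[OF that] q(1) by auto
            thus ?thesis using True \<Delta>_nonneg by auto
          next
            case False
            hence "0 \<le> \<Delta>" using \<Delta>_nonneg \<Gamma>(2) by blast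
            thus ?thesis using \<Gamma>(4) Suc.prems by (intro mult_left_mono) auto
          qed
          finally show ?thesis using \<Delta> by linarith
        qed
        ultimately show ?thesis by linarith
      qed
      obtain U0 W0 where UW: "(U0, W0) \<in> disjoint_pairs V k" using False by (auto simp: bad_def)
      have Apos: "q / 2 \<le> card A"
        using good[OF UW] card_mono[OF fA, of "A \<inter> cross_edges U0 W0"] by auto
      have "\<exists>e\<in>A. card (bad (insert e \<Gamma>)) \<le> (1 - q / (2 * Q)) * card (bad \<Gamma>)"
      proof (rule ccontr)
        assume "\<not> ?thesis"
        hence gt: "\<And>e. e \<in> A \<Longrightarrow> (1 - q / (2 * Q)) * card (bad \<Gamma>) < card (bad (insert e \<Gamma>))" by force
        have "A \<noteq> {}" using Apos q(1) by auto
        hence "(\<Sum>e\<in>A. (1 - q / (2 * Q)) * card (bad \<Gamma>)) < (\<Sum>e\<in>A. real (card (bad (insert e \<Gamma>))))"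
          using gt by (intro sum_strict_mono fA) auto
        also have "\<dots> = (\<Sum>e\<in>A. \<Sum>x\<in>bad \<Gamma>. if e \<in> cross_edges (fst x) (snd x) then 0 else 1)"
        proof (rule sum.cong[OF refl])
          fix e assume "e \<in> A"
          have "bad (insert e \<Gamma>) = {x \<in> bad \<Gamma>. e \<notin> cross_edges (fst x) (snd x)}"
            by (auto simp: bad_def)
          thus "real (card (bad (insert e \<Gamma>))) = (\<Sum>x\<in>bad \<Gamma>. if e \<in> cross_edges (fst x) (snd x) then 0 else 1)"
            using fin_bad by (simp add: sum.If_cases Int_def)
        qed
        \<comment> \<open>Summed pair by pair instead of edge by edge: an unjoined pair stays
          unjoined for at most \<open>card A - q / 2\<close> choices of the new edge.\<close>
        also have "\<dots> = (\<Sum>x\<in>bad \<Gamma>. \<Sum>e\<in>A. if e \<in> cross_edges (fst x) (snd x) then 0 else 1)"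
          by (rule sum.swap)
        also have "\<dots> \<le> (\<Sum>x\<in>bad \<Gamma>. card A - q / 2)"
        proof (rule sum_mono)
          fix x assume "x \<in> bad \<Gamma>"
          hence x: "q / 2 \<le> card (A \<inter> cross_edges (fst x) (snd x))" using good by (auto simp: bad_def)
          have "(\<Sum>e\<in>A. if e \<in> cross_edges (fst x) (snd x) then 0 else 1) = real (card (A - cross_edges (fst x) (snd x)))"
            using fA by (simp add: sum.If_cases Diff_eq)
          also have "\<dots> = card A - real (card (A \<inter> cross_edges (fst x) (snd x)))"
            using fA by (simp add: card_Diff_subset_Int of_nat_diff card_mono)
          finally show "(\<Sum>e\<in>A. if e \<in> cross_edges (fst x) (snd x) then 0 else 1) \<le> card A - q / 2"
            using x by linarith
        qed
        also have "\<dots> = card A * (1 - q / (2 * card A)) * card (bad \<Gamma>)"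
          using Apos q(1) by (simp add: field_simps)
        also have "\<dots> \<le> card A * (1 - q / (2 * Q)) * card (bad \<Gamma>)"
        proof -
          have "card A \<le> Q" using Q card_mono[OF finite_E, of A] by (auto simp: A_def)
          hence "q / (2 * Q) \<le> q / (2 * card A)" using Apos q(1) by (intro divide_left_mono) auto
          thus ?thesis by (intro mult_right_mono mult_left_mono) auto
        qed
        finally show False by (simp add: mult.assoc)
      qed
      then obtain e where e: "e \<in> A" "card (bad (insert e \<Gamma>)) \<le> (1 - q / (2 * Q)) * card (bad \<Gamma>)" by blast
      have "Q \<ge> q / 2" using Q Apos card_mono[OF finite_E, of A] by (auto simp: A_def)
      hence "0 \<le> 1 - q / (2 * Q)" using q(1) by (simp add: field_simps)
      hence "(1 - q / (2 * Q)) * card (bad \<Gamma>) \<le> (1 - q / (2 * Q)) * ((1 - q / (2 * Q)) ^ i * 4 ^ card V)"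
        using \<Gamma>(5) False by (intro mult_left_mono) auto
      hence "card (bad (insert e \<Gamma>)) \<le> (1 - q / (2 * Q)) ^ Suc i * 4 ^ card V" using e(2) by simp
      moreover have "card (insert e \<Gamma>) \<le> card \<Gamma>0 + Suc i"
        using \<Gamma>(4) card_insert_le_m1[of "Suc (card \<Gamma>)" \<Gamma> e] by simp
      moreover have "compatible_subgraph V F (insert e \<Gamma>)"
        using e(1) by (intro compatible_insert[OF \<Gamma>(3)]) (auto simp: A_def I_def)
      ultimately show ?thesis using \<Gamma>(1,2) e(1) by (intro exI[of _ "insert e \<Gamma>"]) (auto simp: A_def)
    qed
  qed
  obtain \<Gamma> where \<Gamma>: "\<Gamma>0 \<subseteq> \<Gamma>" "\<Gamma> \<subseteq> E" "compatible_subgraph V F \<Gamma>" "card \<Gamma> \<le> card \<Gamma>0 + T"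
    "bad \<Gamma> = {} \<or> card (bad \<Gamma>) \<le> (1 - q / (2 * Q)) ^ T * 4 ^ card V"
    using step[OF order_refl] by auto
  hence "bad \<Gamma> = {}" using T fin_bad by (metis card_0_eq less_one of_nat_less_1_iff order_le_less_trans)
  hence "joined V k \<Gamma>" by (auto simp: joined_def bad_def)
  thus ?thesis using \<Gamma> by auto
qed

end

section \<open>Selection of compatible stars\<close>

text \<open>Derandomised independent choice: \<open>\<Sum>i\<in>I. c i * (\<Prod>m\<in>M. g i m)\<close> does not increase on average
  when a random option is added to \<open>M\<close>, so some option does not increase it.\<close>

lemma product_selection:
  fixes N :: "'a \<Rightarrow> 'a set" and g :: "'i \<Rightarrow> 'a \<times> 'a \<Rightarrow> real" and c :: "'i \<Rightarrow> real" and b :: real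
  assumes fin: "finite I" "finite V" "\<And>v. v \<in> V \<Longrightarrow> finite (N v)"
    and nonneg: "\<And>i. i \<in> I \<Longrightarrow> 0 \<le> c i" "\<And>i m. i \<in> I \<Longrightarrow> 0 \<le> g i m" and "0 < b"
    and avg: "\<And>i v A. i \<in> I \<Longrightarrow> v \<in> V \<Longrightarrow> A \<subseteq> N v \<Longrightarrow> b \<le> card A \<Longrightarrow> (\<Sum>w\<in>A. g i (v, w)) \<le> card A"
    and Inv: "Inv {}"
    and ext: "\<And>M v. Inv M \<Longrightarrow> M \<subseteq> Sigma V N \<Longrightarrow> (\<Sum>i\<in>I. c i * (\<Prod>m\<in>M. g i m)) \<le> sum c I \<Longrightarrow> v \<in> V \<Longrightarrow>
      card {w. (v, w) \<in> M} < d \<Longrightarrow> \<exists>A\<subseteq>N v. b \<le> card A \<and> (\<forall>w\<in>A. (v, w) \<notin> M \<and> Inv (insert (v, w) M))"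
  shows "\<exists>M. M \<subseteq> Sigma V N \<and> Inv M \<and> (\<Sum>i\<in>I. c i * (\<Prod>m\<in>M. g i m)) \<le> sum c I \<and>
    (\<forall>v\<in>V. d \<le> card {w. (v, w) \<in> M})"
proof -
  define \<Psi> where "\<Psi> M = (\<Sum>i\<in>I. c i * (\<Prod>m\<in>M. g i m))" for M
  define S where "S = {M. M \<subseteq> Sigma V N \<and> Inv M \<and> \<Psi> M \<le> sum c I}"
  have finS: "finite (Sigma V N)" using fin by auto
  have "finite S" by (rule finite_subset[of _ "Pow (Sigma V N)"]) (use finS in \<open>auto simp: S_def\<close>)
  moreover have "{} \<in> S" using Inv by (simp add: S_def \<Psi>_def)
  \<comment> \<open>An inclusion-maximal set replaces a sequence of picks: a vertex with fewer than
    \<open>d\<close> picks would allow an extension that stays in \<open>S\<close>.\<close>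
  ultimately obtain M where M: "M \<in> S" "\<And>M'. M' \<in> S \<Longrightarrow> M \<subseteq> M' \<Longrightarrow> M = M'"
    using finite_has_maximal[of S] by blast
  have MS: "M \<subseteq> Sigma V N" "Inv M" "\<Psi> M \<le> sum c I" using M(1) by (auto simp: S_def)
  have finM: "finite M" using MS(1) finS by (rule finite_subset)
  have "d \<le> card {w. (v, w) \<in> M}" if v: "v \<in> V" for v
  proof (rule ccontr)
    assume "\<not> d \<le> card {w. (v, w) \<in> M}"
    then obtain A where A: "A \<subseteq> N v" "b \<le> card A" "\<And>w. w \<in> A \<Longrightarrow> (v, w) \<notin> M" "\<And>w. w \<in> A \<Longrightarrow> Inv (insert (v, w) M)"
      using ext[OF MS(2,1) MS(3)[unfolded \<Psi>_def] v] by (metis not_le)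
    have "A \<noteq> {}" using A(2) \<open>0 < b\<close> by auto
    have finA: "finite A" using A(1) fin(3)[OF v] by (rule finite_subset)
    have "\<exists>w\<in>A. \<Psi> (insert (v, w) M) \<le> \<Psi> M"
    proof (rule ccontr)
      assume "\<not> ?thesis"
      hence "(\<Sum>w\<in>A. \<Psi> M) < (\<Sum>w\<in>A. \<Psi> (insert (v, w) M))"
        using \<open>A \<noteq> {}\<close> by (intro sum_strict_mono finA) auto
      also have "\<dots> = (\<Sum>w\<in>A. \<Sum>i\<in>I. c i * (\<Prod>m\<in>M. g i m) * g i (v, w))"
        unfolding \<Psi>_def using A(3) finM by (intro sum.cong refl) (simp add: mult_ac)
      also have "\<dots> = (\<Sum>i\<in>I. \<Sum>w\<in>A. c i * (\<Prod>m\<in>M. g i m) * g i (v, w))" by (rule sum.swap)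
      also have "\<dots> = (\<Sum>i\<in>I. c i * (\<Prod>m\<in>M. g i m) * (\<Sum>w\<in>A. g i (v, w)))"
        by (simp add: sum_distrib_left)
      also have "\<dots> \<le> (\<Sum>i\<in>I. c i * (\<Prod>m\<in>M. g i m) * card A)"
        using nonneg by (intro sum_mono mult_left_mono avg v A mult_nonneg_nonneg prod_nonneg) auto
      also have "\<dots> = (\<Sum>w\<in>A. \<Psi> M)"
        unfolding \<Psi>_def by (simp add: sum_distrib_left mult_ac)
      finally show False by simp
    qed
    then obtain w where w: "w \<in> A" "\<Psi> (insert (v, w) M) \<le> \<Psi> M" by blast
    have "insert (v, w) M \<in> S" using w A MS v by (auto simp: S_def)
    hence "M = insert (v, w) M" using M(2) by blast
    thus False using A(3)[OF w(1)] by blast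
  qed
  thus ?thesis using MS unfolding \<Psi>_def by blast
qed

definition undirected :: "'a \<times> 'a \<Rightarrow> 'a set" where "undirected m = {fst m, snd m}"

lemma undirected_pair [simp]: "undirected (v, w) = {v, w}" by (simp add: undirected_def)

lemma doubleton_inj: "{x, y} = {x, z} \<Longrightarrow> y = z"
  by (auto simp: doubleton_eq_iff)

text \<open>Every vertex picks \<open>d\<close> out-neighbours, and in-degrees are capped at \<open>K\<close>. The invariant that leaves
  each vertex enough admissible options is a bound on the load of \<open>u\<close>: the number of picks landing
  in the neighbourhood of \<open>u\<close>, plus \<open>L\<close> times the number of picks conflicting with an edge at \<open>u\<close>.
  Its exponential moment grows by a factor of at most \<open>1 + drift u v\<close> with a pick of \<open>v\<close>.\<close>

locale star_setup = bounded_incompatibility V E F \<Delta>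
  for V :: "'a set" and E F and \<Delta> :: real +
  fixes a :: real and d K L :: nat
  assumes a_pos: "0 < a"
    and deg_lower: "v \<in> V \<Longrightarrow> a / 2 \<le> card (nbrs E v)"
    and deg_upper: "v \<in> V \<Longrightarrow> card (nbrs E v) \<le> 2 * a"
    and K: "K = 672 * d" and L: "L = 1344 * d" and d_pos: "0 < d"
    and \<Delta>_exp: "2 ^ (L + 3) * \<Delta> \<le> a" and \<Delta>_deg: "(d + K) * \<Delta> \<le> a / 16"
    and d_small: "d \<le> a / 16" and n_small: "ln (2 * real (card V)) \<le> d * a"
    and V_ne: "V \<noteq> {}"
begin

definition N where "N v = nbrs E v"

text \<open>Only conflicts at the far end \<open>x\<close> of an edge \<open>{u, x}\<close> are
  recorded. Conflicts at \<open>u\<close> itself come from picks incident to \<open>u\<close>, whose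
  number is bounded through the caps \<open>d\<close> and \<open>K\<close>.\<close>

definition conf :: "'a \<Rightarrow> 'a set \<Rightarrow> bool" where
  "conf u e \<longleftrightarrow> (\<exists>x\<in>e. {u, x} \<in> E \<and> {{u, x}, e} \<in> F x)"

definition load :: "'a \<Rightarrow> 'a \<times> 'a \<Rightarrow> nat" where
  "load u m = of_bool (snd m \<in> N u) + L * of_bool (conf u (undirected m))"

text \<open>An upper bound for the average of \<open>2 ^ load u (v, w) - 1\<close> when
  \<open>w\<close> is uniform among at least \<open>a / 4\<close> options: a pick landing in
  \<open>N u\<close> without conflict adds 1, a conflicting one less than
  \<open>2 ^ (L + 1)\<close>.\<close>

definition drift :: "'a \<Rightarrow> 'a \<Rightarrow> real" where
  "drift u v = 4 / a * (card (N u \<inter> N v) + 2 ^ (L + 1) * card {w \<in> N v. conf u {v, w}})"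

lemma N_iff: "w \<in> N v \<longleftrightarrow> {v, w} \<in> E" by (simp add: N_def nbrs_def)

lemma N_sym: "w \<in> N v \<longleftrightarrow> v \<in> N w" by (simp add: N_def nbrs_sym)

lemma N_sub: "N v \<subseteq> V" using nbrs_subset[OF E_sub] by (auto simp: N_def)

lemma finite_N: "finite (N v)" using N_sub finite_V by (rule finite_subset)

section \<open>Load of a vertex, bounded through its exponential moment\<close>

lemma drift_nonneg: "0 \<le> drift u v" using a_pos by (simp add: drift_def)

text \<open>Counts walks of length two from \<open>u\<close>, with at most \<open>2 * a\<close>
  choices for each step.\<close>

lemma sum_common: 
  assumes "u \<in> V" shows "(\<Sum>v\<in>V. real (card (N u \<inter> N v))) \<le> 4 * a\<^sup>2"
proof -
  have "(\<Sum>v\<in>V. real (card (N u \<inter> N v))) = (\<Sum>v\<in>V. \<Sum>w\<in>N u. of_bool (w \<in> N v))"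
    using finite_N by (simp add: Int_def)
  also have "\<dots> = (\<Sum>w\<in>N u. \<Sum>v\<in>V. of_bool (w \<in> N v))" by (rule sum.swap)
  also have "\<dots> = (\<Sum>w\<in>N u. real (card (N w)))"
  proof (intro sum.cong refl)
    fix w
    have "V \<inter> {v. w \<in> N v} = N w" using N_sub N_sym by blast
    thus "(\<Sum>v\<in>V. of_bool (w \<in> N v)) = real (card (N w))" using finite_V by simp
  qed
  also have "\<dots> \<le> (\<Sum>w\<in>N u. 2 * a)"
    using N_sub[of u] by (intro sum_mono) (auto simp: N_def intro!: deg_upper)
  also have "\<dots> = card (N u) * (2 * a)" by simp
  also have "\<dots> \<le> (2 * a) * (2 * a)"
    using deg_upper[OF assms] a_pos by (intro mult_right_mono) (auto simp: N_def)
  finally show ?thesis by (simp add: power2_eq_square)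
qed

lemma card_conf_at:
  assumes "v \<in> V" "v \<in> e" "e \<in> E"
  shows "card {w. {e, {v, w}} \<in> F v} \<le> \<Delta>"
proof -
  have "card {w. {e, {v, w}} \<in> F v} = card ((\<lambda>w. {v, w}) ` {w. {e, {v, w}} \<in> F v})"
    by (rule card_image[symmetric]) (auto simp: inj_on_def dest: doubleton_inj)
  also have "\<dots> \<le> card {e' \<in> E. {e, e'} \<in> F v}"
    using system_pair(2)[OF assms(1)] by (intro card_mono) (auto simp: finite_E)
  finally have "real (card {w. {e, {v, w}} \<in> F v}) \<le> card {e' \<in> E. {e, e'} \<in> F v}" by simp
  thus ?thesis using card_incompatible_at[OF assms] by linarith
qed

lemma finite_conf_at:
  assumes "v \<in> V" shows "finite {w. {e, {v, w}} \<in> F v}"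
proof (rule finite_subset[OF _ finite_V], rule subsetI)
  fix w assume "w \<in> {w. {e, {v, w}} \<in> F v}"
  hence "{v, w} \<in> E" using system_pair(2)[OF assms] by blast
  hence "w \<in> N v" by (simp add: N_iff)
  thus "w \<in> V" using N_sub by blast
qed

text \<open>An edge conflicting with some \<open>{u, x}\<close> at \<open>x\<close> contains
  \<open>x\<close>. There are at most \<open>2 * a\<close> vertices \<open>x\<close>, at most
  \<open>\<Delta>\<close> such edges for each, and two orientations of every edge.\<close>

lemma sum_conf:
  assumes u: "u \<in> V" shows "(\<Sum>v\<in>V. real (card {w \<in> N v. conf u {v, w}})) \<le> 4 * a * \<Delta>"
proof -
  define C where "C x = {w. {{u, x}, {x, w}} \<in> F x}" for x
  define P where "P = (SIGMA v:V. {w \<in> N v. conf u {v, w}})"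
  have fC: "finite (C x)" if "x \<in> N u" for x
    using finite_conf_at[of x "{u, x}"] that N_sub unfolding C_def by auto
  have cC: "card (C x) \<le> \<Delta>" if "x \<in> N u" for x
    unfolding C_def using that N_sub[of u] by (intro card_conf_at) (auto simp: N_iff)
  have "P \<subseteq> (\<Union>x\<in>N u. Pair x ` C x \<union> (\<lambda>w. (w, x)) ` C x)"
  proof
    fix m assume "m \<in> P"
    then obtain v w where m: "m = (v, w)" "conf u {v, w}" by (auto simp: P_def)
    then consider "v \<in> N u" "{{u, v}, {v, w}} \<in> F v" | "w \<in> N u" "{{u, w}, {w, v}} \<in> F w"
      by (auto simp: conf_def N_iff insert_commute)
    thus "m \<in> (\<Union>x\<in>N u. Pair x ` C x \<union> (\<lambda>w. (w, x)) ` C x)"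
    proof cases
      case 1
      hence "m \<in> Pair v ` C v" by (auto simp: C_def m)
      thus ?thesis using 1 by blast
    next
      case 2
      hence "m \<in> (\<lambda>v. (v, w)) ` C w" by (auto simp: C_def m)
      thus ?thesis using 2 by blast
    qed
  qed
  hence "card P \<le> card (\<Union>x\<in>N u. Pair x ` C x \<union> (\<lambda>w. (w, x)) ` C x)"
    using finite_N fC by (intro card_mono) auto
  also have "\<dots> \<le> (\<Sum>x\<in>N u. card (Pair x ` C x \<union> (\<lambda>w. (w, x)) ` C x))"
    by (rule card_UN_le[OF finite_N])
  also have "\<dots> \<le> (\<Sum>x\<in>N u. 2 * card (C x))"
  proof (rule sum_mono)
    fix x assume "x \<in> N u"
    have "card (Pair x ` C x \<union> (\<lambda>w. (w, x)) ` C x) \<le> card (Pair x ` C x) + card ((\<lambda>w. (w, x)) ` C x)"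
      by (rule card_Un_le)
    also have "\<dots> \<le> card (C x) + card (C x)"
      by (intro add_mono card_image_le fC \<open>x \<in> N u\<close>)
    finally show "card (Pair x ` C x \<union> (\<lambda>w. (w, x)) ` C x) \<le> 2 * card (C x)" by simp
  qed
  finally have "real (card P) \<le> real (\<Sum>x\<in>N u. 2 * card (C x))" by (rule of_nat_mono)
  also have "\<dots> = (\<Sum>x\<in>N u. 2 * real (card (C x)))" by simp
  also have "\<dots> \<le> (\<Sum>x\<in>N u. 2 * \<Delta>)" using cC by (intro sum_mono) auto
  also have "\<dots> = card (N u) * (2 * \<Delta>)" by simp
  also have "\<dots> \<le> (2 * a) * (2 * \<Delta>)"
  proof (cases "N u = {}")
    case True
    have "0 < real (card (N u))" using deg_lower[OF u] a_pos unfolding N_def by linarith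
    thus ?thesis using True by simp
  next
    case False
    hence "0 \<le> \<Delta>" using \<Delta>_nonneg N_iff by blast
    thus ?thesis using deg_upper[OF u] by (intro mult_right_mono) (auto simp: N_def)
  qed
  finally have "real (card P) \<le> 4 * a * \<Delta>" by simp
  moreover have "real (card P) = (\<Sum>v\<in>V. real (card {w \<in> N v. conf u {v, w}}))"
    unfolding P_def using finite_V finite_N by simp
  ultimately show ?thesis by simp
qed

text \<open>The common neighbours contribute \<open>16 * a\<close>. The conflicts contribute at most
  \<open>4 * a\<close>: their exponential weight \<open>2 ^ (L + 1)\<close> is paid for by the
  smallness of \<open>\<Delta>\<close>.\<close>

lemma sum_drift:
  assumes "u \<in> V" shows "(\<Sum>v\<in>V. drift u v) \<le> 20 * a"
proof -
  have "(\<Sum>v\<in>V. drift u v) = 4 / a * ((\<Sum>v\<in>V. real (card (N u \<inter> N v))) +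
      2 ^ (L + 1) * (\<Sum>v\<in>V. real (card {w \<in> N v. conf u {v, w}})))"
    by (simp only: drift_def of_nat_add of_nat_mult of_nat_power of_nat_numeral
        sum_distrib_left[symmetric] sum.distrib)
  also have "\<dots> \<le> 4 / a * (4 * a\<^sup>2 + 2 ^ (L + 1) * (4 * a * \<Delta>))"
    using a_pos by (intro mult_left_mono add_mono sum_common sum_conf assms) auto
  also have "\<dots> = 16 * a + 4 * (2 ^ (L + 3) * \<Delta>)"
    using a_pos by (simp add: field_simps power2_eq_square power_add)
  also have "\<dots> \<le> 20 * a" using \<Delta>_exp by simp
  finally show ?thesis .
qed

lemma load_average:
  assumes "u \<in> V" "v \<in> V" "A \<subseteq> N v" "a / 4 \<le> card A"
  shows "(\<Sum>w\<in>A. 2 ^ load u (v, w) / (1 + drift u v)) \<le> card A"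
proof -
  have fA: "finite A" using assms(3) finite_N by (rule finite_subset)
  have "(\<Sum>w\<in>A. 2 ^ load u (v, w)) \<le>
      (\<Sum>w\<in>A. 1 + of_bool (w \<in> N u) + 2 ^ (L + 1) * of_bool (conf u {v, w}) :: real)"
    by (intro sum_mono) (auto simp: load_def)
  also have "\<dots> = card A + card (A \<inter> N u) + 2 ^ (L + 1) * card {w \<in> A. conf u {v, w}}"
    using fA by (simp add: sum.distrib sum_distrib_left[symmetric] Int_def)
  also have "\<dots> \<le> card A + card (N u \<inter> N v) + 2 ^ (L + 1) * card {w \<in> N v. conf u {v, w}}"
    using assms(3) finite_N fA by (intro add_mono mult_left_mono of_nat_mono card_mono) auto
  also have "\<dots> = card A + a / 4 * drift u v" using a_pos by (simp add: drift_def)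
  also have "\<dots> \<le> card A + card A * drift u v"
    using assms(4) drift_nonneg by (intro add_mono mult_right_mono) auto
  finally have "(\<Sum>w\<in>A. 2 ^ load u (v, w)) \<le> card A * (1 + drift u v)" by (simp add: algebra_simps)
  moreover have "0 < 1 + drift u v" using drift_nonneg[of u v] by linarith
  ultimately show ?thesis by (simp add: sum_divide_distrib[symmetric] divide_le_eq)
qed

text \<open>Logarithm of the potential bound: the load times \<open>ln 2\<close> is at most
  \<open>ln (2 * card V)\<close> plus the total drift of \<open>d\<close> picks per vertex, hence at
  most \<open>d * a + 20 * d * a\<close>. Estimating \<open>ln 2\<close> by one half from below
  doubles 21 to 42.\<close>

lemma sum_load_le:
  assumes u: "u \<in> V" and M: "M \<subseteq> Sigma V N" and out: "\<And>v. v \<in> V \<Longrightarrow> card {w. (v, w) \<in> M} \<le> d"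
    and pot: "(\<Prod>m\<in>M. 2 ^ load u m / (1 + drift u (fst m))) \<le> 2 * real (card V)"
  shows "real (\<Sum>m\<in>M. load u m) \<le> 42 * d * a"
proof -
  have n0: "0 < card V" using V_ne finite_V by (simp add: card_gt_0_iff)
  have finS: "finite (Sigma V N)" using finite_V finite_N by auto
  hence finM: "finite M" using M finite_subset by blast
  have pos: "0 < 1 + drift u v" for v using drift_nonneg[of u v] by linarith
  have "(\<Sum>m\<in>M. drift u (fst m)) = (\<Sum>m\<in>(SIGMA v:V. {w. (v, w) \<in> M}). drift u (fst m))"
    using M by (intro sum.cong) auto
  also have "\<dots> = (\<Sum>v\<in>V. \<Sum>w\<in>{w. (v, w) \<in> M}. drift u v)"
  proof (subst sum.Sigma)
    have "{w. (v, w) \<in> M} \<subseteq> N v" for v using M by auto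
    thus "\<forall>x\<in>V. finite {w. (x, w) \<in> M}" using finite_N finite_subset by blast
  qed (auto simp: finite_V split_def)
  also have "\<dots> = (\<Sum>v\<in>V. card {w. (v, w) \<in> M} * drift u v)" by simp
  also have "\<dots> \<le> (\<Sum>v\<in>V. d * drift u v)"
    using out drift_nonneg by (intro sum_mono mult_right_mono) auto
  also have "\<dots> \<le> d * (20 * a)"
    unfolding sum_distrib_left[symmetric] by (intro mult_left_mono sum_drift u) auto
  finally have dr: "(\<Sum>m\<in>M. drift u (fst m)) \<le> d * (20 * a)" .
  have "(2::real) ^ (\<Sum>m\<in>M. load u m) = (\<Prod>m\<in>M. 2 ^ load u m)" by (rule power_sum)
  also have "\<dots> = (\<Prod>m\<in>M. 2 ^ load u m / (1 + drift u (fst m))) * (\<Prod>m\<in>M. 1 + drift u (fst m))"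
    using pos by (simp add: prod.distrib[symmetric] less_imp_neq[symmetric])
  also have "\<dots> \<le> 2 * real (card V) * (\<Prod>m\<in>M. exp (drift u (fst m)))"
    using pot drift_nonneg by (intro mult_mono prod_mono prod_nonneg conjI exp_ge_add_one_self) (auto simp: add_nonneg_nonneg)
  also have "\<dots> = 2 * real (card V) * exp (\<Sum>m\<in>M. drift u (fst m))" using finM by (simp add: exp_sum)
  also have "\<dots> \<le> 2 * real (card V) * exp (d * (20 * a))" using dr by (intro mult_left_mono) auto
  finally have "ln ((2::real) ^ (\<Sum>m\<in>M. load u m)) \<le> ln (2 * real (card V) * exp (d * (20 * a)))"
    using n0 by (subst ln_le_cancel_iff) auto
  hence "real (\<Sum>m\<in>M. load u m) * ln 2 \<le> ln (2 * real (card V)) + d * (20 * a)"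
    using n0 by (simp add: ln_mult ln_realpow)
  also have "\<dots> \<le> 21 * d * a" using n_small by (simp add: algebra_simps)
  finally have "real (\<Sum>m\<in>M. load u m) * ln 2 \<le> 21 * d * a" .
  moreover have "real (\<Sum>m\<in>M. load u m) * (1 / 2) \<le> real (\<Sum>m\<in>M. load u m) * ln 2"
    using ln2_ge_two_thirds by (intro mult_left_mono of_nat_0_le_iff) auto
  ultimately show ?thesis by linarith
qed


text \<open>The cap \<open>K\<close> on in-degrees leaves at most \<open>d + K\<close> picks
  incident to any vertex, so that few options are lost to conflicts there.\<close>

definition admissible :: "('a \<times> 'a) set \<Rightarrow> bool" where
  "admissible M \<longleftrightarrow> (\<forall>v. card {w. (v, w) \<in> M} \<le> d) \<and> (\<forall>w. card {v. (v, w) \<in> M} \<le> K) \<and>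
     compatible_subgraph V F (undirected ` M)"

section \<open>Every vertex keeps enough admissible options\<close>

lemma finite_Sigma_N: "finite (Sigma V N)"
  using finite_V finite_N by auto

text \<open>A neighbour of \<open>v\<close> that has reached its in-degree cap contributes
  \<open>K = 16 * 42 * d\<close> to the load of \<open>v\<close>.\<close>

lemma card_saturated:
  assumes M: "M \<subseteq> Sigma V N" and ld: "real (\<Sum>m\<in>M. load v m) \<le> 42 * d * a"
  shows "card {w \<in> N v. K \<le> card {x. (x, w) \<in> M}} \<le> a / 16" (is "real (card ?S) \<le> _")
proof -
  have finM: "finite M" using M finite_Sigma_N by (rule finite_subset)
  have fx: "finite {x. (x, w) \<in> M}" for w
    by (rule finite_subset[of _ "fst ` M"]) (use finM in force)+
  have fS: "finite ?S" using finite_N by simp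
  have "K * card ?S = (\<Sum>w\<in>?S. K)" by simp
  also have "\<dots> \<le> (\<Sum>w\<in>?S. card {x. (x, w) \<in> M})" by (intro sum_mono) auto
  also have "\<dots> = card (SIGMA w:?S. {x. (x, w) \<in> M})" using fS fx by simp
  also have "\<dots> = card ((\<lambda>(w, x). (x, w)) ` (SIGMA w:?S. {x. (x, w) \<in> M}))"
    by (rule card_image[symmetric]) (auto simp: inj_on_def)
  also have "\<dots> \<le> card {m \<in> M. snd m \<in> N v}"
    using finM by (intro card_mono) auto
  also have "\<dots> = (\<Sum>m\<in>M. of_bool (snd m \<in> N v))" using finM by (simp add: Int_def)
  also have "\<dots> \<le> (\<Sum>m\<in>M. load v m)" by (intro sum_mono) (simp add: load_def)
  finally have "real (K * card ?S) \<le> real (\<Sum>m\<in>M. load v m)" by (rule of_nat_mono)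
  hence "real (K * card ?S) \<le> 42 * d * a" using ld by linarith
  hence "real d * (672 * card ?S) \<le> real d * (42 * a)" by (simp add: K mult_ac)
  hence "672 * real (card ?S) \<le> 42 * a" using d_pos by simp
  thus ?thesis by simp
qed

text \<open>A conflicting pick contributes \<open>L = 32 * 42 * d\<close> to the load of
  \<open>v\<close>, so there are at most \<open>a / 32\<close> of them, and each blocks at most its
  two end vertices.\<close>

lemma card_blocked:
  assumes M: "M \<subseteq> Sigma V N" and ld: "real (\<Sum>m\<in>M. load v m) \<le> 42 * d * a"
  shows "card {w \<in> N v. \<exists>m\<in>M. w \<in> undirected m \<and> {{v, w}, undirected m} \<in> F w} \<le> a / 16" (is "real (card ?S) \<le> _")
proof -
  have finM: "finite M" using M finite_Sigma_N by (rule finite_subset)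
  define B where "B = {m \<in> M. conf v (undirected m)}"
  have finB: "finite B" using finM by (simp add: B_def)
  have "?S \<subseteq> (\<Union>m\<in>B. undirected m)" by (auto simp: B_def conf_def N_iff)
  hence "card ?S \<le> card (\<Union>m\<in>B. undirected m)" using finB by (intro card_mono) (auto simp: undirected_def)
  also have "\<dots> \<le> (\<Sum>m\<in>B. card (undirected m))" by (rule card_UN_le[OF finB])
  also have "\<dots> \<le> (\<Sum>m\<in>B. 2)" by (intro sum_mono) (simp add: undirected_def card_insert_if)
  finally have "card ?S \<le> 2 * card B" by simp
  have "L * card B = (\<Sum>m\<in>M. L * of_bool (conf v (undirected m)))"
    using finM by (simp add: B_def sum_distrib_left[symmetric] Int_def)
  also have "\<dots> \<le> (\<Sum>m\<in>M. load v m)" by (intro sum_mono) (simp add: load_def)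
  finally have "real (L * card B) \<le> real (\<Sum>m\<in>M. load v m)" by (rule of_nat_mono)
  hence "real (L * card B) \<le> 42 * d * a" using ld by linarith
  hence "real d * (1344 * card B) \<le> real d * (42 * a)" by (simp add: L mult_ac)
  hence "1344 * real (card B) \<le> 42 * a" using d_pos by simp
  thus ?thesis using \<open>card ?S \<le> 2 * card B\<close> by simp
qed

text \<open>At most \<open>d + K\<close> picks are incident to \<open>v\<close>, and each conflicts
  at \<open>v\<close> with at most \<open>\<Delta>\<close> edges.\<close>

lemma card_blocked_at:
  assumes M: "M \<subseteq> Sigma V N" "admissible M" and v: "v \<in> V"
  shows "card {w \<in> N v. \<exists>m\<in>M. v \<in> undirected m \<and> {undirected m, {v, w}} \<in> F v} \<le> a / 16" (is "real (card ?S) \<le> _")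
proof -
  have finM: "finite M" using M(1) finite_Sigma_N by (rule finite_subset)
  define B where "B = {m \<in> M. v \<in> undirected m}"
  have finB: "finite B" using finM by (simp add: B_def)
  have "B \<subseteq> Pair v ` {w. (v, w) \<in> M} \<union> (\<lambda>w. (w, v)) ` {w. (w, v) \<in> M}"
    by (auto simp: B_def undirected_def)
  moreover have f1: "finite {w. (v, w) \<in> M}"
    by (rule finite_subset[of _ "snd ` M"]) (use finM in force)+
  moreover have f2: "finite {w. (w, v) \<in> M}"
    by (rule finite_subset[of _ "fst ` M"]) (use finM in force)+
  ultimately have "card B \<le> card (Pair v ` {w. (v, w) \<in> M} \<union> (\<lambda>w. (w, v)) ` {w. (w, v) \<in> M})"
    by (intro card_mono) auto
  also have "\<dots> \<le> card (Pair v ` {w. (v, w) \<in> M}) + card ((\<lambda>w. (w, v)) ` {w. (w, v) \<in> M})"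
    by (rule card_Un_le)
  also have "\<dots> \<le> card {w. (v, w) \<in> M} + card {w. (w, v) \<in> M}"
    using f1 f2 by (intro add_mono card_image_le)
  also have "\<dots> \<le> d + K" using M(2) by (intro add_mono) (auto simp: admissible_def)
  finally have cB: "card B \<le> d + K" .
  have BE: "undirected m \<in> E" "v \<in> undirected m" if "m \<in> B" for m
    using that M(1) by (auto simp: B_def N_iff undirected_def)
  have "?S \<subseteq> (\<Union>m\<in>B. {w. {undirected m, {v, w}} \<in> F v})" by (auto simp: B_def)
  hence "card ?S \<le> card (\<Union>m\<in>B. {w. {undirected m, {v, w}} \<in> F v})"
    using finB finite_conf_at[OF v] by (intro card_mono) auto
  also have "\<dots> \<le> (\<Sum>m\<in>B. card {w. {undirected m, {v, w}} \<in> F v})" by (rule card_UN_le[OF finB])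
  finally have "real (card ?S) \<le> real (\<Sum>m\<in>B. card {w. {undirected m, {v, w}} \<in> F v})" by (rule of_nat_mono)
  also have "\<dots> = (\<Sum>m\<in>B. real (card {w. {undirected m, {v, w}} \<in> F v}))" by simp
  also have "\<dots> \<le> (\<Sum>m\<in>B. \<Delta>)" by (intro sum_mono card_conf_at v BE)
  also have "\<dots> = card B * \<Delta>" by simp
  also have "\<dots> \<le> (d + K) * \<Delta>"
  proof (cases "B = {}")
    case True
    have "N v \<noteq> {}" using deg_lower[OF v] a_pos by (auto simp: N_def)
    then obtain w where "{v, w} \<in> E" unfolding N_iff[symmetric] by blast
    thus ?thesis using True \<Delta>_nonneg by simp
  next
    case False
    hence "0 \<le> \<Delta>" using BE(1) \<Delta>_nonneg by blast
    thus ?thesis using cB by (intro mult_right_mono) (simp_all only: of_nat_add[symmetric] of_nat_le_iff)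
  qed
  also have "\<dots> \<le> a / 16" by (rule \<Delta>_deg)
  finally show ?thesis .
qed

text \<open>Of at least \<open>a / 2\<close> neighbours, four obstructions remove at most
  \<open>a / 16\<close> each: a full in-degree (\<open>S1\<close>), an earlier pick by
  \<open>v\<close> (\<open>S2\<close>), a conflict at \<open>w\<close> (\<open>S3\<close>) and a
  conflict at \<open>v\<close> (\<open>S4\<close>).\<close>

lemma options:
  assumes M: "M \<subseteq> Sigma V N" "admissible M" and ld: "real (\<Sum>m\<in>M. load v m) \<le> 42 * d * a"
    and v: "v \<in> V" "card {w. (v, w) \<in> M} < d"
  shows "\<exists>A\<subseteq>N v. a / 4 \<le> card A \<and> (\<forall>w\<in>A. (v, w) \<notin> M \<and> admissible (insert (v, w) M))"
proof -
  define S1 where "S1 = {w \<in> N v. K \<le> card {x. (x, w) \<in> M}}"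
  define S2 where "S2 = {w. (v, w) \<in> M}"
  define S3 where "S3 = {w \<in> N v. \<exists>m\<in>M. w \<in> undirected m \<and> {{v, w}, undirected m} \<in> F w}"
  define S4 where "S4 = {w \<in> N v. \<exists>m\<in>M. v \<in> undirected m \<and> {undirected m, {v, w}} \<in> F v}"
  define A where "A = N v - (S1 \<union> S2 \<union> S3 \<union> S4)"
  have finM: "finite M" using M(1) finite_Sigma_N by (rule finite_subset)
  have f1: "finite {w. (x, w) \<in> M}" for x
    by (rule finite_subset[of _ "snd ` M"]) (use finM in force)+
  have f2: "finite {x. (x, w) \<in> M}" for w
    by (rule finite_subset[of _ "fst ` M"]) (use finM in force)+
  have fS: "finite S1" "finite S2" "finite S3" "finite S4"
    using finite_N f1 by (auto simp: S1_def S2_def S3_def S4_def)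
  have "card S1 \<le> a / 16" unfolding S1_def by (rule card_saturated[OF M(1) ld])
  moreover have "card S2 \<le> a / 16" using v(2) d_small unfolding S2_def by linarith
  moreover have "card S3 \<le> a / 16" unfolding S3_def by (rule card_blocked[OF M(1) ld])
  moreover have "card S4 \<le> a / 16" unfolding S4_def by (rule card_blocked_at[OF M v(1)])
  moreover have "card (S1 \<union> S2 \<union> S3 \<union> S4) \<le> card S1 + card S2 + card S3 + card S4"
    using card_Un_le[of "S1 \<union> S2 \<union> S3" S4] card_Un_le[of "S1 \<union> S2" S3] card_Un_le[of S1 S2] by linarith
  ultimately have "real (card (S1 \<union> S2 \<union> S3 \<union> S4)) \<le> a / 4" by linarith
  moreover have "card (N v) - card (S1 \<union> S2 \<union> S3 \<union> S4) \<le> card A"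
    unfolding A_def using fS by (intro diff_card_le_card_Diff) auto
  moreover have "a / 2 \<le> card (N v)" using deg_lower[OF v(1)] by (simp add: N_def)
  ultimately have "a / 4 \<le> card A" by linarith
  moreover have "admissible (insert (v, w) M)" if w: "w \<in> A" for w
    unfolding admissible_def
  proof (intro conjI allI)
    fix x
    show "card {y. (x, y) \<in> insert (v, w) M} \<le> d"
    proof (cases "x = v")
      case True
      have "{y. (x, y) \<in> insert (v, w) M} = insert w {y. (v, y) \<in> M}" using True by auto
      thus ?thesis using v(2) f1 by (simp add: card_insert_if)
    next
      case False
      thus ?thesis using M(2) by (simp add: admissible_def)
    qed
    show "card {y. (y, x) \<in> insert (v, w) M} \<le> K"
    proof (cases "x = w")
      case True
      have "{y. (y, x) \<in> insert (v, w) M} = insert v {y. (y, w) \<in> M}" using True by auto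
      moreover have "card {y. (y, w) \<in> M} < K" using w by (auto simp: A_def S1_def)
      ultimately show ?thesis using f2 by (simp add: card_insert_if)
    next
      case False
      thus ?thesis using M(2) by (simp add: admissible_def)
    qed
  next
    \<comment> \<open>Two incompatible edges conflict at a common vertex, which is \<open>v\<close>
      or \<open>w\<close> here; \<open>S4\<close> and \<open>S3\<close> exclude these cases.\<close>
    have "\<not> incompatible V F (undirected m) {v, w}" if m: "m \<in> M" for m
    proof
      assume "incompatible V F (undirected m) {v, w}"
      then obtain x where x: "x \<in> V" "{undirected m, {v, w}} \<in> F x" by (auto simp: incompatible_def)
      hence xs: "x \<in> undirected m" "x \<in> {v, w}" using system_pair(4,5) by blast+
      have "w \<in> N v" using w by (simp add: A_def)
      from xs(2) consider "x = v" | "x = w" by blast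
      thus False
      proof cases
        case 1
        hence "w \<in> S4" using xs x m \<open>w \<in> N v\<close> unfolding S4_def by blast
        thus False using w by (simp add: A_def)
      next
        case 2
        have "{{v, w}, undirected m} \<in> F w" using x(2) 2 by (metis insert_commute)
        hence "w \<in> S3" using xs 2 m \<open>w \<in> N v\<close> unfolding S3_def by blast
        thus False using w by (simp add: A_def)
      qed
    qed
    hence "compatible_subgraph V F (insert {v, w} (undirected ` M))"
      using M(2) by (intro compatible_insert) (auto simp: admissible_def)
    thus "compatible_subgraph V F (undirected ` insert (v, w) M)" by simp
  qed
  moreover have "(v, w) \<notin> M" if "w \<in> A" for w using that by (simp add: A_def S2_def)
  ultimately show ?thesis by (intro exI[of _ A]) (auto simp: A_def)
qed

end

section \<open>Weighted counting of trapped pairs and expansion of the stars\<close>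

lemma binomial_le_pow3:
  assumes "0 < j" shows "real (n choose j) \<le> (3 * real n / real j) ^ j"
proof (cases "n = 0 \<or> n < j")
  case True
  thus ?thesis using assms by (auto simp: binomial_eq_0)
next
  case False
  \<comment> \<open>A single term of the expansion of \<open>(1 + x) ^ n\<close> is compared with
    \<open>exp (n * x)\<close>; this \<open>x\<close> makes the latter \<open>exp j\<close>, and
    \<open>exp 1\<close> is at most 3.\<close>
  define x where "x = real j / real n"
  have x: "0 < x" using assms False by (simp add: x_def)
  have "real (n choose j) * x ^ j \<le> (\<Sum>i\<le>n. real (n choose i) * x ^ i)"
    using x False by (intro member_le_sum) auto
  also have "\<dots> = (x + 1) ^ n" by (simp add: binomial_ring)
  also have "\<dots> \<le> exp x ^ n" using x by (intro power_mono) (auto simp: add.commute)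
  also have "\<dots> = exp 1 ^ j" using False by (simp add: exp_of_nat_mult[symmetric] x_def)
  also have "\<dots> \<le> 3 ^ j" by (intro power_mono exp_le) auto
  finally have "real (n choose j) \<le> 3 ^ j / x ^ j" using x by (simp add: pos_le_divide_eq)
  thus ?thesis by (simp add: x_def power_divide[symmetric])
qed

lemma sum_quarter_powers: "(\<Sum>j = 1..k. (1 / 4 :: real) ^ j) \<le> 1 / 3"
proof -
  have "(\<Sum>j = 1..k. (1 / 4 :: real) ^ j) = 1 / 3 - (1 / 4) ^ k / 3"
  proof (induction k)
    case (Suc k)
    have "(\<Sum>j = 1..Suc k. (1 / 4 :: real) ^ j) = (\<Sum>j = 1..k. (1 / 4) ^ j) + 1 / 4 * (1 / 4) ^ k"
      by simp
    also have "\<dots> = 1 / 3 - 1 / 4 * (1 / 4) ^ k / 3" unfolding Suc.IH by linarith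
    finally show ?case by (simp only: power_Suc)
  qed simp
  thus ?thesis by simp
qed

text \<open>If \<open>U\<close> with \<open>card U = j\<close> fails to expand, all picks of \<open>U\<close> stay in some \<open>Y\<close> with
  \<open>card Y = 4 * j\<close>. A vertex with at most \<open>threshold j * a\<close> neighbours in \<open>Y\<close> picks inside \<open>Y\<close> with
  probability at most \<open>4 * threshold j\<close>, which is what \<open>trap\<close> divides out. The weights are small
  enough to be summed over all \<open>U\<close> and \<open>Y\<close>, yet a trapped pair with \<open>44\<close> picks per vertex would
  contribute more than the whole potential.\<close>

context star_setup
begin

definition test_sets :: "nat \<Rightarrow> (nat \<times> 'a set \<times> 'a set) set" where
  "test_sets k = (SIGMA j:{1..k}. {U. U \<subseteq> V \<and> card U = j} \<times> {Y. Y \<subseteq> V \<and> card Y = 4 * j})"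

text \<open>With \<open>z = 16 * j / card V\<close> one has \<open>4 * threshold j = sqrt z\<close>.
  If half of \<open>U\<close> is trapped with 44 picks per vertex, the trap product is at least
  \<open>(1 / sqrt z) ^ (22 * j)\<close>, which cancels \<open>z ^ (11 * j)\<close> and leaves
  \<open>2 * card V\<close>, more than the total potential.\<close>

definition weight :: "nat \<Rightarrow> real" where
  "weight j = 2 * card V * (16 * j / card V) ^ (11 * j)"

definition threshold :: "nat \<Rightarrow> real" where
  "threshold j = sqrt (j / card V)"

definition trap :: "nat \<times> 'a set \<times> 'a set \<Rightarrow> 'a \<times> 'a \<Rightarrow> real" where
  "trap = (\<lambda>(j, U, Y) (v, w). if v \<in> U \<and> card (N v \<inter> Y) \<le> threshold j * a
     then of_bool (w \<in> Y) / (4 * threshold j) else 1)"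

lemma finite_test_sets: "finite (test_sets k)"
  unfolding test_sets_def using finite_V by auto

text \<open>With \<open>x = j / card V\<close>, the choices of \<open>U\<close> and \<open>Y\<close>
  cost at most \<open>(3 / x) ^ (5 * j)\<close>, against \<open>(16 * x) ^ (11 * j)\<close> in the
  weight. What remains is \<open>3 ^ 5 * 16 ^ 11 * x ^ 6\<close> to the power \<open>j\<close>, and
  \<open>x\<close> at most \<open>1 / 1000\<close> brings this base below
  \<open>1 / 4\<close>.\<close>

lemma sum_weight:
  assumes "1000 * k \<le> card V"
  shows "(\<Sum>(j, U, Y)\<in>test_sets k. weight j) \<le> 2 / 3 * card V"
proof -
  have n0: "0 < card V" using V_ne finite_V by (simp add: card_gt_0_iff)
  let ?n = "real (card V)"
  have "(\<Sum>(j, U, Y)\<in>test_sets k. weight j) =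
     (\<Sum>j = 1..k. \<Sum>x\<in>{U. U \<subseteq> V \<and> card U = j} \<times> {Y. Y \<subseteq> V \<and> card Y = 4 * j}. weight j)"
    unfolding test_sets_def by (subst sum.Sigma) (use finite_V in \<open>auto simp: split_def\<close>)
  also have "\<dots> = (\<Sum>j = 1..k. real (card V choose j) * real (card V choose (4 * j)) * weight j)"
    by (simp add: card_cartesian_product n_subsets[OF finite_V])
  also have "\<dots> \<le> (\<Sum>j = 1..k. 2 * ?n * (1 / 4) ^ j)"
  proof (rule sum_mono)
    fix j assume j: "j \<in> {1..k}"
    hence j0: "0 < j" and jn: "1000 * real j \<le> ?n" using assms by auto
    define x where "x = real j / ?n"
    have x: "0 < x" "x \<le> 1 / 1000" using j0 n0 jn by (auto simp: x_def field_simps)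
    have b1: "real (card V choose j) \<le> (3 / x) ^ j"
      using binomial_le_pow3[OF j0, of "card V"] by (simp add: x_def)
    have "real (card V choose (4 * j)) \<le> (3 * ?n / real (4 * j)) ^ (4 * j)"
      using j0 by (intro binomial_le_pow3) auto
    also have "\<dots> \<le> (3 / x) ^ (4 * j)"
      using j0 n0 by (intro power_mono) (auto simp: x_def field_simps)
    finally have b2: "real (card V choose (4 * j)) \<le> (3 / x) ^ (4 * j)" .
    have "real (card V choose j) * real (card V choose (4 * j)) * weight j
      \<le> (3 / x) ^ j * (3 / x) ^ (4 * j) * weight j"
      using x by (intro mult_right_mono mult_mono b1 b2) (auto simp: weight_def)
    also have "\<dots> = 2 * ?n * ((3 / x) ^ 5 * (16 * x) ^ 11) ^ j"
    proof -
      have "(3 / x) ^ j * (3 / x) ^ (4 * j) = ((3 / x) ^ 5) ^ j"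
        by (simp flip: power_add power_mult)
      moreover have "weight j = 2 * ?n * ((16 * x) ^ 11) ^ j"
        by (simp add: weight_def x_def flip: power_mult)
      ultimately show ?thesis by (simp only: power_mult_distrib mult_ac)
    qed
    also have "\<dots> \<le> 2 * ?n * (1 / 4) ^ j"
    proof (intro mult_left_mono power_mono)
      have "(3 / x) ^ 5 * (16 * x) ^ 11 = 3 ^ 5 * 16 ^ 11 * x ^ 6"
        using x by (simp add: field_simps eval_nat_numeral)
      also have "\<dots> \<le> 3 ^ 5 * 16 ^ 11 * (1 / 1000) ^ 6"
        using x by (intro mult_left_mono power_mono) auto
      also have "\<dots> \<le> 1 / 4" by (simp add: field_simps)
      finally show "(3 / x) ^ 5 * (16 * x) ^ 11 \<le> 1 / 4" .
    qed (use x in auto)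
    finally show "real (card V choose j) * real (card V choose (4 * j)) * weight j \<le> 2 * ?n * (1 / 4) ^ j" .
  qed
  also have "\<dots> = 2 * ?n * (\<Sum>j = 1..k. (1 / 4) ^ j)" by (simp add: sum_distrib_left)
  also have "\<dots> \<le> 2 * ?n * (1 / 3)" by (intro mult_left_mono sum_quarter_powers) auto
  finally show ?thesis by simp
qed

text \<open>At most \<open>threshold j * a\<close> of at least \<open>a / 4\<close> options lie in
  \<open>Y\<close>, a fraction of at most \<open>4 * threshold j\<close>, which \<open>trap\<close>
  divides out.\<close>

lemma trap_average:
  assumes "1 \<le> j" "v \<in> V" "A \<subseteq> N v" "a / 4 \<le> card A"
  shows "(\<Sum>w\<in>A. trap (j, U, Y) (v, w)) \<le> card A"
proof (cases "v \<in> U \<and> card (N v \<inter> Y) \<le> threshold j * a")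
  case True
  have fA: "finite A" using assms(3) finite_N by (rule finite_subset)
  have t: "0 < threshold j" using assms(1) V_ne finite_V by (simp add: threshold_def card_gt_0_iff)
  have "(\<Sum>w\<in>A. trap (j, U, Y) (v, w)) = (\<Sum>w\<in>A. of_bool (w \<in> Y) / (4 * threshold j))"
    using True by (simp add: trap_def)
  also have "\<dots> = card (A \<inter> Y) / (4 * threshold j)"
    using fA by (simp add: sum_divide_distrib[symmetric] Int_def)
  also have "\<dots> \<le> (threshold j * a) / (4 * threshold j)"
  proof (rule divide_right_mono)
    have "card (A \<inter> Y) \<le> card (N v \<inter> Y)" using assms(3) finite_N by (intro card_mono) auto
    thus "card (A \<inter> Y) \<le> threshold j * a" using True by linarith
  qed (use t in simp)
  also have "\<dots> = a / 4" using t by simp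
  finally show ?thesis using assms(4) by linarith
next
  case False
  thus ?thesis by (auto simp: trap_def)
qed

text \<open>One potential serves both purposes. The load terms, of total initial weight
  \<open>card V\<close>, keep options available throughout; the trap terms, of weight at most
  \<open>2 / 3 * card V\<close>, are evaluated only at the end. All terms are nonnegative, so each
  stays below \<open>2 * card V\<close>.\<close>

lemma selection:
  assumes "1000 * k \<le> card V"
  shows "\<exists>M. M \<subseteq> Sigma V N \<and> admissible M \<and> (\<forall>v\<in>V. card {w. (v, w) \<in> M} = d) \<and>
    (\<forall>(j, U, Y)\<in>test_sets k. weight j * (\<Prod>m\<in>M. trap (j, U, Y) m) < 2 * card V)"
proof -
  define I where "I = V <+> test_sets k"
  define c where "c = case_sum (\<lambda>u::'a. 1) (\<lambda>(j, U :: 'a set, Y :: 'a set). weight j)"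
  define g where "g = case_sum (\<lambda>u m. 2 ^ load u m / (1 + drift u (fst m))) trap"
  have n0: "0 < card V" using V_ne finite_V by (simp add: card_gt_0_iff)
  have finI: "finite I" unfolding I_def using finite_V finite_test_sets by simp
  have pos: "0 < 1 + drift u v" for u v using drift_nonneg[of u v] by linarith
  have c0: "0 \<le> c i" for i by (auto simp: c_def weight_def split: sum.split)
  have g0: "0 \<le> g i m" for i m
    using pos by (auto simp: g_def trap_def threshold_def less_imp_le split: sum.split prod.split)
  have "sum c I = card V + (\<Sum>(j, U, Y)\<in>test_sets k. weight j)"
    unfolding I_def using finite_V finite_test_sets by (simp add: sum.Plus c_def split_def)
  also have "\<dots> \<le> card V + 2 / 3 * card V" using sum_weight[OF assms] by simp
  also have "\<dots> < 2 * card V" using n0 by simp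
  finally have cI: "sum c I < 2 * card V" .
  have bound: "c i * (\<Prod>m\<in>M. g i m) < 2 * card V"
    if "(\<Sum>i\<in>I. c i * (\<Prod>m\<in>M. g i m)) \<le> sum c I" "i \<in> I" for i M
  proof -
    have "c i * (\<Prod>m\<in>M. g i m) \<le> (\<Sum>i\<in>I. c i * (\<Prod>m\<in>M. g i m))"
      using c0 g0 finI that(2) by (intro member_le_sum) (auto intro!: mult_nonneg_nonneg prod_nonneg)
    thus ?thesis using that(1) cI by linarith
  qed
  have "\<exists>M. M \<subseteq> Sigma V N \<and> admissible M \<and> (\<Sum>i\<in>I. c i * (\<Prod>m\<in>M. g i m)) \<le> sum c I \<and>
    (\<forall>v\<in>V. d \<le> card {w. (v, w) \<in> M})"
  proof (rule product_selection[where b = "a / 4"])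
    show "admissible {}" by (simp add: admissible_def compatible_subgraph_def)
    fix i v A assume A: "i \<in> I" "v \<in> V" "A \<subseteq> N v" "a / 4 \<le> card A"
    show "(\<Sum>w\<in>A. g i (v, w)) \<le> card A"
    proof (cases i)
      case (Inl u)
      thus ?thesis using A load_average[of u v A] by (auto simp: I_def g_def)
    next
      case (Inr x)
      thus ?thesis using A trap_average by (auto simp: I_def g_def test_sets_def)
    qed
  next
    fix M v assume M: "admissible M" "M \<subseteq> Sigma V N" "(\<Sum>i\<in>I. c i * (\<Prod>m\<in>M. g i m)) \<le> sum c I"
      and v: "v \<in> V" "card {w. (v, w) \<in> M} < d"
    have "c (Inl v) * (\<Prod>m\<in>M. g (Inl v) m) < 2 * card V"
      by (rule bound[OF M(3)]) (auto simp: I_def v)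
    hence "(\<Prod>m\<in>M. 2 ^ load v m / (1 + drift v (fst m))) \<le> 2 * real (card V)"
      by (simp add: c_def g_def)
    hence "real (\<Sum>m\<in>M. load v m) \<le> 42 * d * a"
      using M(1) by (intro sum_load_le v M) (auto simp: admissible_def)
    thus "\<exists>A\<subseteq>N v. a / 4 \<le> card A \<and> (\<forall>w\<in>A. (v, w) \<notin> M \<and> admissible (insert (v, w) M))"
      by (intro options M v)
  qed (use finI finite_V finite_N c0 g0 a_pos in auto)
  then obtain M where M: "M \<subseteq> Sigma V N" "admissible M" "(\<Sum>i\<in>I. c i * (\<Prod>m\<in>M. g i m)) \<le> sum c I"
    "\<forall>v\<in>V. d \<le> card {w. (v, w) \<in> M}" by blast
  have "card {w. (v, w) \<in> M} = d" if "v \<in> V" for v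
    using M(2,4) that by (auto simp: admissible_def intro: antisym)
  moreover have "weight j * (\<Prod>m\<in>M. trap (j, U, Y) m) < 2 * card V" if "(j, U, Y) \<in> test_sets k" for j U Y
    using bound[OF M(3), of "Inr (j, U, Y)"] that by (auto simp: I_def c_def g_def)
  ultimately show ?thesis using M(1,2) by blast
qed

lemma prod_trap:
  assumes M: "M \<subseteq> Sigma V N" and out: "\<And>v. v \<in> V \<Longrightarrow> card {w. (v, w) \<in> M} = d"
    and U: "U \<subseteq> V" and inY: "\<And>v w. v \<in> U \<Longrightarrow> (v, w) \<in> M \<Longrightarrow> w \<in> Y"
  shows "(\<Prod>m\<in>M. trap (j, U, Y) m) =
    (1 / (4 * threshold j)) ^ (d * card {v \<in> U. card (N v \<inter> Y) \<le> threshold j * a})"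
proof -
  define G where "G = {v \<in> U. card (N v \<inter> Y) \<le> threshold j * a}"
  have finM: "finite M" using M finite_Sigma_N by (rule finite_subset)
  have fG: "finite G" using finite_subset[OF U finite_V] by (simp add: G_def)
  have f1: "finite {w. (x, w) \<in> M}" for x
    by (rule finite_subset[of _ "snd ` M"]) (use finM in force)+
  have "(\<Prod>m\<in>M. trap (j, U, Y) m) = (\<Prod>m\<in>M. if fst m \<in> G then 1 / (4 * threshold j) else 1)"
    using inY by (intro prod.cong) (auto simp: trap_def G_def)
  also have "\<dots> = (1 / (4 * threshold j)) ^ card (M \<inter> {m. fst m \<in> G})"
    using finM by (simp add: prod.If_cases)
  also have "M \<inter> {m. fst m \<in> G} = (SIGMA v:G. {w. (v, w) \<in> M})" by auto
  also have "card \<dots> = (\<Sum>v\<in>G. card {w. (v, w) \<in> M})" using fG f1 by simp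
  also have "\<dots> = (\<Sum>v\<in>G. d)" using U by (intro sum.cong out) (auto simp: G_def)
  also have "\<dots> = d * card G" by simp
  finally show ?thesis by (simp add: G_def)
qed

text \<open>All picks from a non-expanding \<open>U\<close> stay in a set \<open>Y\<close> of size
  \<open>4 * card U\<close>. By \<open>spread\<close>, at least half of \<open>U\<close> has few
  neighbours in \<open>Y\<close>, and the picks of these vertices alone push the term of
  \<open>(card U, U, Y)\<close> up to \<open>2 * card V\<close>.\<close>

lemma expanding_stars:
  assumes k: "1000 * k \<le> card V" and d: "d = 44"
    and spread: "\<And>X Y. X \<subseteq> V \<Longrightarrow> Y \<subseteq> V \<Longrightarrow> X \<noteq> {} \<Longrightarrow> card X \<le> k \<Longrightarrow> card Y = 8 * card X \<Longrightarrow>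
      \<exists>x\<in>X. card (nbrs E x \<inter> Y) \<le> max 40 (sqrt (card X / card V) * a)"
  shows "\<exists>\<Gamma>\<subseteq>E. compatible_subgraph V F \<Gamma> \<and> card \<Gamma> \<le> 44 * card V \<and> expanding V k \<Gamma>"
proof -
  obtain M where M: "M \<subseteq> Sigma V N" "admissible M" "\<And>v. v \<in> V \<Longrightarrow> card {w. (v, w) \<in> M} = d"
    "\<And>j U Y. (j, U, Y) \<in> test_sets k \<Longrightarrow> weight j * (\<Prod>m\<in>M. trap (j, U, Y) m) < 2 * card V"
    using selection[OF k] by blast
  have n0: "0 < card V" using V_ne finite_V by (simp add: card_gt_0_iff)
  have finM: "finite M" using M(1) finite_Sigma_N by (rule finite_subset)
  have f1: "finite {w. (x, w) \<in> M}" for x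
    by (rule finite_subset[of _ "snd ` M"]) (use finM in force)+
  define \<Gamma> where "\<Gamma> = undirected ` M"
  have \<Gamma>E: "\<Gamma> \<subseteq> E" using M(1) by (auto simp: \<Gamma>_def undirected_def N_iff)
  have "card \<Gamma> \<le> card M" unfolding \<Gamma>_def by (rule card_image_le[OF finM])
  also have "M = (SIGMA v:V. {w. (v, w) \<in> M})" using M(1) by auto
  also have "card \<dots> = (\<Sum>v\<in>V. card {w. (v, w) \<in> M})" using finite_V f1 by simp
  also have "\<dots> = 44 * card V" using M(3) d by simp
  finally have "card \<Gamma> \<le> 44 * card V" .
  moreover have "expanding V k \<Gamma>"
    unfolding expanding_def
  proof (intro allI impI, elim conjE)
    fix U assume U: "U \<subseteq> V" "U \<noteq> {}" "card U \<le> k"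
    show "3 * card U \<le> card (outer_nbrs \<Gamma> U)"
    proof (rule ccontr)
      assume less: "\<not> 3 * card U \<le> card (outer_nbrs \<Gamma> U)"
      define j where "j = card U"
      have finU: "finite U" using U(1) finite_V by (rule finite_subset)
      have j: "1 \<le> j" "j \<le> k" using U finU by (auto simp: j_def Suc_le_eq card_gt_0_iff)
      have \<Gamma>V: "\<Gamma> \<subseteq> all_edges V" using \<Gamma>E E_sub by simp
      have oV: "outer_nbrs \<Gamma> U \<subseteq> V" using nbrs_subset[OF \<Gamma>V] by (auto simp: outer_nbrs_def)
      \<comment> \<open>\<open>U\<close> itself and fewer than \<open>3 * j\<close> outer
        neighbours.\<close>
      have "card (U \<union> outer_nbrs \<Gamma> U) \<le> 4 * j"
        using card_Un_le[of U "outer_nbrs \<Gamma> U"] less by (simp add: j_def)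
      moreover have "4 * j \<le> card V" using j(2) k by linarith
      ultimately obtain Y where Y: "U \<union> outer_nbrs \<Gamma> U \<subseteq> Y" "Y \<subseteq> V" "card Y = 4 * j"
        using exists_subset_between[of "U \<union> outer_nbrs \<Gamma> U" "4 * j" V] U(1) oV finite_V by auto
      have inY: "w \<in> Y" if "v \<in> U" "(v, w) \<in> M" for v w
      proof -
        have "w \<in> nbrs \<Gamma> v" using that(2) by (auto simp: nbrs_def \<Gamma>_def undirected_def intro!: image_eqI)
        thus ?thesis using that(1) Y(1) by (auto simp: outer_nbrs_def)
      qed
      have many: "44 \<le> card (N v \<inter> Y)" if "v \<in> U" for v
      proof -
        have "{w. (v, w) \<in> M} \<subseteq> N v \<inter> Y" using inY that M(1) by auto
        hence "card {w. (v, w) \<in> M} \<le> card (N v \<inter> Y)" using finite_N by (intro card_mono) auto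
        thus ?thesis using M(3)[of v] that U(1) d by auto
      qed
      define G where "G = {v \<in> U. card (N v \<inter> Y) \<le> threshold j * a}"
      define X where "X = U - G"
      \<comment> \<open>Otherwise the remaining part \<open>X\<close> has at least
        \<open>j / 2\<close> vertices, so \<open>Y\<close> fits into a set of size
        \<open>8 * card X\<close>, to which \<open>spread\<close> applies. The alternative 40 in its
        bound is ruled out by the 44 picks in \<open>Y\<close>, which leaves the square
        root.\<close>
      have half: "j \<le> 2 * card G"
      proof (rule ccontr)
        assume "\<not> j \<le> 2 * card G"
        moreover have "card X = j - card G"
          unfolding X_def j_def using finU by (intro card_Diff_subset) (auto simp: G_def finU)
        ultimately have X: "j \<le> 2 * card X" "card X \<le> j" "0 < card X" by auto
        hence "card Y \<le> 8 * card X" using Y(3) by linarith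
        moreover have "8 * card X \<le> card V" using X(2) j(2) k by linarith
        ultimately obtain Y' where Y': "Y \<subseteq> Y'" "Y' \<subseteq> V" "card Y' = 8 * card X"
          using exists_subset_between[of Y "8 * card X" V] Y(2) finite_V by auto
        have "X \<subseteq> V" using U(1) by (auto simp: X_def)
        moreover have "X \<noteq> {}" "card X \<le> k" using X j(2) by auto
        ultimately obtain x where x: "x \<in> X" "card (N x \<inter> Y') \<le> max 40 (sqrt (card X / card V) * a)"
          using spread[OF _ Y'(2) _ _ Y'(3)] unfolding N_def by blast
        have le: "card (N x \<inter> Y) \<le> card (N x \<inter> Y')" using Y'(1) finite_N by (intro card_mono) auto
        have "44 \<le> card (N x \<inter> Y)" using many x(1) by (auto simp: X_def)
        hence "card (N x \<inter> Y') \<le> sqrt (card X / card V) * a" using x(2) le by auto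
        also have "\<dots> \<le> threshold j * a"
          unfolding threshold_def using X(2) a_pos by (intro mult_right_mono real_sqrt_le_mono divide_right_mono) auto
        finally have "card (N x \<inter> Y) \<le> threshold j * a" using le by linarith
        thus False using x(1) by (auto simp: X_def G_def)
      qed
      have inT: "(j, U, Y) \<in> test_sets k" using j U(1) Y by (auto simp: test_sets_def j_def)
      define z where "z = 16 * real j / card V"
      have z: "0 < z" "z \<le> 1" using j n0 k by (auto simp: z_def field_simps)
      have t: "4 * threshold j = sqrt z" by (simp add: threshold_def z_def real_sqrt_mult real_sqrt_divide)
      have "z ^ (11 * j) = sqrt z ^ (22 * j)"
      proof -
        have "sqrt z ^ (22 * j) = (sqrt z ^ 2) ^ (11 * j)" by (simp flip: power_mult)
        thus ?thesis using z by simp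
      qed
      \<comment> \<open>Since \<open>z\<close> is at most 1, extra trapped vertices only enlarge the
        trap product.\<close>
      moreover have "sqrt z ^ (44 * card G) \<le> sqrt z ^ (22 * j)"
        using z half by (intro power_decreasing) auto
      ultimately have "1 \<le> z ^ (11 * j) * (1 / sqrt z) ^ (44 * card G)"
        using z by (simp add: power_divide)
      hence "2 * real (card V) * 1 \<le> 2 * real (card V) * (z ^ (11 * j) * (1 / sqrt z) ^ (44 * card G))"
        by (intro mult_left_mono) auto
      also have "\<dots> = weight j * (\<Prod>m\<in>M. trap (j, U, Y) m)"
        using prod_trap[OF M(1,3) U(1), of Y j] inY
        by (simp add: weight_def z_def[symmetric] t G_def d mult.assoc)
      finally show False using M(4)[OF inT] by simp
    qed
  qed
  ultimately show ?thesis using \<Gamma>E M(2) by (intro exI[of _ \<Gamma>]) (auto simp: admissible_def \<Gamma>_def)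
qed

end

section \<open>Properties of the random graph\<close>

lemma set_pmf_gnp: "set_pmf (gnp n p) \<subseteq> Pow (all_edges {..<n})"
  by (auto simp: gnp_def)

lemma finite_set_pmf_gnp: "finite (set_pmf (gnp n p))"
  by (rule finite_subset[OF set_pmf_gnp]) (simp add: finite_all_edges)

lemma integrable_gnp: "integrable (measure_pmf (gnp n p)) (f :: _ \<Rightarrow> real)"
  by (rule integrable_measure_pmf_finite[OF finite_set_pmf_gnp])

text \<open>Both factors are products over single edges, and disjointness of \<open>\<Gamma>\<close>
  and \<open>S\<close> keeps each edge in only one of them. With \<open>\<Gamma> = {}\<close> this
  is the usual generating function of the edge count on \<open>S\<close>.\<close>

lemma expectation_gnp_card:
  fixes p x :: real
  assumes p: "0 \<le> p" "p \<le> 1" and sub: "\<Gamma> \<subseteq> all_edges {..<n}" "S \<subseteq> all_edges {..<n}" "\<Gamma> \<inter> S = {}"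
    and x: "0 \<le> x"
  shows "measure_pmf.expectation (gnp n p) (\<lambda>E. of_bool (\<Gamma> \<subseteq> E) * x ^ card (E \<inter> S))
    = p ^ card \<Gamma> * (1 - p + p * x) ^ card S"
proof -
  define A where "A = all_edges {..<n}"
  have finA: "finite A" by (simp add: A_def finite_all_edges)
  have fin: "finite \<Gamma>" "finite S" using sub finA unfolding A_def by (auto intro: finite_subset)
  define \<phi> where "\<phi> e b = (if e \<in> \<Gamma> then of_bool b else if e \<in> S \<and> b then x else (1::real))" for e b
  have eq: "of_bool (\<Gamma> \<subseteq> {e \<in> A. f e}) * x ^ card ({e \<in> A. f e} \<inter> S) = (\<Prod>e\<in>A. \<phi> e (f e))" for f
  proof -
    have "(\<Prod>e\<in>A. \<phi> e (f e)) = (\<Prod>e\<in>A. if e \<in> \<Gamma> then of_bool (f e) else 1) * (\<Prod>e\<in>A. if e \<in> S \<and> f e then x else 1)"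
      using sub(3) by (subst prod.distrib[symmetric]) (auto simp: \<phi>_def intro!: prod.cong)
    also have "(\<Prod>e\<in>A. if e \<in> S \<and> f e then x else 1) = x ^ card (A \<inter> {e. e \<in> S \<and> f e})"
      using finA by (simp add: prod.If_cases)
    also have "A \<inter> {e. e \<in> S \<and> f e} = {e \<in> A. f e} \<inter> S" by blast
    also have "(\<Prod>e\<in>A. if e \<in> \<Gamma> then of_bool (f e) else 1) = (of_bool (\<Gamma> \<subseteq> {e \<in> A. f e}) :: real)"
    proof (cases "\<Gamma> \<subseteq> {e \<in> A. f e}")
      case True
      hence "(\<Prod>e\<in>A. if e \<in> \<Gamma> then of_bool (f e) else 1) = (\<Prod>e\<in>A. (1::real))"
        by (intro prod.cong) auto
      thus ?thesis using True by simp
    next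
      case False
      then obtain e where "e \<in> \<Gamma>" "\<not> f e" using sub(1) by (auto simp: A_def)
      moreover from this have "e \<in> A" using sub(1) by (auto simp: A_def)
      ultimately have "\<exists>e\<in>A. (if e \<in> \<Gamma> then of_bool (f e) else (1::real)) = 0" by auto
      hence "(\<Prod>e\<in>A. if e \<in> \<Gamma> then of_bool (f e) else (1::real)) = 0" using finA by (simp add: prod_zero_iff)
      thus ?thesis using False by simp
    qed
    finally show ?thesis by simp
  qed
  have "measure_pmf.expectation (gnp n p) (\<lambda>E. of_bool (\<Gamma> \<subseteq> E) * x ^ card (E \<inter> S)) =
    measure_pmf.expectation (Pi_pmf A False (\<lambda>_. bernoulli_pmf p)) (\<lambda>f. \<Prod>e\<in>A. \<phi> e (f e))"
    unfolding gnp_def integral_map_pmf A_def[symmetric] eq ..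
  also have "\<dots> = (\<Prod>e\<in>A. measure_pmf.expectation (bernoulli_pmf p) (\<phi> e))"
    using x by (intro expectation_prod_Pi_pmf finA integrable_measure_pmf_finite) (auto simp: \<phi>_def)
  also have "\<dots> = (\<Prod>e\<in>A. (if e \<in> \<Gamma> then p else 1) * (if e \<in> S then 1 - p + p * x else 1))"
    using p sub(3) by (intro prod.cong refl) (auto simp: \<phi>_def)
  also have "\<dots> = p ^ card (A \<inter> \<Gamma>) * (1 - p + p * x) ^ card (A \<inter> S)"
    using finA by (simp add: prod.distrib prod.If_cases)
  also have "A \<inter> \<Gamma> = \<Gamma>" using sub(1) by (auto simp: A_def)
  also have "A \<inter> S = S" using sub(2) by (auto simp: A_def)
  finally show ?thesis .
qed

lemma prob_gnp_le_expectation: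
  assumes "\<And>E. 0 \<le> \<phi> E" "\<And>E. E \<in> B \<Longrightarrow> 1 \<le> \<phi> E"
  shows "measure_pmf.prob (gnp n p) B \<le> measure_pmf.expectation (gnp n p) \<phi>"
proof -
  have "measure_pmf.prob (gnp n p) B = measure_pmf.expectation (gnp n p) (indicator B)" by simp
  also have "\<dots> \<le> measure_pmf.expectation (gnp n p) \<phi>"
    using assms by (intro integral_mono integrable_gnp) (auto simp: indicator_def)
  finally show ?thesis .
qed

text \<open>Markov's inequality for \<open>(1 / 2) ^ card (E \<inter> S)\<close> restricted to the
  graphs containing \<open>\<Gamma>\<close>; the constant \<open>3 / 4\<close> bounds
  \<open>ln 2\<close>. The factor \<open>p ^ card \<Gamma>\<close> later pays for the union over all
  \<open>\<Gamma>\<close>.\<close>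

lemma gnp_lower_tail:
  fixes p t :: real
  assumes p: "0 \<le> p" "p \<le> 1" and sub: "\<Gamma> \<subseteq> all_edges {..<n}" "S \<subseteq> all_edges {..<n}" "\<Gamma> \<inter> S = {}"
    and t: "0 \<le> t"
  shows "measure_pmf.prob (gnp n p) {E. \<Gamma> \<subseteq> E \<and> card (E \<inter> S) \<le> t}
    \<le> p ^ card \<Gamma> * exp (3 / 4 * t - p * card S / 2)"
proof -
  have "measure_pmf.prob (gnp n p) {E. \<Gamma> \<subseteq> E \<and> card (E \<inter> S) \<le> t}
    \<le> measure_pmf.expectation (gnp n p) (\<lambda>E. 2 powr t * (of_bool (\<Gamma> \<subseteq> E) * (1 / 2) ^ card (E \<inter> S)))"
  proof (rule prob_gnp_le_expectation)
    fix E assume "E \<in> {E. \<Gamma> \<subseteq> E \<and> card (E \<inter> S) \<le> t}"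
    hence E: "\<Gamma> \<subseteq> E" "card (E \<inter> S) \<le> t" by auto
    have "(2::real) ^ card (E \<inter> S) = 2 powr card (E \<inter> S)" by (simp add: powr_realpow)
    also have "\<dots> \<le> 2 powr t" using E by (intro powr_mono) auto
    finally show "1 \<le> 2 powr t * (of_bool (\<Gamma> \<subseteq> E) * (1 / 2) ^ card (E \<inter> S))"
      using E(1) by (simp add: power_one_over field_simps)
  qed simp
  also have "\<dots> = 2 powr t * (p ^ card \<Gamma> * (1 - p + p * (1 / 2)) ^ card S)"
    using expectation_gnp_card[OF p sub, of "1 / 2"] by simp
  also have "\<dots> \<le> exp (3 / 4 * t) * (p ^ card \<Gamma> * exp (- (p / 2)) ^ card S)"
  proof (intro mult_mono power_mono order_refl)
    have "2 powr t = exp (t * ln 2)" by (simp add: powr_def)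
    also have "t * ln 2 \<le> t * (3 / 4)" using t ln2_le_25_over_36 by (intro mult_left_mono) auto
    finally show "2 powr t \<le> exp (3 / 4 * t)" by (simp add: mult.commute)
    show "1 - p + p * (1 / 2) \<le> exp (- (p / 2))" using exp_ge_add_one_self[of "- (p / 2)"] by simp
  qed (use p in auto)
  also have "\<dots> = p ^ card \<Gamma> * exp (3 / 4 * t - p * card S / 2)"
    by (simp add: exp_of_nat_mult[symmetric] exp_add[symmetric] mult.commute)
  finally show ?thesis .
qed

text \<open>The base \<open>x\<close> stays free: degrees use 2, whereas dense pairs need a base
  that grows as the pair gets smaller.\<close>

lemma gnp_upper_tail:
  fixes p x t :: real
  assumes p: "0 \<le> p" "p \<le> 1" and S: "S \<subseteq> all_edges {..<n}" and x: "1 \<le> x"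
  shows "measure_pmf.prob (gnp n p) {E. t \<le> card (E \<inter> S)} \<le> exp (p * (x - 1) * card S) / x powr t"
proof -
  have "measure_pmf.prob (gnp n p) {E. t \<le> card (E \<inter> S)}
    \<le> measure_pmf.expectation (gnp n p) (\<lambda>E. 1 / x powr t * (of_bool ({} \<subseteq> E) * x ^ card (E \<inter> S)))"
  proof (rule prob_gnp_le_expectation)
    fix E assume "E \<in> {E. t \<le> card (E \<inter> S)}"
    hence "x powr t \<le> x powr card (E \<inter> S)" using x by (intro powr_mono) auto
    also have "\<dots> = x ^ card (E \<inter> S)" using x by (simp add: powr_realpow)
    finally show "1 \<le> 1 / x powr t * (of_bool ({} \<subseteq> E) * x ^ card (E \<inter> S))"
      using x by (simp add: field_simps)
  qed (use x in auto)
  also have "\<dots> = (1 - p + p * x) ^ card S / x powr t"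
    using expectation_gnp_card[OF p _ S, of "{}" x] x by simp
  also have "\<dots> \<le> exp (p * (x - 1)) ^ card S / x powr t"
  proof (intro divide_right_mono power_mono)
    show "1 - p + p * x \<le> exp (p * (x - 1))"
      using exp_ge_add_one_self[of "p * (x - 1)"] by (simp add: algebra_simps)
    show "0 \<le> 1 - p + p * x" using p x by (simp add: add_nonneg_nonneg)
  qed simp
  also have "exp (p * (x - 1)) ^ card S = exp (p * (x - 1) * card S)"
    by (simp add: exp_of_nat_mult[symmetric] mult.commute)
  finally show ?thesis .
qed

section \<open>Union bounds for the exceptional events\<close>

lemma prob_UN_le:
  assumes "finite I" "B \<subseteq> (\<Union>i\<in>I. C i)" "\<And>i. i \<in> I \<Longrightarrow> measure_pmf.prob M (C i) \<le> b i"
  shows "measure_pmf.prob M B \<le> sum b I"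
proof -
  have "measure_pmf.prob M B \<le> measure_pmf.prob M (\<Union>i\<in>I. C i)"
    by (intro measure_pmf.finite_measure_mono assms) auto
  also have "\<dots> \<le> (\<Sum>i\<in>I. measure_pmf.prob M (C i))"
    by (intro measure_pmf.finite_measure_subadditive_finite assms) auto
  also have "\<dots> \<le> sum b I" by (intro sum_mono assms)
  finally show ?thesis .
qed

text \<open>Cutting neighbourhoods down to \<open>{..<n} - {v}\<close> makes the degree equal to the
  number of edges in the star \<open>S v\<close> for every set system \<open>E\<close>, not only for
  graphs.\<close>

lemma prob_degrees:
  fixes p :: real
  assumes p: "0 \<le> p" "p \<le> 1"
  shows "measure_pmf.prob (gnp n p) {E. \<exists>v<n. real (card (nbrs E v \<inter> {..<n} - {v})) < n * p / 2 \<or>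
      2 * (n * p) < card (nbrs E v \<inter> {..<n} - {v})} \<le> 3 * n * exp (- (n * p / 8))"
proof -
  define S where "S v = (\<lambda>w. {v, w}) ` ({..<n} - {v})" for v
  define a where "a = n * p"
  have a0: "0 \<le> a" using p by (simp add: a_def)
  have deg: "card (nbrs E v \<inter> {..<n} - {v}) = card (E \<inter> S v)" for E v
  proof -
    have "E \<inter> S v = (\<lambda>w. {v, w}) ` (nbrs E v \<inter> {..<n} - {v})" by (auto simp: S_def nbrs_def)
    thus ?thesis by (simp add: card_image inj_on_def doubleton_inj)
  qed
  have SA: "S v \<subseteq> all_edges {..<n}" if "v < n" for v
    using that by (auto simp: S_def all_edges_iff)
  have cS: "card (S v) = n - 1" if "v < n" for v
  proof -
    have "card (S v) = card ({..<n} - {v})"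
      unfolding S_def by (rule card_image) (auto simp: inj_on_def dest: doubleton_inj)
    thus ?thesis using that by simp
  qed
  have lo: "measure_pmf.prob (gnp n p) {E. card (E \<inter> S v) \<le> a / 2} \<le> 2 * exp (- (a / 8))" if v: "v < n" for v
  proof -
    have "measure_pmf.prob (gnp n p) {E. {} \<subseteq> E \<and> card (E \<inter> S v) \<le> a / 2}
      \<le> p ^ card ({} :: nat set set) * exp (3 / 4 * (a / 2) - p * card (S v) / 2)"
      using a0 by (intro gnp_lower_tail p SA v) auto
    also have "\<dots> = exp (- (a / 8) + p / 2)"
    proof -
      have "3 / 4 * (a / 2) - p * card (S v) / 2 = - (a / 8) + p / 2"
        using v cS[OF v] by (simp add: a_def of_nat_diff field_simps)
      thus ?thesis by simp
    qed
    \<comment> \<open>The star at \<open>v\<close> has \<open>n - 1\<close> rather than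
      \<open>n\<close> pairs; this costs the factor \<open>exp (p / 2)\<close>.\<close>
    also have "\<dots> \<le> exp (- (a / 8) + 1 / 2)" using p by simp
    also have "\<dots> = exp (- (a / 8)) * exp (1 / 2)" by (rule exp_add)
    also have "\<dots> \<le> exp (- (a / 8)) * 2"
      using exp_half_le2 by (intro mult_left_mono) auto
    finally show ?thesis by simp
  qed
  have hi: "measure_pmf.prob (gnp n p) {E. 2 * a \<le> card (E \<inter> S v)} \<le> exp (- (a / 8))" if v: "v < n" for v
  proof -
    have "measure_pmf.prob (gnp n p) {E. 2 * a \<le> card (E \<inter> S v)} \<le> exp (p * (2 - 1) * card (S v)) / 2 powr (2 * a)"
      by (intro gnp_upper_tail p SA v) auto
    also have "\<dots> \<le> exp a / exp (4 / 3 * a)"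
    proof (intro frac_le)
      show "exp (p * (2 - 1) * card (S v)) \<le> exp a"
        using p cS[OF v] by (simp add: a_def mult.commute mult_left_mono)
      have "2 / 3 * (2 * a) \<le> ln 2 * (2 * a)" using ln2_ge_two_thirds a0 by (intro mult_right_mono) auto
      thus "exp (4 / 3 * a) \<le> 2 powr (2 * a)" by (simp add: powr_def mult.commute)
    qed auto
    also have "\<dots> = exp (- (a / 3))" by (simp add: exp_diff[symmetric])
    also have "\<dots> \<le> exp (- (a / 8))" using a0 by simp
    finally show ?thesis .
  qed
  have "measure_pmf.prob (gnp n p) {E. \<exists>v<n. real (card (nbrs E v \<inter> {..<n} - {v})) < n * p / 2 \<or>
      2 * (n * p) < card (nbrs E v \<inter> {..<n} - {v})} \<le> (\<Sum>v<n. 3 * exp (- (a / 8)))"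
  proof (rule prob_UN_le)
    show "{E. \<exists>v<n. real (card (nbrs E v \<inter> {..<n} - {v})) < n * p / 2 \<or>
      2 * (n * p) < card (nbrs E v \<inter> {..<n} - {v})} \<subseteq>
      (\<Union>v<n. {E. card (E \<inter> S v) \<le> a / 2} \<union> {E. 2 * a \<le> card (E \<inter> S v)})"
      unfolding deg a_def by (auto simp: less_imp_le)
    fix v assume "v \<in> {..<n}"
    hence "measure_pmf.prob (gnp n p) {E. card (E \<inter> S v) \<le> a / 2} + measure_pmf.prob (gnp n p) {E. 2 * a \<le> card (E \<inter> S v)}
       \<le> 3 * exp (- (a / 8))"
      using lo[of v] hi[of v] by auto
    moreover have "measure_pmf.prob (gnp n p) ({E. card (E \<inter> S v) \<le> a / 2} \<union> {E. 2 * a \<le> card (E \<inter> S v)})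
      \<le> measure_pmf.prob (gnp n p) {E. card (E \<inter> S v) \<le> a / 2} + measure_pmf.prob (gnp n p) {E. 2 * a \<le> card (E \<inter> S v)}"
      by (rule measure_Un_le) auto
    ultimately show "measure_pmf.prob (gnp n p) ({E. card (E \<inter> S v) \<le> a / 2} \<union> {E. 2 * a \<le> card (E \<inter> S v)})
      \<le> 3 * exp (- (a / 8))" by linarith
  qed simp
  thus ?thesis by (simp add: a_def)
qed


lemma exp_div_powr_le:
  fixes x t :: real
  assumes "1 \<le> x" "0 \<le> t" shows "exp t / x powr t \<le> (3 / x) powr t"
proof -
  have "exp t = exp 1 powr t" by (simp add: powr_def)
  also have "\<dots> \<le> 3 powr t" using assms exp_le by (intro powr_mono2) auto
  finally have "exp t / x powr t \<le> 3 powr t / x powr t" by (rule divide_right_mono) simp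
  thus ?thesis using assms by (simp add: powr_divide)
qed

text \<open>Such a pair spans at least \<open>t = h * \<rho> / 2\<close> edges, halved because
  \<open>X\<close> and \<open>Y\<close> may overlap. The tail bound becomes a power of
  \<open>48 * \<theta>\<close> with exponent at least \<open>20 * h\<close>, where
  \<open>\<theta>\<close> squared is \<open>h / n\<close> and \<open>48 * 48 = 2304\<close>.\<close>

lemma prob_dense_pair:
  fixes p :: real
  assumes p: "0 \<le> p" "p \<le> 1" and X: "X \<subseteq> {..<n}" "card X = h" "0 < h" and Y: "Y \<subseteq> {..<n}" "card Y = 8 * h"
    and h: "2304 * h \<le> n"
  shows "measure_pmf.prob (gnp n p) {E. E \<subseteq> all_edges {..<n} \<and>
      (\<forall>x\<in>X. max 40 (sqrt (h / n) * (n * p)) < card (nbrs E x \<inter> Y))} \<le> (2304 * h / n) ^ (10 * h)"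
proof -
  define \<theta> where "\<theta> = sqrt (h / n)"
  define \<rho> where "\<rho> = max 40 (\<theta> * (n * p))"
  define t where "t = h * \<rho> / 2"
  \<comment> \<open>Chosen so that \<open>p * x\<close> times \<open>8 * h * h\<close>, which bounds
    the number of pairs, equals \<open>h * (\<theta> * n * p) / 2\<close>, at most
    \<open>t\<close>.\<close>
  define x where "x = 1 / (16 * \<theta>)"
  define S where "S = cross_edges X Y \<inter> all_edges {..<n}"
  have n: "0 < n" using h X(3) by linarith
  have fin: "finite X" "finite Y" using X Y by (auto intro: finite_subset)
  have \<theta>0: "0 < \<theta>" using X n by (simp add: \<theta>_def)
  have \<theta>2: "\<theta>\<^sup>2 = h / n" by (simp add: \<theta>_def)
  have "\<theta>\<^sup>2 \<le> (1 / 48)\<^sup>2" using h n unfolding \<theta>2 by (simp add: field_simps)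
  hence \<theta>1: "\<theta> \<le> 1 / 48" by (rule power2_le_imp_le) simp
  have x: "1 \<le> x" using \<theta>0 \<theta>1 by (simp add: x_def field_simps)
  have \<rho>: "40 \<le> \<rho>" "\<theta> * (n * p) \<le> \<rho>" by (auto simp: \<rho>_def)
  have t: "20 * real h \<le> t" using \<rho>(1) X(3) by (simp add: t_def)
  have img: "cross_edges X Y = (\<lambda>(x, y). {x, y}) ` (X \<times> Y)" by (auto simp: cross_edges_def)
  have fS: "finite (cross_edges X Y)" unfolding img using fin by simp
  have "card S \<le> card (cross_edges X Y)" unfolding S_def using fS by (intro card_mono) auto
  also have "\<dots> \<le> card (X \<times> Y)" unfolding img using fin by (intro card_image_le) auto
  finally have cS: "card S \<le> 8 * h\<^sup>2" using X Y by (simp add: card_cartesian_product power2_eq_square)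
  have "measure_pmf.prob (gnp n p) {E. E \<subseteq> all_edges {..<n} \<and> (\<forall>x\<in>X. \<rho> < card (nbrs E x \<inter> Y))}
    \<le> measure_pmf.prob (gnp n p) {E. t \<le> card (E \<inter> S)}"
  proof (intro measure_pmf.finite_measure_mono subsetI CollectI)
    fix E assume "E \<in> {E. E \<subseteq> all_edges {..<n} \<and> (\<forall>x\<in>X. \<rho> < card (nbrs E x \<inter> Y))}"
    hence E: "E \<subseteq> all_edges {..<n}" "\<And>x. x \<in> X \<Longrightarrow> \<rho> < card (nbrs E x \<inter> Y)" by auto
    have "(\<Sum>x\<in>X. card (nbrs E x \<inter> Y)) \<le> 2 * card (E \<inter> S)"
    proof (rule card_Sigma_le_unordered)
      show "finite (E \<inter> S)" using fS by (simp add: S_def)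
      fix x y assume "x \<in> X" "y \<in> nbrs E x \<inter> Y"
      hence "{x, y} \<in> E" "{x, y} \<in> cross_edges X Y" by (auto simp: nbrs_def cross_edges_def)
      thus "{x, y} \<in> E \<inter> S" using E(1) by (auto simp: S_def)
    qed (use fin in auto)
    hence "real (\<Sum>x\<in>X. card (nbrs E x \<inter> Y)) \<le> 2 * card (E \<inter> S)" by linarith
    moreover have "(\<Sum>x\<in>X. \<rho>) \<le> (\<Sum>x\<in>X. real (card (nbrs E x \<inter> Y)))"
      using E(2) by (intro sum_mono less_imp_le)
    ultimately show "t \<le> card (E \<inter> S)" using X by (simp add: t_def)
  qed simp
  also have "\<dots> \<le> exp (p * (x - 1) * card S) / x powr t"
    using x by (intro gnp_upper_tail p) (auto simp: S_def)
  also have "\<dots> \<le> exp t / x powr t"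
  proof (intro divide_right_mono)
    have "p * (x - 1) * card S \<le> p * x * (8 * h\<^sup>2)"
      using p x cS by (intro mult_mono) (auto simp: of_nat_le_iff[symmetric, where 'a = real] simp del: of_nat_le_iff)
    also have "\<dots> = h * (p * h / \<theta>) / 2" by (simp add: x_def power2_eq_square mult_ac)
    also have "p * h / \<theta> = \<theta> * (n * p)"
      using \<theta>2 \<theta>0 n by (simp add: field_simps power2_eq_square)
    also have "h * (\<theta> * (n * p)) / 2 \<le> t" unfolding t_def using \<rho>(2) by (intro divide_right_mono mult_left_mono) auto
    finally show "exp (p * (x - 1) * card S) \<le> exp t" by simp
  qed simp
  also have "\<dots> \<le> (3 / x) powr t" using x t by (intro exp_div_powr_le) auto
  also have "\<dots> \<le> (3 / x) powr (20 * h)"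
    using t \<theta>0 \<theta>1 by (intro powr_mono') (auto simp: x_def)
  also have "\<dots> = (3 / x) ^ (20 * h)"
    using x by (subst powr_realpow[symmetric]) auto
  also have "\<dots> = ((3 / x)\<^sup>2) ^ (10 * h)" by (simp flip: power_mult)
  also have "(3 / x)\<^sup>2 = 2304 * h / n" using \<theta>2 by (simp add: x_def power_mult_distrib)
  finally show ?thesis by (simp add: \<rho>_def \<theta>_def)
qed

text \<open>The choices of \<open>X\<close> and \<open>Y\<close> cost an exponent
  \<open>9 * h\<close>, and a dense pair gains \<open>10 * h\<close>; the minimum 40 in the spread
  bound was set to secure this margin. The remaining term is \<open>C * h / n\<close> to the power
  \<open>h\<close>.\<close>

lemma prob_spread:
  fixes p :: real
  defines "C \<equiv> 3 ^ 9 * 2304 ^ 10 :: nat"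
  assumes p: "0 \<le> p" "p \<le> 1" and k: "4 * C * k \<le> n"
  shows "measure_pmf.prob (gnp n p) {E. E \<subseteq> all_edges {..<n} \<and> (\<exists>X Y. X \<subseteq> {..<n} \<and> Y \<subseteq> {..<n} \<and> X \<noteq> {} \<and>
      card X \<le> k \<and> card Y = 8 * card X \<and> (\<forall>x\<in>X. max 40 (sqrt (card X / n) * (n * p)) < card (nbrs E x \<inter> Y)))}
    \<le> 2 * C / n"
proof -
  define R where "R h = {X. X \<subseteq> {..<n} \<and> card X = h} \<times> {Y. Y \<subseteq> {..<n} \<and> card Y = 8 * h}" for h
  define D where "D = (\<lambda>(h, X, Y). {E. E \<subseteq> all_edges {..<n} \<and>
      (\<forall>x\<in>X. max 40 (sqrt (real h / n) * (n * p)) < card (nbrs E x \<inter> Y))})"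
  have finR: "finite (R h)" for h unfolding R_def by auto
  have "measure_pmf.prob (gnp n p) {E. E \<subseteq> all_edges {..<n} \<and> (\<exists>X Y. X \<subseteq> {..<n} \<and> Y \<subseteq> {..<n} \<and> X \<noteq> {} \<and>
      card X \<le> k \<and> card Y = 8 * card X \<and> (\<forall>x\<in>X. max 40 (sqrt (card X / n) * (n * p)) < card (nbrs E x \<inter> Y)))}
    \<le> (\<Sum>(h, X, Y)\<in>Sigma {1..k} R. (2304 * real h / n) ^ (10 * h))"
  proof (rule prob_UN_le[where C = D])
    show "finite (Sigma {1..k} R)" using finR by auto
    show "{E. E \<subseteq> all_edges {..<n} \<and> (\<exists>X Y. X \<subseteq> {..<n} \<and> Y \<subseteq> {..<n} \<and> X \<noteq> {} \<and>
      card X \<le> k \<and> card Y = 8 * card X \<and> (\<forall>x\<in>X. max 40 (sqrt (card X / n) * (n * p)) < card (nbrs E x \<inter> Y)))}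
      \<subseteq> (\<Union>i\<in>Sigma {1..k} R. D i)"
    proof
      fix E assume "E \<in> {E. E \<subseteq> all_edges {..<n} \<and> (\<exists>X Y. X \<subseteq> {..<n} \<and> Y \<subseteq> {..<n} \<and> X \<noteq> {} \<and>
      card X \<le> k \<and> card Y = 8 * card X \<and> (\<forall>x\<in>X. max 40 (sqrt (card X / n) * (n * p)) < card (nbrs E x \<inter> Y)))}"
      then obtain X Y where XY: "E \<subseteq> all_edges {..<n}" "X \<subseteq> {..<n}" "Y \<subseteq> {..<n}" "X \<noteq> {}" "card X \<le> k"
        "card Y = 8 * card X" "\<And>x. x \<in> X \<Longrightarrow> max 40 (sqrt (card X / n) * (n * p)) < card (nbrs E x \<inter> Y)"
        by blast
      have "finite X" using XY(2) finite_subset by blast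
      hence "1 \<le> card X" using XY(4) by (simp add: Suc_le_eq card_gt_0_iff)
      hence "(card X, X, Y) \<in> Sigma {1..k} R" using XY by (auto simp: R_def)
      moreover have "E \<in> D (card X, X, Y)" using XY(1,7) by (simp add: D_def)
      ultimately show "E \<in> (\<Union>i\<in>Sigma {1..k} R. D i)" by blast
    qed
    fix i assume i: "i \<in> Sigma {1..k} R"
    obtain h X Y where hXY: "i = (h, X, Y)" by (cases i)
    have "2304 * h \<le> 4 * C * k" using i hXY by (auto simp: C_def)
    hence "2304 * h \<le> n" using k by linarith
    thus "measure_pmf.prob (gnp n p) (D i) \<le> (case i of (h, X, Y) \<Rightarrow> (2304 * real h / n) ^ (10 * h))"
      using i hXY prob_dense_pair[OF p, of X n h Y] by (auto simp: D_def R_def)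
  qed
  also have "\<dots> = (\<Sum>h = 1..k. \<Sum>x\<in>R h. (2304 * real h / n) ^ (10 * h))"
    using finR by (subst sum.Sigma) (auto simp: split_def)
  also have "\<dots> = (\<Sum>h = 1..k. real (n choose h) * real (n choose (8 * h)) * (2304 * real h / n) ^ (10 * h))"
    by (simp add: R_def card_cartesian_product n_subsets)
  also have "\<dots> \<le> (\<Sum>h = 1..k. real C / n * (1 / 2) ^ (h - 1))"
  proof (rule sum_mono)
    fix h assume h: "h \<in> {1..k}"
    have C0: "0 < C" by (simp add: C_def)
    have h0: "0 < h" and hn: "4 * real C * real h \<le> n"
    proof -
      show "0 < h" using h by simp
      have "4 * C * h \<le> 4 * C * k" using h by simp
      hence "4 * C * h \<le> n" using k by linarith
      hence "real (4 * C * h) \<le> real n" by (rule of_nat_mono)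
      thus "4 * real C * real h \<le> n" by simp
    qed
    have n0: "0 < real n" using hn h0 C0 by (smt (verit) mult_pos_pos of_nat_0_less_iff)
    define y where "y = real h / n"
    have y: "0 < y" using h0 n0 by (simp add: y_def)
    have Cy: "real C * y \<le> 1 / 4" using hn n0 by (simp add: y_def field_simps)
    have b1: "real (n choose h) \<le> (3 / y) ^ h" using binomial_le_pow3[OF h0, of n] by (simp add: y_def)
    have "real (n choose (8 * h)) \<le> (3 * real n / real (8 * h)) ^ (8 * h)"
      using h0 by (intro binomial_le_pow3) auto
    also have "\<dots> \<le> (3 / y) ^ (8 * h)"
      using h0 n0 by (intro power_mono) (auto simp: y_def field_simps)
    finally have b2: "real (n choose (8 * h)) \<le> (3 / y) ^ (8 * h)" .
    have "real (n choose h) * real (n choose (8 * h)) * (2304 * real h / n) ^ (10 * h)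
      \<le> (3 / y) ^ h * (3 / y) ^ (8 * h) * (2304 * real h / n) ^ (10 * h)"
      using y by (intro mult_right_mono mult_mono b1 b2) auto
    also have "\<dots> = ((3 / y) ^ 9 * (2304 * y) ^ 10) ^ h"
    proof -
      have "(3 / y) ^ h * (3 / y) ^ (8 * h) = ((3 / y) ^ 9) ^ h"
        by (simp flip: power_add power_mult)
      moreover have "(2304 * real h / n) ^ (10 * h) = ((2304 * y) ^ 10) ^ h"
        by (simp add: y_def flip: power_mult)
      ultimately show ?thesis by (simp only: power_mult_distrib)
    qed
    also have "(3 / y) ^ 9 * (2304 * y) ^ 10 = real C * y"
    proof -
      have "y ^ 10 = y * y ^ 9" using power_Suc[of y 9] by simp
      hence "y ^ 10 / y ^ 9 = y" using y by simp
      moreover have "(3 / y) ^ 9 * (2304 * y) ^ 10 = 3 ^ 9 * 2304 ^ 10 * (y ^ 10 / y ^ 9)"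
        by (simp add: power_divide power_mult_distrib)
      moreover have "real C = 3 ^ 9 * 2304 ^ 10" by (simp add: C_def)
      ultimately show ?thesis by simp
    qed
    \<comment> \<open>One factor is kept out, since it supplies the decay \<open>1 / n\<close>; the
      others are bounded by \<open>1 / 4\<close>.\<close>
    also have "(real C * y) ^ h = real C * y * (real C * y) ^ (h - 1)"
      using h0 by (metis Suc_diff_1 power_Suc)
    also have "\<dots> \<le> real C * y * (1 / 4) ^ (h - 1)"
      using y Cy by (intro mult_left_mono power_mono) auto
    also have "\<dots> = real C / n * (h * (1 / 4) ^ (h - 1))" by (simp add: y_def)
    also have "\<dots> \<le> real C / n * (1 / 2) ^ (h - 1)"
    proof (intro mult_left_mono)
      \<comment> \<open>The prefactor \<open>h\<close> is absorbed by weakening the ratio from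
        \<open>1 / 4\<close> to \<open>1 / 2\<close>.\<close>
      have "h \<le> 2 ^ (h - 1)" using h0 less_exp[of "h - 1"] by linarith
      hence "real h \<le> real (2 ^ (h - 1))" by (rule of_nat_mono)
      hence "real h * (1 / 4) ^ (h - 1) \<le> 2 ^ (h - 1) * (1 / 4) ^ (h - 1)"
        by (intro mult_right_mono) auto
      also have "\<dots> = (2 * (1 / 4)) ^ (h - 1)" by (rule power_mult_distrib[symmetric])
      finally show "real h * (1 / 4) ^ (h - 1) \<le> (1 / 2) ^ (h - 1)" by simp
    qed simp
    finally show "real (n choose h) * real (n choose (8 * h)) * (2304 * real h / n) ^ (10 * h)
      \<le> real C / n * (1 / 2) ^ (h - 1)" .
  qed
  also have "\<dots> = real C / n * (\<Sum>h = 1..k. (1 / 2) ^ (h - 1))" by (simp add: sum_distrib_left)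
  also have "\<dots> \<le> real C / n * 2"
  proof (intro mult_left_mono)
    have "(\<Sum>h = 1..k. (1 / 2 :: real) ^ (h - 1)) = 2 - 2 * (1 / 2) ^ k"
      by (induction k) (simp_all add: power_one_over)
    thus "(\<Sum>h = 1..k. (1 / 2 :: real) ^ (h - 1)) \<le> 2" by simp
  qed simp
  finally show ?thesis by (simp add: mult.commute)
qed

lemma prob_joined:
  fixes p :: real
  assumes p: "0 \<le> p" "p \<le> 1"
  shows "measure_pmf.prob (gnp n p) {E. \<exists>(U, W)\<in>disjoint_pairs {..<n} k. card (E \<inter> cross_edges U W) \<le> p * (real k)\<^sup>2 / 2}
    \<le> 4 ^ n * exp (- (p * (real k)\<^sup>2 / 8))"
proof -
  have "measure_pmf.prob (gnp n p) {E. \<exists>(U, W)\<in>disjoint_pairs {..<n} k. card (E \<inter> cross_edges U W) \<le> p * (real k)\<^sup>2 / 2}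
    \<le> (\<Sum>x\<in>disjoint_pairs {..<n} k. exp (- (p * (real k)\<^sup>2 / 8)))"
  proof (rule prob_UN_le[OF finite_disjoint_pairs[OF finite_lessThan], where C = "\<lambda>(U, W). {E. card (E \<inter> cross_edges U W) \<le> p * (real k)\<^sup>2 / 2}"])
    show "{E. \<exists>(U, W)\<in>disjoint_pairs {..<n} k. card (E \<inter> cross_edges U W) \<le> p * (real k)\<^sup>2 / 2}
      \<subseteq> (\<Union>x\<in>disjoint_pairs {..<n} k. case x of (U, W) \<Rightarrow> {E. card (E \<inter> cross_edges U W) \<le> p * (real k)\<^sup>2 / 2})"
      by blast
    fix x assume x: "x \<in> disjoint_pairs {..<n} k"
    obtain U W where UW: "x = (U, W)" by (cases x)
    hence sub: "U \<subseteq> {..<n}" "W \<subseteq> {..<n}" "U \<inter> W = {}" "card U = k" "card W = k"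
      using x by (auto simp: disjoint_pairs_def)
    have img: "cross_edges U W = (\<lambda>(u, w). {u, w}) ` (U \<times> W)" by (auto simp: cross_edges_def)
    have inj: "inj_on (\<lambda>(u, w). {u, w}) (U \<times> W)" using sub(3) by (auto simp: inj_on_def doubleton_eq_iff)
    have card: "card (cross_edges U W) = k\<^sup>2"
      unfolding img using sub by (simp add: card_image[OF inj] card_cartesian_product power2_eq_square)
    have "cross_edges U W \<subseteq> all_edges {..<n}"
    proof
      fix e assume "e \<in> cross_edges U W"
      then obtain u w where "e = {u, w}" "u \<in> U" "w \<in> W" by (auto simp: cross_edges_def)
      thus "e \<in> all_edges {..<n}" using sub by (auto simp: all_edges_iff)
    qed
    hence "measure_pmf.prob (gnp n p) {E. {} \<subseteq> E \<and> card (E \<inter> cross_edges U W) \<le> p * (real k)\<^sup>2 / 2}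
      \<le> p ^ card ({} :: nat set set) * exp (3 / 4 * (p * (real k)\<^sup>2 / 2) - p * card (cross_edges U W) / 2)"
      using p by (intro gnp_lower_tail) auto
    also have "\<dots> = exp (- (p * (real k)\<^sup>2 / 8))" by (simp add: card)
    finally show "measure_pmf.prob (gnp n p) (case x of (U, W) \<Rightarrow> {E. card (E \<inter> cross_edges U W) \<le> p * (real k)\<^sup>2 / 2})
      \<le> exp (- (p * (real k)\<^sup>2 / 8))" by (simp add: UW)
  qed
  also have "\<dots> = card (disjoint_pairs {..<n} k) * exp (- (p * (real k)\<^sup>2 / 8))" by simp
  also have "\<dots> \<le> 4 ^ n * exp (- (p * (real k)\<^sup>2 / 8))"
  proof (rule mult_right_mono)
    have "real (card (disjoint_pairs {..<n} k)) \<le> real (4 ^ n)"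
      using of_nat_mono[OF card_disjoint_pairs[of "{..<n}" k], where 'a = real] by simp
    thus "real (card (disjoint_pairs {..<n} k)) \<le> 4 ^ n" by simp
  qed simp
  finally show ?thesis .
qed

lemma sum_subsets_power:
  fixes y :: real
  assumes "finite A" shows "(\<Sum>\<Gamma>\<in>Pow A. y ^ card \<Gamma>) = (1 + y) ^ card A"
  using prod_add[OF assms, of "\<lambda>_. y" "\<lambda>_. 1"] by (simp add: add.commute)

lemma card_all_edges_le: "card (all_edges {..<n}) \<le> n\<^sup>2"
proof -
  have "all_edges {..<n} \<subseteq> (\<lambda>(x, y). {x, y}) ` ({..<n} \<times> {..<n})"
  proof
    fix e assume "e \<in> all_edges {..<n}"
    then obtain x y where "e = {x, y}" "e \<subseteq> {..<n}" by (auto simp: all_edges_def card_2_iff)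
    thus "e \<in> (\<lambda>(x, y). {x, y}) ` ({..<n} \<times> {..<n})" by auto
  qed
  hence "card (all_edges {..<n}) \<le> card ((\<lambda>(x, y). {x, y}) ` ({..<n} \<times> {..<n}))"
    by (intro card_mono) auto
  also have "\<dots> \<le> card ({..<n} \<times> {..<n})" by (rule card_image_le) simp
  finally show ?thesis by (simp add: card_cartesian_product power2_eq_square)
qed

text \<open>The factor \<open>\<eta>\<close> makes the union over all \<open>\<Gamma>\<close> with at most \<open>m\<close> edges affordable: it is an
  exponential Markov bound for the sum of \<open>p ^ card \<Gamma>\<close>.\<close>

lemma prob_sparse_subgraph:
  fixes p \<eta> :: real
  assumes p: "0 \<le> p" "p \<le> 1" and \<eta>: "0 < \<eta>" "\<eta> \<le> 1"
    and B: "\<And>\<Gamma>. \<Gamma> \<in> \<G> \<Longrightarrow> B \<Gamma> \<subseteq> all_edges {..<n} - \<Gamma> \<and> k\<^sup>2 \<le> 2 * card (B \<Gamma>)"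
  shows "measure_pmf.prob (gnp n p) {E. E \<subseteq> all_edges {..<n} \<and>
      (\<exists>\<Gamma>\<in>\<G>. \<Gamma> \<subseteq> E \<and> card \<Gamma> \<le> m \<and> card (E \<inter> B \<Gamma>) \<le> p * (real k)\<^sup>2 / 8)}
    \<le> exp (\<eta> * p * n\<^sup>2 - p * (real k)\<^sup>2 / 8) / \<eta> ^ m"
proof -
  define A where "A = all_edges {..<n}"
  have finA: "finite A" by (simp add: A_def finite_all_edges)
  define I where "I = {\<Gamma> \<in> Pow A. \<Gamma> \<in> \<G> \<and> card \<Gamma> \<le> m}"
  have finI: "finite I" using finA by (simp add: I_def)
  have "measure_pmf.prob (gnp n p) {E. E \<subseteq> A \<and> (\<exists>\<Gamma>\<in>\<G>. \<Gamma> \<subseteq> E \<and> card \<Gamma> \<le> m \<and> card (E \<inter> B \<Gamma>) \<le> p * (real k)\<^sup>2 / 8)}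
    \<le> (\<Sum>\<Gamma>\<in>I. p ^ card \<Gamma> * exp (- (p * (real k)\<^sup>2 / 8)))"
  proof (rule prob_UN_le[OF finI, where C = "\<lambda>\<Gamma>. {E. \<Gamma> \<subseteq> E \<and> card (E \<inter> B \<Gamma>) \<le> p * (real k)\<^sup>2 / 8}"])
    show "{E. E \<subseteq> A \<and> (\<exists>\<Gamma>\<in>\<G>. \<Gamma> \<subseteq> E \<and> card \<Gamma> \<le> m \<and> card (E \<inter> B \<Gamma>) \<le> p * (real k)\<^sup>2 / 8)}
      \<subseteq> (\<Union>\<Gamma>\<in>I. {E. \<Gamma> \<subseteq> E \<and> card (E \<inter> B \<Gamma>) \<le> p * (real k)\<^sup>2 / 8})" by (auto simp: I_def)
    fix \<Gamma> assume "\<Gamma> \<in> I"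
    hence \<Gamma>: "\<Gamma> \<subseteq> A" "\<Gamma> \<in> \<G>" by (auto simp: I_def)
    have "measure_pmf.prob (gnp n p) {E. \<Gamma> \<subseteq> E \<and> card (E \<inter> B \<Gamma>) \<le> p * (real k)\<^sup>2 / 8}
      \<le> p ^ card \<Gamma> * exp (3 / 4 * (p * (real k)\<^sup>2 / 8) - p * card (B \<Gamma>) / 2)"
      using \<Gamma> B[OF \<Gamma>(2)] p by (intro gnp_lower_tail) (auto simp: A_def)
    also have "\<dots> \<le> p ^ card \<Gamma> * exp (- (p * (real k)\<^sup>2 / 8))"
    proof (rule mult_left_mono)
      have "real (k\<^sup>2) \<le> real (2 * card (B \<Gamma>))" using B[OF \<Gamma>(2)] by (intro of_nat_mono) auto
      hence "p * (real k)\<^sup>2 \<le> p * (2 * card (B \<Gamma>))" using p by (intro mult_left_mono) auto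
      moreover have "0 \<le> p * (real k)\<^sup>2" using p by simp
      ultimately show "exp (3 / 4 * (p * (real k)\<^sup>2 / 8) - p * card (B \<Gamma>) / 2) \<le> exp (- (p * (real k)\<^sup>2 / 8))" by simp
    qed (use p in simp)
    finally show "measure_pmf.prob (gnp n p) {E. \<Gamma> \<subseteq> E \<and> card (E \<inter> B \<Gamma>) \<le> p * (real k)\<^sup>2 / 8}
      \<le> p ^ card \<Gamma> * exp (- (p * (real k)\<^sup>2 / 8))" .
  qed
  also have "\<dots> \<le> (\<Sum>\<Gamma>\<in>I. (\<eta> * p) ^ card \<Gamma> / \<eta> ^ m * exp (- (p * (real k)\<^sup>2 / 8)))"
  proof (intro sum_mono mult_right_mono)
    fix \<Gamma> assume "\<Gamma> \<in> I"
    hence "\<eta> ^ m \<le> \<eta> ^ card \<Gamma>" using \<eta> by (intro power_decreasing) (auto simp: I_def)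
    hence "p ^ card \<Gamma> * \<eta> ^ m \<le> p ^ card \<Gamma> * \<eta> ^ card \<Gamma>" using p by (intro mult_left_mono) auto
    thus "p ^ card \<Gamma> \<le> (\<eta> * p) ^ card \<Gamma> / \<eta> ^ m" using \<eta> by (simp add: pos_le_divide_eq power_mult_distrib mult.commute)
  qed simp
  also have "\<dots> = (\<Sum>\<Gamma>\<in>I. (\<eta> * p) ^ card \<Gamma>) * (exp (- (p * (real k)\<^sup>2 / 8)) / \<eta> ^ m)"
    by (simp add: sum_distrib_right sum_divide_distrib)
  also have "\<dots> \<le> exp (\<eta> * p * n\<^sup>2) * (exp (- (p * (real k)\<^sup>2 / 8)) / \<eta> ^ m)"
  proof (rule mult_right_mono)
    have "(\<Sum>\<Gamma>\<in>I. (\<eta> * p) ^ card \<Gamma>) \<le> (\<Sum>\<Gamma>\<in>Pow A. (\<eta> * p) ^ card \<Gamma>)"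
      using finA p \<eta> by (intro sum_mono2) (auto simp: I_def)
    also have "\<dots> = (1 + \<eta> * p) ^ card A" by (rule sum_subsets_power[OF finA])
    also have "\<dots> \<le> exp (\<eta> * p) ^ card A"
      using p \<eta> exp_ge_add_one_self by (intro power_mono) auto
    also have "\<dots> = exp (\<eta> * p * card A)" by (simp add: exp_of_nat_mult[symmetric] mult.commute)
    also have "\<dots> \<le> exp (\<eta> * p * n\<^sup>2)"
    proof -
      have "real (card A) \<le> real (n\<^sup>2)" unfolding A_def by (rule of_nat_mono[OF card_all_edges_le])
      thus ?thesis using p \<eta> by (auto intro!: mult_left_mono)
    qed
    finally show "(\<Sum>\<Gamma>\<in>I. (\<eta> * p) ^ card \<Gamma>) \<le> exp (\<eta> * p * n\<^sup>2)" .
  qed (use \<eta> in simp)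
  also have "\<dots> = exp (\<eta> * p * n\<^sup>2 - p * (real k)\<^sup>2 / 8) / \<eta> ^ m"
    unfolding times_divide_eq_right exp_add[symmetric] by simp
  finally show ?thesis by (simp add: A_def)
qed

section \<open>Conclusion\<close>

text \<open>The family depends on \<open>n\<close> and \<open>k\<close> only. Its boosters can
  therefore be counted in the random graph before \<open>F\<close> is known.\<close>

definition nonhamiltonian_expanders :: "nat \<Rightarrow> nat \<Rightarrow> nat set set set" where
  "nonhamiltonian_expanders n k = {\<Gamma>. \<Gamma> \<subseteq> all_edges {..<n} \<and> expanding {..<n} k \<Gamma> \<and> joined {..<n} k \<Gamma> \<and>
     \<not> hamiltonian {..<n} \<Gamma>}"

definition spread :: "nat \<Rightarrow> nat \<Rightarrow> real \<Rightarrow> nat set set \<Rightarrow> bool" where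
  "spread n k a E \<longleftrightarrow> \<not> (\<exists>X Y. X \<subseteq> {..<n} \<and> Y \<subseteq> {..<n} \<and> X \<noteq> {} \<and> card X \<le> k \<and> card Y = 8 * card X \<and>
     (\<forall>x\<in>X. max 40 (sqrt (card X / n) * a) < card (nbrs E x \<inter> Y)))"

definition degrees_ok :: "nat \<Rightarrow> real \<Rightarrow> nat set set \<Rightarrow> bool" where
  "degrees_ok n a E \<longleftrightarrow> \<not> (\<exists>v<n. real (card (nbrs E v \<inter> {..<n} - {v})) < a / 2 \<or>
      2 * a < card (nbrs E v \<inter> {..<n} - {v}))"

lemma card_edges_le:
  fixes a :: real
  assumes "finite V" "E \<subseteq> all_edges V" "\<And>v. v \<in> V \<Longrightarrow> card (nbrs E v) \<le> 2 * a"
  shows "card E \<le> 2 * a * card V"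
proof -
  have fN: "finite (nbrs E v)" for v using nbrs_subset[OF assms(2), of v] assms(1) by (meson finite_Diff finite_subset)
  have "E \<subseteq> (\<Union>v\<in>V. (\<lambda>w. {v, w}) ` nbrs E v)"
  proof
    fix e assume e: "e \<in> E"
    hence "e \<in> all_edges V" using assms(2) by blast
    then obtain v w where vw: "e = {v, w}" "v \<in> V" by (auto simp: all_edges_def card_2_iff)
    hence "w \<in> nbrs E v" using e by (simp add: nbrs_def)
    thus "e \<in> (\<Union>v\<in>V. (\<lambda>w. {v, w}) ` nbrs E v)" using vw by blast
  qed
  hence "card E \<le> card (\<Union>v\<in>V. (\<lambda>w. {v, w}) ` nbrs E v)"
    using assms(1) fN by (intro card_mono) auto
  also have "\<dots> \<le> (\<Sum>v\<in>V. card ((\<lambda>w. {v, w}) ` nbrs E v))" by (rule card_UN_le[OF assms(1)])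
  also have "\<dots> \<le> (\<Sum>v\<in>V. card (nbrs E v))" by (intro sum_mono card_image_le fN)
  finally have "real (card E) \<le> real (\<Sum>v\<in>V. card (nbrs E v))" by (rule of_nat_mono)
  also have "\<dots> = (\<Sum>v\<in>V. real (card (nbrs E v)))" by simp
  also have "\<dots> \<le> (\<Sum>v\<in>V. 2 * a)" by (intro sum_mono assms)
  finally show ?thesis by (simp add: mult.commute)
qed

text \<open>The deterministic half, valid for each \<open>F\<close> separately. The bound 704 is
  \<open>16 * 44\<close>, so that 44 picks take up at most \<open>a / 16\<close> of a neighbourhood;
  the conditions on \<open>\<mu>\<close> are what the stars, the joining edges and the boosters
  require.\<close>

lemma compatible_hamilton_cycle_of_spread:
  fixes n k K L c :: nat and a p \<mu> :: real
  assumes E: "E \<subseteq> all_edges {..<n}" and a: "a = n * p" "0 < a" "704 \<le> a" "ln (2 * real n) \<le> 44 * a"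
    and deg: "degrees_ok n a E" and spr: "spread n k a E"
    and jn: "\<And>U W. (U, W) \<in> disjoint_pairs {..<n} k \<Longrightarrow> p * (real k)\<^sup>2 / 2 < card (E \<inter> cross_edges U W)"
    and boost: "\<And>\<Gamma>. \<Gamma> \<in> nonhamiltonian_expanders n k \<Longrightarrow> \<Gamma> \<subseteq> E \<Longrightarrow> card \<Gamma> \<le> (46 + c) * n \<Longrightarrow>
      p * (real k)\<^sup>2 / 8 < card (E \<inter> boosters {..<n} \<Gamma>)"
    and k: "1 \<le> k" "1000 * k \<le> n"
    and KL: "K = 672 * 44" "L = 1344 * 44"
    and \<mu>: "0 \<le> \<mu>" "2 ^ (L + 3) * \<mu> \<le> 1" "(44 + real K) * \<mu> \<le> 1 / 16" "16 * \<mu> * (46 + real c) * (real n)\<^sup>2 \<le> (real k)\<^sup>2"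
    and c: "(1 - (real k)\<^sup>2 / (8 * (real n)\<^sup>2)) ^ (c * n) * 4 ^ n < 1"
    and F: "incompatibility_system {..<n} E F" "bounded_system {..<n} E F (\<mu> * n * p)"
  shows "\<exists>C. hamilton_cycle {..<n} E C \<and> compatible_subgraph {..<n} F C"
proof -
  have n0: "0 < n" using k by linarith
  have p0: "0 < p" using a n0 by (simp add: zero_less_mult_iff)
  have nb: "nbrs E v \<inter> {..<n} - {v} = nbrs E v" for v using nbrs_subset[OF E] by blast
  define \<Delta> where "\<Delta> = \<mu> * n * p"
  have \<Delta>: "\<Delta> = \<mu> * a" by (simp add: \<Delta>_def a(1))
  interpret star_setup "{..<n}" E F \<Delta> a 44 K L
  proof
    show "bounded_system {..<n} E F \<Delta>" using F(2) by (simp add: \<Delta>_def)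
    show "a / 2 \<le> card (nbrs E v)" if "v \<in> {..<n}" for v
      using deg that unfolding degrees_ok_def nb by (fastforce simp: not_less)
    show "card (nbrs E v) \<le> 2 * a" if "v \<in> {..<n}" for v
      using deg that unfolding degrees_ok_def nb by (fastforce simp: not_less)
    show "2 ^ (L + 3) * \<Delta> \<le> a"
      using mult_right_mono[OF \<mu>(2), of a] a(2) by (simp add: \<Delta> mult.assoc)
    show "real (44 + K) * \<Delta> \<le> a / 16"
      using mult_right_mono[OF \<mu>(3), of a] a(2) by (simp add: \<Delta> mult.assoc)
  qed (use E F a KL n0 in auto)
  \<comment> \<open>Per vertex there are 44 star picks, \<open>c\<close> joining edges, and at most
    2 boosters since \<open>n + 1\<close> is at most \<open>2 * n\<close>. The left side bounds the
    edges that all of these rule out.\<close>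
  have key: "2 * \<Delta> * ((46 + c) * n) \<le> p * (real k)\<^sup>2 / 8"
  proof -
    have "2 * \<Delta> * ((46 + c) * n) = p * (16 * \<mu> * (46 + c) * (real n)\<^sup>2) / 8"
      by (simp add: \<Delta>_def power2_eq_square algebra_simps)
    also have "\<dots> \<le> p * (real k)\<^sup>2 / 8" using \<mu>(4) p0 by (intro divide_right_mono mult_left_mono) auto
    finally show ?thesis .
  qed
  have \<Delta>0: "0 \<le> \<Delta>" using \<mu>(1) a(2) by (simp add: \<Delta>)
  obtain \<Gamma>1 where \<Gamma>1: "\<Gamma>1 \<subseteq> E" "compatible_subgraph {..<n} F \<Gamma>1" "card \<Gamma>1 \<le> 44 * n" "expanding {..<n} k \<Gamma>1"
  proof -
    have "\<exists>\<Gamma>\<subseteq>E. compatible_subgraph {..<n} F \<Gamma> \<and> card \<Gamma> \<le> 44 * card {..<n} \<and> expanding {..<n} k \<Gamma>"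
    proof (rule expanding_stars)
      fix X Y :: "nat set"
      assume "X \<subseteq> {..<n}" "Y \<subseteq> {..<n}" "X \<noteq> {}" "card X \<le> k" "card Y = 8 * card X"
      thus "\<exists>x\<in>X. card (nbrs E x \<inter> Y) \<le> max 40 (sqrt (card X / card {..<n}) * a)"
        using spr unfolding spread_def by (metis card_lessThan not_less)
    qed (use k in auto)
    thus ?thesis using that by auto
  qed
  have "\<exists>\<Gamma>. \<Gamma>1 \<subseteq> \<Gamma> \<and> \<Gamma> \<subseteq> E \<and> compatible_subgraph {..<n} F \<Gamma> \<and> card \<Gamma> \<le> card \<Gamma>1 + c * n \<and> joined {..<n} k \<Gamma>"
  proof (rule joined_completion[OF \<Gamma>1(1,2), where q = "p * (real k)\<^sup>2 / 2" and Q = "2 * a * n"])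
    show "0 < p * (real k)\<^sup>2 / 2" using p0 k by simp
    show "p * (real k)\<^sup>2 / 2 \<le> card (E \<inter> cross_edges U W)" if "(U, W) \<in> disjoint_pairs {..<n} k" for U W
      using jn[OF that] by simp
    show "card E \<le> 2 * a * n" using card_edges_le[OF finite_V E deg_upper] by simp
    have "2 * \<Delta> * (card \<Gamma>1 + c * n) \<le> 2 * \<Delta> * ((46 + c) * n)"
    proof (rule mult_left_mono)
      have "card \<Gamma>1 + c * n \<le> (46 + c) * n" using \<Gamma>1(3) by (simp add: algebra_simps)
      thus "real (card \<Gamma>1 + c * n) \<le> real ((46 + c) * n)" by (rule of_nat_mono)
    qed (use \<Delta>0 in simp)
    also have "\<dots> \<le> p * (real k)\<^sup>2 / 8" by (rule key)
    also have "\<dots> \<le> p * (real k)\<^sup>2 / 2 / 2" using p0 by simp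
    finally show "2 * \<Delta> * (card \<Gamma>1 + c * n) \<le> p * (real k)\<^sup>2 / 2 / 2" .
    \<comment> \<open>The edge probability cancels, so the number \<open>c\<close> of joining edges
      per vertex depends only on the ratio of \<open>k\<close> to \<open>n\<close>.\<close>
    have "p * (real k)\<^sup>2 / 2 / (2 * (2 * a * n)) = (real k)\<^sup>2 / (8 * (real n)\<^sup>2)"
      using p0 by (simp add: a(1) power2_eq_square)
    thus "(1 - p * (real k)\<^sup>2 / 2 / (2 * (2 * a * n))) ^ (c * n) * 4 ^ card {..<n} < 1" using c by simp
  qed
  then obtain \<Gamma>2 where \<Gamma>2: "\<Gamma>1 \<subseteq> \<Gamma>2" "\<Gamma>2 \<subseteq> E" "compatible_subgraph {..<n} F \<Gamma>2"
    "card \<Gamma>2 \<le> card \<Gamma>1 + c * n" "joined {..<n} k \<Gamma>2" by blast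
  have exp2: "expanding {..<n} k \<Gamma>2"
    by (rule expanding_mono[OF \<Gamma>1(4) \<Gamma>2(1)]) (use \<Gamma>2(2) E in auto)
  show ?thesis
  proof (rule booster_completion[OF \<Gamma>2(2,3) exp2 \<Gamma>2(5)])
    fix \<Gamma> assume \<Gamma>: "\<Gamma> \<subseteq> E" "card \<Gamma> \<le> card \<Gamma>2 + card {..<n} + 1" "expanding {..<n} k \<Gamma>"
      "joined {..<n} k \<Gamma>" "\<not> hamiltonian {..<n} \<Gamma>"
    have cG: "card \<Gamma> \<le> (46 + c) * n" using \<Gamma>(2) \<Gamma>2(4) \<Gamma>1(3) n0 by (simp add: algebra_simps)
    have "2 * \<Delta> * card \<Gamma> \<le> 2 * \<Delta> * ((46 + c) * n)"
      using of_nat_mono[OF cG, where 'a = real] \<Delta>0 by (intro mult_left_mono) auto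
    also have "\<dots> \<le> p * (real k)\<^sup>2 / 8" by (rule key)
    also have "\<dots> < card (E \<inter> boosters {..<n} \<Gamma>)"
      using \<Gamma> cG E by (intro boost) (auto simp: nonhamiltonian_expanders_def)
    finally show "2 * \<Delta> * card \<Gamma> < card (E \<inter> boosters {..<n} \<Gamma>)" .
  qed
qed

lemma nonhamiltonian_expander_boosters:
  assumes "\<Gamma> \<in> nonhamiltonian_expanders n k" "1 \<le> k" "0 < n"
  shows "boosters {..<n} \<Gamma> \<subseteq> all_edges {..<n} - \<Gamma> \<and> k\<^sup>2 \<le> 2 * card (boosters {..<n} \<Gamma>)"
proof
  show "boosters {..<n} \<Gamma> \<subseteq> all_edges {..<n} - \<Gamma>" by (auto simp: boosters_def)
  show "k\<^sup>2 \<le> 2 * card (boosters {..<n} \<Gamma>)"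
    using posa_boosters[of "{..<n}" k \<Gamma>] assms by (auto simp: nonhamiltonian_expanders_def power2_eq_square)
qed

lemma prob_good:
  fixes n k c :: nat and a p \<eta> :: real
  assumes p: "0 \<le> p" "p \<le> 1" and a: "a = n * p" and k: "1 \<le> k" "4 * (3 ^ 9 * 2304 ^ 10) * k \<le> n"
    and \<eta>: "0 < \<eta>" "\<eta> \<le> 1"
    and good: "\<And>E. E \<subseteq> all_edges {..<n} \<Longrightarrow> degrees_ok n a E \<Longrightarrow> spread n k a E \<Longrightarrow>
      (\<And>U W. (U, W) \<in> disjoint_pairs {..<n} k \<Longrightarrow> p * (real k)\<^sup>2 / 2 < card (E \<inter> cross_edges U W)) \<Longrightarrow>
      (\<And>\<Gamma>. \<Gamma> \<in> nonhamiltonian_expanders n k \<Longrightarrow> \<Gamma> \<subseteq> E \<Longrightarrow> card \<Gamma> \<le> m \<Longrightarrow>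
        p * (real k)\<^sup>2 / 8 < card (E \<inter> boosters {..<n} \<Gamma>)) \<Longrightarrow> P E"
  shows "1 - (3 * n * exp (- (a / 8)) + 2 * (3 ^ 9 * 2304 ^ 10) / n + 4 ^ n * exp (- (p * (real k)\<^sup>2 / 8)) +
      exp (\<eta> * p * n\<^sup>2 - p * (real k)\<^sup>2 / 8) / \<eta> ^ m) \<le> measure_pmf.prob (gnp n p) {E. P E}"
proof -
  let ?A = "all_edges {..<n}" and ?pr = "measure_pmf.prob (gnp n p)"
  define B1 where "B1 = {E. \<not> degrees_ok n a E}"
  define B2 where "B2 = {E. E \<subseteq> ?A \<and> \<not> spread n k a E}"
  define B3 where "B3 = {E. \<exists>(U, W)\<in>disjoint_pairs {..<n} k. card (E \<inter> cross_edges U W) \<le> p * (real k)\<^sup>2 / 2}"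
  define B4 where "B4 = {E. E \<subseteq> ?A \<and> (\<exists>\<Gamma>\<in>nonhamiltonian_expanders n k. \<Gamma> \<subseteq> E \<and> card \<Gamma> \<le> m \<and>
    card (E \<inter> boosters {..<n} \<Gamma>) \<le> p * (real k)\<^sup>2 / 8)}"
  have n0: "0 < n"
  proof -
    have "1 * 1 \<le> 4 * (3 ^ 9 * 2304 ^ 10) * k" using k(1) by (intro mult_le_mono) auto
    thus ?thesis using k(2) by linarith
  qed
  have b1: "?pr B1 \<le> 3 * n * exp (- (a / 8))"
    using prob_degrees[OF p, of n] unfolding B1_def degrees_ok_def a by simp
  have b2: "?pr B2 \<le> 2 * (3 ^ 9 * 2304 ^ 10) / n"
    using prob_spread[OF p k(2)] unfolding B2_def spread_def a not_not by simp
  have b3: "?pr B3 \<le> 4 ^ n * exp (- (p * (real k)\<^sup>2 / 8))"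
    unfolding B3_def by (rule prob_joined[OF p])
  have b4: "?pr B4 \<le> exp (\<eta> * p * n\<^sup>2 - p * (real k)\<^sup>2 / 8) / \<eta> ^ m"
    using prob_sparse_subgraph[OF p \<eta>, of "nonhamiltonian_expanders n k" "boosters {..<n}" n k m]
      nonhamiltonian_expander_boosters[OF _ k(1) n0] unfolding B4_def by simp
  \<comment> \<open>\<open>B2\<close> and \<open>B4\<close> contain graphs only, so the covering is
    claimed on the support of the distribution.\<close>
  have "set_pmf (gnp n p) \<subseteq> {E. P E} \<union> (B1 \<union> B2 \<union> B3 \<union> B4)"
  proof
    fix E assume "E \<in> set_pmf (gnp n p)"
    hence E: "E \<subseteq> ?A" using set_pmf_gnp by blast
    show "E \<in> {E. P E} \<union> (B1 \<union> B2 \<union> B3 \<union> B4)"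
    proof (rule ccontr)
      assume "E \<notin> {E. P E} \<union> (B1 \<union> B2 \<union> B3 \<union> B4)"
      hence nP: "\<not> P E" and nB: "E \<notin> B1" "E \<notin> B2" "E \<notin> B3" "E \<notin> B4" by auto
      have "P E"
      proof (rule good[OF E])
        show "degrees_ok n a E" using nB(1) by (simp add: B1_def)
        show "spread n k a E" using nB(2) E by (simp add: B2_def)
        show "p * (real k)\<^sup>2 / 2 < card (E \<inter> cross_edges U W)" if "(U, W) \<in> disjoint_pairs {..<n} k" for U W
          using nB(3) that unfolding B3_def by (auto simp: not_le)
        show "p * (real k)\<^sup>2 / 8 < card (E \<inter> boosters {..<n} \<Gamma>)"
          if "\<Gamma> \<in> nonhamiltonian_expanders n k" "\<Gamma> \<subseteq> E" "card \<Gamma> \<le> m" for \<Gamma>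
          using nB(4) that E unfolding B4_def by (auto simp: not_le)
      qed
      thus False using nP by simp
    qed
  qed
  hence "1 \<le> ?pr ({E. P E} \<union> (B1 \<union> B2 \<union> B3 \<union> B4))"
    by (metis measure_pmf.prob_eq_1 AE_measure_pmf_iff subsetD order_refl sets_measure_pmf UNIV_I)
  also have "\<dots> \<le> ?pr {E. P E} + (?pr B1 + ?pr B2 + ?pr B3 + ?pr B4)"
    using measure_Un_le[of "{E. P E}" "gnp n p" "B1 \<union> B2 \<union> B3 \<union> B4"] measure_Un_le[of "B1 \<union> B2 \<union> B3" "gnp n p" B4]
      measure_Un_le[of "B1 \<union> B2" "gnp n p" B3] measure_Un_le[of B1 "gnp n p" B2] by simp
  finally show ?thesis using b1 b2 b3 b4 by linarith
qed


lemma exp_neg_le_inverse: "0 < n \<Longrightarrow> exp (- real n) \<le> 1 / n"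
proof -
  assume "0 < n"
  moreover have "real n \<le> exp (real n)" using exp_ge_add_one_self[of "real n"] by linarith
  ultimately show ?thesis by (simp add: exp_minus inverse_eq_divide frac_le)
qed

theorem theorem1p2:
  shows "\<exists>\<mu>::real. \<mu> > 0 \<and>
    (\<forall>p :: nat \<Rightarrow> real.
       (\<forall>n. 0 \<le> p n \<and> p n \<le> 1) \<longrightarrow>
       filterlim (\<lambda>n. p n / (ln (real n) / real n)) at_top sequentially \<longrightarrow>
       asymptotically_almost_surely (\<lambda>n. gnp n (p n))
         (\<lambda>n E. \<forall>F. incompatibility_system {..<n} E F \<and>
                    bounded_system {..<n} E F (\<mu> * real n * p n) \<longrightarrow>
                    (\<exists>C. hamilton_cycle {..<n} E C \<and> compatible_subgraph {..<n} F C)))"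
proof -
  \<comment> \<open>\<open>D\<close> is four times the constant of the spread estimate: with
    \<open>k = n div D\<close>, the base of the geometric sum there is at most
    \<open>1 / 4\<close>.\<close>
  obtain D :: nat where D: "D = 4 * (3 ^ 9 * 2304 ^ 10)" by simp
  obtain K L :: nat where KL: "K = 672 * 44" "L = 1344 * 44" by simp
  have D1000: "1000 \<le> D" by (simp add: D)
  \<comment> \<open>For \<open>n\<close> at least \<open>2 * D\<close>, rounding down loses at most
    half, so \<open>k\<close> is at least \<open>\<epsilon> * n\<close>.\<close>
  define \<epsilon> where "\<epsilon> = 1 / (2 * real D)"
  \<comment> \<open>Makes \<open>c\<close> times \<open>\<epsilon> * \<epsilon> / 8\<close> equal to
    4: \<open>c * n\<close> joining edges leave a fraction \<open>exp (- 4 * n)\<close> of the at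
    most \<open>4 ^ n\<close> pairs, that is, none.\<close>
  define c where "c = 128 * D\<^sup>2"
  \<comment> \<open>With this choice the cost \<open>\<eta> * p * n * n\<close> of the union over
    subgraphs is at most half of the booster gain \<open>p * k * k / 8\<close>.\<close>
  define \<eta> where "\<eta> = \<epsilon>\<^sup>2 / 16"
  \<comment> \<open>The three terms keep, in this order, the exponential weight of conflicts, the
    conflicts at a vertex with its own picks, and the edges ruled out by the whole subgraph small
    enough.\<close>
  define \<mu> where "\<mu> = min (1 / 2 ^ (L + 3)) (min (1 / (16 * (44 + real K))) (\<epsilon>\<^sup>2 / (16 * (46 + real c))))"
  \<comment> \<open>The summand 704 serves the stars and the degree bound, the second one beats the
    \<open>4 ^ n\<close> pairs, and the third one beats \<open>1 / \<eta> ^ ((46 + c) * n)\<close>;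
    the last two each leave a factor \<open>exp (- n)\<close>.\<close>
  define M where "M = 704 + 32 / \<epsilon>\<^sup>2 + 16 * ((46 + real c) * ln (1 / \<eta>) + 1) / \<epsilon>\<^sup>2"
  have \<epsilon>: "0 < \<epsilon>" "\<epsilon> \<le> 1" using D1000 by (auto simp: \<epsilon>_def)
  have \<epsilon>2: "0 < \<epsilon>\<^sup>2" "\<epsilon>\<^sup>2 \<le> 1" using \<epsilon> by (auto simp: power_le_one)
  have \<eta>: "0 < \<eta>" "\<eta> \<le> 1" using \<epsilon>2 by (auto simp: \<eta>_def)
  have ln\<eta>: "0 \<le> ln (1 / \<eta>)" using \<eta> by (intro ln_ge_zero) auto
  have \<mu>0: "0 < \<mu>" using \<epsilon>2 by (simp add: \<mu>_def)
  have M704: "704 \<le> M" using \<epsilon>2 ln\<eta> by (simp add: M_def)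
  have M32: "32 / \<epsilon>\<^sup>2 \<le> M" using \<epsilon>2 ln\<eta> by (simp add: M_def)
  have Mln: "16 * ((46 + real c) * ln (1 / \<eta>) + 1) / \<epsilon>\<^sup>2 \<le> M" using \<epsilon>2 by (simp add: M_def)
  have "asymptotically_almost_surely (\<lambda>n. gnp n (p n))
         (\<lambda>n E. \<forall>F. incompatibility_system {..<n} E F \<and>
                    bounded_system {..<n} E F (\<mu> * real n * p n) \<longrightarrow>
                    (\<exists>C. hamilton_cycle {..<n} E C \<and> compatible_subgraph {..<n} F C))"
    if p: "\<forall>n. 0 \<le> p n \<and> p n \<le> 1" and lim: "filterlim (\<lambda>n. p n / (ln (real n) / real n)) at_top sequentially"
    for p :: "nat \<Rightarrow> real"
  proof -
    define P where "P n E \<longleftrightarrow> (\<forall>F. incompatibility_system {..<n} E F \<and>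
                    bounded_system {..<n} E F (\<mu> * real n * p n) \<longrightarrow>
                    (\<exists>C. hamilton_cycle {..<n} E C \<and> compatible_subgraph {..<n} F C))" for n E
    have "\<forall>\<^sub>F n in sequentially. M \<le> p n / (ln (real n) / real n)"
      using lim by (simp add: filterlim_at_top)
    hence lower: "\<forall>\<^sub>F n in sequentially. 1 - (5 + real D) / n \<le> measure_pmf.prob (gnp n (p n)) {E. P n E}"
      using eventually_ge_at_top[of "2 * D"]
    proof eventually_elim
      case (elim n)
      define k where "k = n div D"
      define a where "a = n * p n"
      have n: "2 * D \<le> n" "3 \<le> n" "0 < n" using elim(2) D1000 by linarith+
      have Dk: "D * k \<le> n" by (simp add: k_def)
      have k1: "1 \<le> k" using n(1) D1000 by (simp add: k_def div_greater_zero_iff Suc_le_eq)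
      have lnn: "1 \<le> ln (real n)"
      proof -
        have "exp 1 \<le> real n" using exp_le n(2) by linarith
        thus ?thesis using n(3) by (simp add: ln_ge_iff)
      qed
      have "0 < ln (real n)" using lnn by linarith
      hence "M * ln n \<le> a"
        using elim(1) n(3) by (simp add: a_def field_simps)
      hence aln: "704 * ln n \<le> a" and aM: "M \<le> a"
        using mult_right_mono[OF M704, of "ln n"] mult_left_mono[of 1 "ln n" M] lnn M704 by linarith+
      have a0: "0 < a" and a704: "704 \<le> a" using aM M704 by auto
      have p0: "0 \<le> p n" "p n \<le> 1" using p by auto
      have "real n \<le> 2 * (real D * real k)"
      proof -
        have "n mod D < D" using D1000 by simp
        moreover have "n = D * k + n mod D" by (simp add: k_def)
        ultimately have "n \<le> 2 * (D * k)" using n(1) by linarith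
        hence "real n \<le> real (2 * (D * k))" by (rule of_nat_mono)
        thus ?thesis by simp
      qed
      hence "\<epsilon> * n \<le> k" using D1000 by (simp add: \<epsilon>_def field_simps)
      hence "(\<epsilon> * n)\<^sup>2 \<le> (real k)\<^sup>2" using \<epsilon> by (intro power_mono) auto
      hence k2: "\<epsilon>\<^sup>2 * (real n)\<^sup>2 \<le> (real k)\<^sup>2" by (simp add: power_mult_distrib)
      have pk: "\<epsilon>\<^sup>2 * a * n \<le> p n * (real k)\<^sup>2"
        using mult_left_mono[OF k2 p0(1)] by (simp add: a_def power2_eq_square mult_ac)
      have kn: "k \<le> n" by (simp add: k_def)
      have cond: "(1 - (real k)\<^sup>2 / (8 * (real n)\<^sup>2)) ^ (c * n) * 4 ^ n < 1"
      proof -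
        define \<beta> where "\<beta> = (real k)\<^sup>2 / (8 * (real n)\<^sup>2)"
        have "\<epsilon>\<^sup>2 / 8 \<le> \<beta>" using k2 n(3) by (simp add: \<beta>_def field_simps)
        hence "c * (\<epsilon>\<^sup>2 / 8) \<le> c * \<beta>" by (rule mult_left_mono) simp
        moreover have "c * (\<epsilon>\<^sup>2 / 8) = 4" using D1000 by (simp add: c_def \<epsilon>_def power2_eq_square)
        ultimately have c\<beta>: "4 \<le> c * \<beta>" by linarith
        have "(real k)\<^sup>2 \<le> (real n)\<^sup>2" using kn by (intro power_mono) auto
        also have "\<dots> \<le> 8 * (real n)\<^sup>2" by simp
        finally have "\<beta> \<le> 1" using n(3) by (simp add: \<beta>_def)
        hence "(1 - \<beta>) ^ (c * n) \<le> exp (- \<beta>) ^ (c * n)"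
          using exp_ge_add_one_self[of "- \<beta>"] by (intro power_mono) auto
        also have "\<dots> = exp (- (c * \<beta>)) ^ n" by (simp add: exp_of_nat_mult[symmetric] mult_ac flip: power_mult)
        also have "\<dots> \<le> exp (- 4) ^ n" using c\<beta> by (intro power_mono) auto
        finally have "(1 - \<beta>) ^ (c * n) * 4 ^ n \<le> exp (- 4) ^ n * 4 ^ n" by (rule mult_right_mono) simp
        also have "\<dots> = (exp (- 4) * 4) ^ n" by (rule power_mult_distrib[symmetric])
        also have "\<dots> < 1"
        proof -
          have "exp (- 4) * 4 < (1::real)" using exp_ge_add_one_self[of "4::real"] by (simp add: exp_minus field_simps)
          thus ?thesis using n(3) by (intro power_less_one_iff[THEN iffD2]) auto
        qed
        finally show ?thesis by (simp add: \<beta>_def)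
      qed
      have \<mu>1: "2 ^ (L + 3) * \<mu> \<le> 1"
      proof -
        have "\<mu> \<le> 1 / 2 ^ (L + 3)" by (simp only: \<mu>_def min.cobounded1)
        thus ?thesis by (simp add: pos_le_divide_eq mult.commute)
      qed
      have \<mu>2: "(44 + real K) * \<mu> \<le> 1 / 16"
      proof -
        have "\<mu> \<le> 1 / (16 * (44 + real K))" unfolding \<mu>_def by (simp only: min.coboundedI2 min.cobounded1)
        hence "\<mu> * (16 * (44 + real K)) \<le> 1"
          by (subst (asm) pos_le_divide_eq) (auto intro: add_pos_nonneg)
        thus ?thesis by (simp add: algebra_simps)
      qed
      have \<mu>3: "16 * \<mu> * (46 + real c) * (real n)\<^sup>2 \<le> (real k)\<^sup>2"
      proof -
        have "\<mu> \<le> \<epsilon>\<^sup>2 / (16 * (46 + real c))" unfolding \<mu>_def by (simp only: min.coboundedI2 min.cobounded2)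
        hence "16 * \<mu> * (46 + real c) \<le> \<epsilon>\<^sup>2" by (simp add: field_simps)
        hence "16 * \<mu> * (46 + real c) * (real n)\<^sup>2 \<le> \<epsilon>\<^sup>2 * (real n)\<^sup>2" by (rule mult_right_mono) simp
        thus ?thesis using k2 by linarith
      qed
      have ln2n: "ln (2 * real n) \<le> 44 * a"
      proof -
        have "ln (2 * real n) = ln 2 + ln n" using n(3) by (simp add: ln_mult)
        also have "\<dots> \<le> 1 + ln n" using ln2_le_25_over_36 by simp
        also have "\<dots> \<le> 704 * ln n" using lnn by simp
        also have "\<dots> \<le> 44 * a" using aln a0 by linarith
        finally show ?thesis .
      qed
      have "1 - (3 * n * exp (- (a / 8)) + 2 * (3 ^ 9 * 2304 ^ 10) / n + 4 ^ n * exp (- (p n * (real k)\<^sup>2 / 8)) +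
        exp (\<eta> * p n * n\<^sup>2 - p n * (real k)\<^sup>2 / 8) / \<eta> ^ ((46 + c) * n)) \<le> measure_pmf.prob (gnp n (p n)) {E. P n E}"
      proof (rule prob_good[OF p0 a_def k1 _ \<eta>])
        show "4 * (3 ^ 9 * 2304 ^ 10) * k \<le> n" using Dk by (simp only: D)
        fix E assume E: "E \<subseteq> all_edges {..<n}" "degrees_ok n a E" "spread n k a E"
          "\<And>U W. (U, W) \<in> disjoint_pairs {..<n} k \<Longrightarrow> p n * (real k)\<^sup>2 / 2 < card (E \<inter> cross_edges U W)"
          "\<And>\<Gamma>. \<Gamma> \<in> nonhamiltonian_expanders n k \<Longrightarrow> \<Gamma> \<subseteq> E \<Longrightarrow> card \<Gamma> \<le> (46 + c) * n \<Longrightarrow>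
            p n * (real k)\<^sup>2 / 8 < card (E \<inter> boosters {..<n} \<Gamma>)"
        have "1000 * k \<le> D * k" using D1000 by (rule mult_le_mono1)
        hence k1000: "1000 * k \<le> n" using Dk by linarith
        show "P n E"
          unfolding P_def
        proof (intro allI impI, elim conjE)
          fix F assume F: "incompatibility_system {..<n} E F" "bounded_system {..<n} E F (\<mu> * real n * p n)"
          show "\<exists>C. hamilton_cycle {..<n} E C \<and> compatible_subgraph {..<n} F C"
            by (rule compatible_hamilton_cycle_of_spread[OF E(1) a_def a0 a704 ln2n E(2,3) _ _ k1 k1000 KL
              less_imp_le[OF \<mu>0] \<mu>1 \<mu>2 \<mu>3 cond F]) (rule E(4,5), assumption+)+
        qed
      qed
      moreover have "3 * n * exp (- (a / 8)) \<le> 3 / n"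
      proof -
        have "exp (- (a / 8)) \<le> exp (- (2 * ln n))" using aln lnn by simp
        also have "\<dots> = 1 / (real n)\<^sup>2"
        proof -
          have "exp (2 * ln (real n)) = (real n)\<^sup>2"
            using exp_of_nat_mult[of 2 "ln (real n)"] n(3) by simp
          thus ?thesis by (simp add: exp_minus inverse_eq_divide)
        qed
        finally have "3 * n * exp (- (a / 8)) \<le> 3 * n * (1 / (real n)\<^sup>2)" by (rule mult_left_mono) simp
        thus ?thesis using n(3) by (simp add: power2_eq_square)
      qed
      moreover have "2 * (3 ^ 9 * 2304 ^ 10) / n \<le> real D / n"
        by (intro divide_right_mono) (simp_all add: D)
      moreover have "4 ^ n * exp (- (p n * (real k)\<^sup>2 / 8)) \<le> 1 / n"
      proof -
        have "32 / \<epsilon>\<^sup>2 \<le> a" using M32 aM by linarith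
        hence "32 \<le> \<epsilon>\<^sup>2 * a" using \<epsilon>2(1) by (simp only: pos_divide_le_eq mult.commute)
        hence "32 * real n \<le> \<epsilon>\<^sup>2 * a * n" by (rule mult_right_mono) simp
        hence "exp (- (p n * (real k)\<^sup>2 / 8)) \<le> exp (- (4 * real n))" using pk by simp
        moreover have "(4::real) ^ n \<le> exp 3 ^ n"
          using exp_ge_add_one_self[of "3::real"] by (intro power_mono) auto
        ultimately have "4 ^ n * exp (- (p n * (real k)\<^sup>2 / 8)) \<le> exp 3 ^ n * exp (- (4 * real n))"
          by (intro mult_mono) auto
        also have "\<dots> = exp (- real n)" by (simp add: exp_of_nat_mult[symmetric] exp_add[symmetric])
        also have "\<dots> \<le> 1 / n" using n(3) by (rule exp_neg_le_inverse)
        finally show ?thesis .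
      qed
      moreover have "exp (\<eta> * p n * n\<^sup>2 - p n * (real k)\<^sup>2 / 8) / \<eta> ^ ((46 + c) * n) \<le> 1 / n"
      proof -
        have "1 / \<eta> ^ ((46 + c) * n) = exp (ln (1 / \<eta>)) ^ ((46 + c) * n)" using \<eta> by (simp add: power_one_over)
        also have "\<dots> = exp ((46 + real c) * n * ln (1 / \<eta>))" by (simp add: exp_of_nat_mult[symmetric] algebra_simps)
        finally have e: "1 / \<eta> ^ ((46 + c) * n) = exp ((46 + real c) * n * ln (1 / \<eta>))" .
        have "\<eta> * p n * n\<^sup>2 = \<epsilon>\<^sup>2 * a * n / 16" by (simp add: \<eta>_def a_def power2_eq_square)
        hence "\<eta> * p n * n\<^sup>2 - p n * (real k)\<^sup>2 / 8 \<le> - (\<epsilon>\<^sup>2 * a / 16 * n)" using pk by simp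
        moreover have "((46 + real c) * ln (1 / \<eta>) + 1) * n \<le> \<epsilon>\<^sup>2 * a / 16 * n"
        proof (rule mult_right_mono)
          have "16 * ((46 + real c) * ln (1 / \<eta>) + 1) / \<epsilon>\<^sup>2 \<le> a" using Mln aM by linarith
          hence "16 * ((46 + real c) * ln (1 / \<eta>) + 1) \<le> a * \<epsilon>\<^sup>2" using \<epsilon>2(1) by (simp only: pos_divide_le_eq)
          thus "(46 + real c) * ln (1 / \<eta>) + 1 \<le> \<epsilon>\<^sup>2 * a / 16" by (simp add: mult.commute)
        qed simp
        ultimately have "\<eta> * p n * n\<^sup>2 - p n * (real k)\<^sup>2 / 8 + (46 + real c) * n * ln (1 / \<eta>) \<le> - real n"
          by (simp add: algebra_simps)
        hence "exp (\<eta> * p n * n\<^sup>2 - p n * (real k)\<^sup>2 / 8 + (46 + real c) * n * ln (1 / \<eta>)) \<le> exp (- real n)" by simp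
        hence "exp (\<eta> * p n * n\<^sup>2 - p n * (real k)\<^sup>2 / 8) * (1 / \<eta> ^ ((46 + c) * n)) \<le> exp (- real n)"
          unfolding e exp_add[symmetric] .
        also have "\<dots> \<le> 1 / n" using n(3) by (rule exp_neg_le_inverse)
        finally show ?thesis by simp
      qed
      moreover have "(5 + real D) / n = 3 / n + real D / n + 1 / n + 1 / n" by (simp add: add_divide_distrib[symmetric])
      ultimately show ?case by linarith
    qed
    have upper: "\<forall>\<^sub>F n in sequentially. measure_pmf.prob (gnp n (p n)) {E. P n E} \<le> 1" by simp
    have "(\<lambda>n. 1 - (5 + real D) / real n) \<longlonglongrightarrow> 1 - 0"
      by (intro tendsto_intros lim_const_over_n)
    hence "(\<lambda>n. 1 - (5 + real D) / real n) \<longlonglongrightarrow> 1" by (simp only: diff_zero)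
    hence "(\<lambda>n. measure_pmf.prob (gnp n (p n)) {E. P n E}) \<longlonglongrightarrow> 1"
      by (rule tendsto_sandwich[OF lower upper _ tendsto_const])
    thus ?thesis unfolding asymptotically_almost_surely_def P_def .
  qed
  thus ?thesis using \<mu>0 by blast
qed

end
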